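(* Let $(A,\mathcal{L})$ be a polarized abelian variety of dimension $g$ and type $(d_1,\dots,d_g)$ over $\mathbb{C}$, given by a period matrix $(D\;Z)$, and let $1\le n\le g$. Under the identification of $\mathrm{NS}_{\mathbb{Q}}(A)$ with a subspace of $\wedge^2\mathbb{Q}^{2g}$ described in the context, the map $X\mapsto\alpha_X$ induces a bijection between the following two sets: (1) the set of abelian subvarieties of $A$ of dimension $n$; (2) the set of differential forms $\omega\in\wedge^2\mathbb{Q}^{2g}$ such that (a) $\omega\wedge dz_1\wedge\cdots\wedge dz_g=0$, and (b) for all $1\le r\le g$, $$\omega^{\wedge r}\wedge\theta^{\wedge(g-r)}=\begin{cases}\chi(\mathcal{L})\,n!\,\prod_{i=n+1}^{g}(i-r)\cdot\omega_0 & \text{if }1\le r\le n,\\ 0&\text{if } r\ge n+1,\end{cases}$$ where $\theta=-\sum_{i=1}^g d_i\,dx_i\wedge dx_{g+i}$ is the first Chern class of $\mathcal{L}$ and $\omega_0=(-1)^g dx_1\wedge dx_{g+1}\wedge\cdots\wedge dx_g\wedge dx_{2g}$.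
   Context: All abelian varieties are over $\mathbb{C}$. Write $A=V/\Lambda$ with $V$ a $g$-dimensional complex vector space. Given a basis of $V$, take a symplectic basis $\lambda_1,\dots,\lambda_g,\mu_1,\dots,\mu_g$ of $\Lambda$ for $\mathcal{L}$ such that with respect to these bases $A$ has period matrix $(D\;Z)$, $D=\mathrm{diag}(d_1,\dots,d_g)$, $Z$ in the Siegel upper half space $\mathcal{H}_g$ (symmetric complex $g\times g$ matrices with positive definite imaginary part). Let $x_1,\dots,x_{2g}$ be the real coordinates on $\Lambda\otimes\mathbb{R}=V$ for the basis of $\Lambda$, and $z_1,\dots,z_g$ the complex coordinates of $V$, so $(z_1,\dots,z_g)^t=(D\;Z)(x_1,\dots,x_{2g})^t$. Identify $H^2(A,\mathbb{Q})=\wedge^2\mathbb{Q}^{2g}$ with the $\mathbb{Q}$-vector space with basis $dx_i\wedge dx_j$, $1\le i<j\le 2g$. Via the first Chern class, $\mathrm{NS}_{\mathbb{Q}}(A)=(\mathrm{Pic}(A)/\mathrm{Pic}^0(A))\otimes\mathbb{Q}\simeq H^2(A,\mathbb{Q})\cap H^{1,1}(A)=\{\omega\in\wedge^2\mathbb{Q}^{2g}:\omega\wedge dz_1\wedge\cdots\wedge dz_g=0\}$, with sign convention such that the class of $\mathcal{L}$ corresponds to $\theta$. The Euler characteristic is $\chi(\mathcal{L})=d_1\cdots d_g$. For a line bundle $\mathcal{M}$, $\phi_{\mathcal{M}}:A\to\widehat A=\mathrm{Pic}^0(A)$ is $a\mapsto t_a^*\mathcal{M}\otimes\mathcal{M}^{-1}$;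 extend linearly to $\phi_\alpha\in\mathrm{Hom}(A,\widehat A)\otimes\mathbb{Q}$ for $\alpha\in\mathrm{NS}_{\mathbb{Q}}(A)$. Let $\mathrm{End}^s_{\mathbb{Q}}(A)\subseteq\mathrm{End}(A)\otimes\mathbb{Q}$ be the elements fixed by the Rosati involution $f\mapsto\phi_{\mathcal{L}}^{-1}\widehat f\phi_{\mathcal{L}}$; then $\varphi:\mathrm{NS}_{\mathbb{Q}}(A)\to\mathrm{End}_{\mathbb{Q}}^s(A)$, $\alpha\mapsto\phi_{\mathcal{L}}^{-1}\phi_\alpha$, is an isomorphism of $\mathbb{Q}$-vector spaces. For an abelian subvariety $\iota_X:X\hookrightarrow A$ of dimension $n\ge1$, with $\mathcal{L}|_X$ of type $(e_1,\dots,e_n)$, put $e_X=e_n$, $\psi_X=e_X\phi_{\mathcal{L}|_X}^{-1}:\widehat X\to X$, $N_X=\iota_X\psi_X\widehat\iota_X\phi_{\mathcal{L}}$, $\varepsilon_X=\frac{1}{e_X}N_X$ (a symmetric idempotent), and $\alpha_X=\varphi^{-1}(\varepsilon_X)\in\mathrm{NS}_{\mathbb{Q}}(A)$. *)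

theory Defs
  imports Complex_Main "HOL-Library.FuncSet" "Jordan_Normal_Form.VS_Connect"
begin

text \<open>
  Indices are 0-based throughout: the coordinates \<open>x\<^sub>1, \<dots>, x\<^sub>2\<^sub>g\<close> become \<open>x\<^sub>0, \<dots>, x\<^sub>2\<^sub>g\<^sub>-\<^sub>1\<close>,
  so that \<open>x\<^sub>g\<^sub>+\<^sub>i\<close> is paired with \<open>x\<^sub>i\<close> for \<open>i < g\<close>.
\<close>


section \<open>Exterior forms with constant coefficients\<close>

text \<open>
  An element of the complex exterior algebra on \<open>dx\<^sub>0, dx\<^sub>1, \<dots>\<close> is given by its coefficients: the
  value at \<open>S = {i\<^sub>1 < \<dots> < i\<^sub>k}\<close> is the coefficient of \<open>dx\<^sub>i\<^sub>1 \<and> \<dots> \<and> dx\<^sub>i\<^sub>k\<close>.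
\<close>

type_synonym form = "nat set \<Rightarrow> complex"

text \<open>The sign relating \<open>dx\<^sub>T \<and> dx\<^sub>U\<close> to \<open>dx\<close> of the union, for disjoint \<open>T\<close> and \<open>U\<close>.\<close>

definition wedge_sign :: "nat set \<Rightarrow> nat set \<Rightarrow> complex" where
  "wedge_sign T U = (-1) ^ card {(i, j). i \<in> T \<and> j \<in> U \<and> j < i}"

definition wedge :: "form \<Rightarrow> form \<Rightarrow> form" where
  "wedge a b = (\<lambda>S. \<Sum>T\<in>Pow S. wedge_sign T (S - T) * a T * b (S - T))"

definition form_one :: form where
  "form_one = (\<lambda>S. if S = {} then 1 else 0)"

definition wedge_list :: "form list \<Rightarrow> form" where
  "wedge_list as = foldr wedge as form_one"

definition wedge_power :: "form \<Rightarrow> nat \<Rightarrow> form" where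
  "wedge_power a r = wedge_list (replicate r a)"

definition dx :: "nat \<Rightarrow> form" where
  "dx i = (\<lambda>S. if S = {i} then 1 else 0)"

definition rational_two_forms :: "nat \<Rightarrow> form set" where
  "rational_two_forms m =
     {\<omega>. (\<forall>S. \<omega> S \<in> \<rat>) \<and> (\<forall>S. \<omega> S \<noteq> 0 \<longrightarrow> S \<subseteq> {..<m} \<and> card S = 2)}"


section \<open>Complex tori\<close>

text \<open>
  All tori below are of the form \<open>W / \<Gamma>\<close> with \<open>W\<close> a complex subspace of \<open>\<complex>\<^sup>g\<close> and \<open>\<Gamma>\<close> a lattice in
  \<open>W\<close>.
\<close>

definition complex_subspace :: "nat \<Rightarrow> complex vec set \<Rightarrow> bool" where
  "complex_subspace g W \<longleftrightarrow> subspace class_ring W (module_vec TYPE(complex) g)"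

definition complex_dim :: "nat \<Rightarrow> complex vec set \<Rightarrow> nat" where
  "complex_dim g W =
     vectorspace.dim class_ring ((module_vec TYPE(complex) g)\<lparr>carrier := W\<rparr>)"

text \<open>The columns of \<open>B\<close> form an \<open>\<real>\<close>-basis of \<open>W\<close> and generate \<open>\<Gamma>\<close> over \<open>\<int>\<close>.\<close>

definition lattice_basis ::
    "nat \<Rightarrow> complex vec set \<Rightarrow> complex vec set \<Rightarrow> complex mat \<Rightarrow> bool" where
  "lattice_basis g W \<Gamma> B \<longleftrightarrow> dim_row B = g \<and>
     bij_betw (\<lambda>x. B *\<^sub>v map_vec complex_of_real x) (carrier_vec (dim_col B)) W \<and>
     \<Gamma> = (\<lambda>x. B *\<^sub>v map_vec complex_of_int x) ` carrier_vec (dim_col B)"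

definition lattice_in :: "nat \<Rightarrow> complex vec set \<Rightarrow> complex vec set \<Rightarrow> bool" where
  "lattice_in g W \<Gamma> \<longleftrightarrow> (\<exists>B. lattice_basis g W \<Gamma> B)"

text \<open>Points of \<open>\<complex>\<^sup>g / \<Lambda>\<close> are cosets of \<open>\<Lambda>\<close>.\<close>

definition torus_point :: "complex vec set \<Rightarrow> complex vec \<Rightarrow> complex vec set" where
  "torus_point \<Lambda> v = (\<lambda>l. v + l) ` \<Lambda>"


section \<open>Line bundles\<close>

text \<open>
  By the theorem of Appell and Humbert, \<open>Pic (W / \<Gamma>)\<close> is the group of pairs \<open>(H, \<chi>)\<close> with \<open>H\<close> a
  hermitian form on \<open>W\<close> such that \<open>Im H\<close> is integral on \<open>\<Gamma>\<close>, and \<open>\<chi>\<close> a semicharacter of \<open>\<Gamma>\<close> for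
  \<open>Im H\<close>. The pair stands for the quotient of the trivial bundle \<open>W \<times> \<complex>\<close> by the action
  \<open>\<lambda> (v, t) = (v + \<lambda>, \<chi> \<lambda> * exp (\<pi> * H v \<lambda> + \<pi> / 2 * H \<lambda> \<lambda>) * t)\<close> of \<open>\<Gamma>\<close>. To make equality of such
  pairs extensional, \<open>H\<close> is taken to be 0 off \<open>W \<times> W\<close> and \<open>\<chi>\<close> to be 1 off \<open>\<Gamma>\<close>.
\<close>

type_synonym line_bundle = "(complex vec \<Rightarrow> complex vec \<Rightarrow> complex) \<times> (complex vec \<Rightarrow> complex)"

definition hermitian_form ::
    "complex vec set \<Rightarrow> (complex vec \<Rightarrow> complex vec \<Rightarrow> complex) \<Rightarrow> bool" where
  "hermitian_form W H \<longleftrightarrow>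
     (\<forall>v w. v \<notin> W \<or> w \<notin> W \<longrightarrow> H v w = 0) \<and>
     (\<forall>u\<in>W. \<forall>v\<in>W. \<forall>w\<in>W. H (u + v) w = H u w + H v w) \<and>
     (\<forall>c. \<forall>v\<in>W. \<forall>w\<in>W. H (c \<cdot>\<^sub>v v) w = c * H v w) \<and>
     (\<forall>v\<in>W. \<forall>w\<in>W. H w v = cnj (H v w))"

definition Pic :: "complex vec set \<Rightarrow> complex vec set \<Rightarrow> line_bundle set" where
  "Pic W \<Gamma> = {(H, \<chi>).
     hermitian_form W H \<and>
     (\<forall>l\<in>\<Gamma>. \<forall>m\<in>\<Gamma>. Im (H l m) \<in> \<int>) \<and>
     (\<forall>l. l \<notin> \<Gamma> \<longrightarrow> \<chi> l = 1) \<and>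
     (\<forall>l\<in>\<Gamma>. cmod (\<chi> l) = 1) \<and>
     (\<forall>l\<in>\<Gamma>. \<forall>m\<in>\<Gamma>. \<chi> (l + m) = \<chi> l * \<chi> m * exp (\<i> * pi * Im (H l m)))}"

definition tensor :: "line_bundle \<Rightarrow> line_bundle \<Rightarrow> line_bundle" where
  "tensor M N = ((\<lambda>v w. fst M v w + fst N v w), (\<lambda>l. snd M l * snd N l))"

definition dual_bundle :: "line_bundle \<Rightarrow> line_bundle" where
  "dual_bundle M = ((\<lambda>v w. - fst M v w), (\<lambda>l. inverse (snd M l)))"

text \<open>Pullback along the translation by the point of \<open>W / \<Gamma>\<close> represented by \<open>v\<close>.\<close>

definition translate ::
    "complex vec set \<Rightarrow> complex vec \<Rightarrow> line_bundle \<Rightarrow> line_bundle" where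
  "translate \<Gamma> v M =
     (fst M, (\<lambda>l. if l \<in> \<Gamma> then snd M l * exp (2 * pi * \<i> * Im (fst M v l)) else 1))"

text \<open>Pullback along the inclusion of the subtorus \<open>W / \<Gamma>\<close>.\<close>

definition restrict_bundle ::
    "complex vec set \<Rightarrow> complex vec set \<Rightarrow> line_bundle \<Rightarrow> line_bundle" where
  "restrict_bundle W \<Gamma> M =
     ((\<lambda>v w. if v \<in> W \<and> w \<in> W then fst M v w else 0), (\<lambda>l. if l \<in> \<Gamma> then snd M l else 1))"

definition polarization ::
    "complex vec set \<Rightarrow> complex vec set \<Rightarrow> line_bundle \<Rightarrow> bool" where
  "polarization W \<Gamma> L \<longleftrightarrow> L \<in> Pic W \<Gamma> \<and> (\<forall>v\<in>W. v \<noteq> 0\<^sub>v (dim_vec v) \<longrightarrow> Re (fst L v v) > 0)"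

text \<open>
  The first Chern class of \<open>(H, \<chi>)\<close> is the alternating form \<open>Im H\<close>, written out in the coordinates
  belonging to the lattice basis given by the columns of \<open>P\<close>.
\<close>

definition chern_class :: "complex mat \<Rightarrow> line_bundle \<Rightarrow> form" where
  "chern_class P M = (\<lambda>S. \<Sum>j<dim_col P. \<Sum>i<j.
     complex_of_real (Im (fst M (col P i) (col P j))) * wedge (dx i) (dx j) S)"

definition elementary_divisors :: "nat list \<Rightarrow> bool" where
  "elementary_divisors ds \<longleftrightarrow>
     (\<forall>i<length ds. 0 < ds ! i) \<and> (\<forall>i. Suc i < length ds \<longrightarrow> ds ! i dvd ds ! Suc i)"

definition has_type ::
    "nat \<Rightarrow> complex vec set \<Rightarrow> complex vec set \<Rightarrow> line_bundle \<Rightarrow> nat list \<Rightarrow> bool" where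
  "has_type g W \<Gamma> L es \<longleftrightarrow> elementary_divisors es \<and>
     (\<exists>B. lattice_basis g W \<Gamma> B \<and> dim_col B = 2 * length es \<and>
       (\<forall>i<length es. \<forall>j<length es.
          Im (fst L (col B i) (col B j)) = 0 \<and>
          Im (fst L (col B (length es + i)) (col B (length es + j))) = 0 \<and>
          Im (fst L (col B i) (col B (length es + j))) = (if i = j then real (es ! i) else 0)))"

definition exponent :: "nat \<Rightarrow> complex vec set \<Rightarrow> complex vec set \<Rightarrow> line_bundle \<Rightarrow> nat" where
  "exponent g W \<Gamma> L = last (SOME es. has_type g W \<Gamma> L es)"


section \<open>The dual torus and the homomorphisms attached to line bundles\<close>

text \<open>
  The dual torus of \<open>W / \<Gamma>\<close> is the quotient of the space of antilinear functionals on \<open>W\<close> by the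
  functionals whose imaginary part is integral on \<open>\<Gamma>\<close>. It is identified with \<open>Pic\<^sup>0 (W / \<Gamma>)\<close>
  by sending \<open>l\<close> to the line bundle with \<open>H = 0\<close> and character \<open>exp (2 \<pi> \<i> Im l)\<close>.
\<close>

type_synonym functional = "complex vec \<Rightarrow> complex"

definition antidual :: "complex vec set \<Rightarrow> functional set" where
  "antidual W = {l.
     (\<forall>v. v \<notin> W \<longrightarrow> l v = 0) \<and>
     (\<forall>v\<in>W. \<forall>w\<in>W. l (v + w) = l v + l w) \<and>
     (\<forall>c. \<forall>v\<in>W. l (c \<cdot>\<^sub>v v) = cnj c * l v)}"

definition Pic0_point :: "complex vec set \<Rightarrow> functional \<Rightarrow> line_bundle" where
  "Pic0_point \<Gamma> l =
     ((\<lambda>v w. 0), (\<lambda>m. if m \<in> \<Gamma> then exp (2 * pi * \<i> * Im (l m)) else 1))"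

text \<open>
  Homomorphisms of complex tori are identified with the linear maps between the tangent spaces
  that induce them (their analytic representations), and elements of \<open>Hom \<otimes> \<rat>\<close> with the
  corresponding rational multiples. Thus \<open>phi W \<Gamma> M\<close> is the unique complex linear map on \<open>W\<close> that
  induces the homomorphism sending \<open>a\<close> to the translate of \<open>M\<close> by \<open>a\<close> tensored with the inverse
  of \<open>M\<close>.
\<close>

definition linear_to_antidual ::
    "complex vec set \<Rightarrow> (complex vec \<Rightarrow> functional) \<Rightarrow> bool" where
  "linear_to_antidual W F \<longleftrightarrow>
     (\<forall>v. v \<notin> W \<longrightarrow> F v = (\<lambda>w. 0)) \<and>
     (\<forall>v\<in>W. F v \<in> antidual W) \<and>
     (\<forall>u\<in>W. \<forall>v\<in>W. F (u + v) = (\<lambda>w. F u w + F v w)) \<and>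
     (\<forall>c. \<forall>v\<in>W. F (c \<cdot>\<^sub>v v) = (\<lambda>w. c * F v w))"

definition phi ::
    "complex vec set \<Rightarrow> complex vec set \<Rightarrow> line_bundle \<Rightarrow> complex vec \<Rightarrow> functional" where
  "phi W \<Gamma> M = (THE F. linear_to_antidual W F \<and>
     (\<forall>v\<in>W. Pic0_point \<Gamma> (F v) = tensor (translate \<Gamma> v M) (dual_bundle M)))"

definition phi_inverse ::
    "complex vec set \<Rightarrow> complex vec set \<Rightarrow> line_bundle \<Rightarrow> functional \<Rightarrow> complex vec" where
  "phi_inverse W \<Gamma> L = the_inv_into W (phi W \<Gamma> L)"


section \<open>Abelian subvarieties and their symmetric idempotents\<close>

text \<open>
  An abelian subvariety is a complex subtorus, i.e. the image of a complex subspace \<open>W\<close> in which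
  the intersection of \<open>W\<close> with \<open>\<Lambda>\<close> is a lattice; a polarization of the ambient torus restricts
  to one on it.
\<close>

definition is_tangent_space ::
    "nat \<Rightarrow> complex vec set \<Rightarrow> complex vec set set \<Rightarrow> complex vec set \<Rightarrow> bool" where
  "is_tangent_space g \<Lambda> X W \<longleftrightarrow>
     complex_subspace g W \<and> lattice_in g W (W \<inter> \<Lambda>) \<and> X = torus_point \<Lambda> ` W"

definition abelian_subvariety :: "nat \<Rightarrow> complex vec set \<Rightarrow> complex vec set set \<Rightarrow> bool" where
  "abelian_subvariety g \<Lambda> X \<longleftrightarrow> (\<exists>W. is_tangent_space g \<Lambda> X W)"

definition tangent_space ::
    "nat \<Rightarrow> complex vec set \<Rightarrow> complex vec set set \<Rightarrow> complex vec set" where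
  "tangent_space g \<Lambda> X = (THE W. is_tangent_space g \<Lambda> X W)"

definition variety_dim :: "nat \<Rightarrow> complex vec set \<Rightarrow> complex vec set set \<Rightarrow> nat" where
  "variety_dim g \<Lambda> X = complex_dim g (tangent_space g \<Lambda> X)"

definition sub_exponent ::
    "nat \<Rightarrow> complex vec set \<Rightarrow> line_bundle \<Rightarrow> complex vec set set \<Rightarrow> nat" where
  "sub_exponent g \<Lambda> L X = (let W = tangent_space g \<Lambda> X in
     exponent g W (W \<inter> \<Lambda>) (restrict_bundle W (W \<inter> \<Lambda>) L))"

definition psi ::
    "nat \<Rightarrow> complex vec set \<Rightarrow> line_bundle \<Rightarrow> complex vec set set \<Rightarrow> functional \<Rightarrow> complex vec" where
  "psi g \<Lambda> L X l = (let W = tangent_space g \<Lambda> X in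
     of_nat (sub_exponent g \<Lambda> L X) \<cdot>\<^sub>v
       phi_inverse W (W \<inter> \<Lambda>) (restrict_bundle W (W \<inter> \<Lambda>) L) l)"

text \<open>The dual of the inclusion, i.e. the restriction of line bundles to the subvariety.\<close>

definition inclusion_dual ::
    "nat \<Rightarrow> complex vec set \<Rightarrow> complex vec set set \<Rightarrow> functional \<Rightarrow> functional" where
  "inclusion_dual g \<Lambda> X l = (\<lambda>w. if w \<in> tangent_space g \<Lambda> X then l w else 0)"

definition norm_endo ::
    "nat \<Rightarrow> complex vec set \<Rightarrow> line_bundle \<Rightarrow> complex vec set set \<Rightarrow> complex vec \<Rightarrow> complex vec" where
  "norm_endo g \<Lambda> L X = (\<lambda>v\<in>carrier_vec g.
     psi g \<Lambda> L X (inclusion_dual g \<Lambda> X (phi (carrier_vec g) \<Lambda> L v)))"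

definition epsilon ::
    "nat \<Rightarrow> complex vec set \<Rightarrow> line_bundle \<Rightarrow> complex vec set set \<Rightarrow> complex vec \<Rightarrow> complex vec" where
  "epsilon g \<Lambda> L X = (\<lambda>v\<in>carrier_vec g.
     (1 / of_nat (sub_exponent g \<Lambda> L X)) \<cdot>\<^sub>v norm_endo g \<Lambda> L X v)"


section \<open>The abelian variety with a given period matrix\<close>

definition siegel_space :: "nat \<Rightarrow> complex mat set" where
  "siegel_space g = {Z \<in> carrier_mat g g. transpose_mat Z = Z \<and>
     (\<forall>x\<in>carrier_vec g. x \<noteq> 0\<^sub>v g \<longrightarrow> x \<bullet> (map_mat Im Z *\<^sub>v x) > 0)}"

text \<open>The matrix \<open>(D Z)\<close>; its columns are the lattice vectors \<open>\<lambda>\<^sub>0, \<dots>, \<lambda>\<^sub>g\<^sub>-\<^sub>1, \<mu>\<^sub>0, \<dots>, \<mu>\<^sub>g\<^sub>-\<^sub>1\<close>.\<close>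

definition period_matrix :: "nat list \<Rightarrow> complex mat \<Rightarrow> complex mat" where
  "period_matrix ds Z = (let g = length ds in
     mat g (2 * g) (\<lambda>(i, j).
       if j < g then (if i = j then of_nat (ds ! i) else 0) else Z $$ (i, j - g)))"

definition period_lattice :: "nat list \<Rightarrow> complex mat \<Rightarrow> complex vec set" where
  "period_lattice ds Z =
     (\<lambda>x. period_matrix ds Z *\<^sub>v map_vec complex_of_int x) ` carrier_vec (2 * length ds)"

definition dz :: "nat list \<Rightarrow> complex mat \<Rightarrow> nat \<Rightarrow> form" where
  "dz ds Z k = (\<lambda>S. \<Sum>i<2 * length ds. period_matrix ds Z $$ (k, i) * dx i S)"

definition theta :: "nat list \<Rightarrow> form" where
  "theta ds = (\<lambda>S. - (\<Sum>i<length ds. of_nat (ds ! i) * wedge (dx i) (dx (length ds + i)) S))"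

definition omega0 :: "nat \<Rightarrow> form" where
  "omega0 g = (\<lambda>S. (-1) ^ g * wedge_list (map (\<lambda>i. wedge (dx i) (dx (g + i))) [0..<g]) S)"

definition NS_rat :: "nat list \<Rightarrow> complex mat \<Rightarrow> form set" where
  "NS_rat ds Z = {\<omega> \<in> rational_two_forms (2 * length ds).
     wedge \<omega> (wedge_list (map (dz ds Z) [0..<length ds])) = (\<lambda>S. 0)}"

text \<open>
  The linear extension of \<open>M \<mapsto> \<phi>\<^sub>M\<close> to the rational Neron-Severi group: if \<open>m \<alpha>\<close> is the class of a
  line bundle \<open>M\<close>, then the value at \<open>\<alpha>\<close> is \<open>\<phi>\<^sub>M / m\<close>.
\<close>

definition phi_rat :: "nat list \<Rightarrow> complex mat \<Rightarrow> form \<Rightarrow> complex vec \<Rightarrow> functional" where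
  "phi_rat ds Z \<alpha> = (THE F. \<exists>m>0. \<exists>M\<in>Pic (carrier_vec (length ds)) (period_lattice ds Z).
     chern_class (period_matrix ds Z) M = (\<lambda>S. of_nat m * \<alpha> S) \<and>
     F = (\<lambda>v w. phi (carrier_vec (length ds)) (period_lattice ds Z) M v w / of_nat m))"

definition NS_to_End ::
    "nat list \<Rightarrow> complex mat \<Rightarrow> line_bundle \<Rightarrow> form \<Rightarrow> complex vec \<Rightarrow> complex vec" where
  "NS_to_End ds Z L \<alpha> = (\<lambda>v\<in>carrier_vec (length ds).
     phi_inverse (carrier_vec (length ds)) (period_lattice ds Z) L (phi_rat ds Z \<alpha> v))"

definition alpha ::
    "nat list \<Rightarrow> complex mat \<Rightarrow> line_bundle \<Rightarrow> complex vec set set \<Rightarrow> form" where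
  "alpha ds Z L X =
     the_inv_into (NS_rat ds Z) (NS_to_End ds Z L) (epsilon (length ds) (period_lattice ds Z) L X)"

end

theory Submission
  imports Defs
    "HOL-Computational_Algebra.Fundamental_Theorem_Algebra"
    "HOL-Analysis.Continuum_Not_Denumerable"
begin

text \<open>
  Let \<open>H\<close> be the hermitian form of the polarization and \<open>E = Im H\<close>. A class \<open>\<omega>\<close> in the rational
  Neron-Severi group corresponds to the \<open>H\<close>-self-adjoint endomorphism \<open>f\<close> with
  \<open>\<omega>(v, w) = E(f v, w)\<close>, and \<open>\<epsilon>\<^sub>X\<close> is the \<open>H\<close>-orthogonal projection onto the tangent space of \<open>X\<close>.
  In an \<open>H\<close>-orthonormal eigenbasis of \<open>f\<close> with eigenvalues \<open>a\<^sub>k\<close> one has \<open>\<theta> = \<Sum> \<eta>\<^sub>k\<close> and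
  \<open>\<omega> = \<Sum> a\<^sub>k \<eta>\<^sub>k\<close> with commuting \<open>\<eta>\<^sub>k\<close> of square zero, so that
  \<open>(\<theta> + t \<omega>)\<^sup>g = \<Prod> (1 + t a\<^sub>k) \<theta>\<^sup>g\<close>. Comparing coefficients of \<open>t\<close>, the numerical conditions say that
  exactly \<open>n\<close> of the \<open>a\<^sub>k\<close> are 1 and the others are 0, i.e. that \<open>f\<close> is a projection of rank \<open>n\<close>. Such
  an \<open>f\<close> is rational on \<open>\<Lambda>\<close>, so its image meets \<open>\<Lambda>\<close> in a lattice and is the tangent space of an
  abelian subvariety.
\<close>

section \<open>The algebra of forms\<close>

text \<open>Most objects in the statement are given by descriptions or choices (\<open>phi\<close>,
  \<open>tangent_space\<close>, \<open>exponent\<close>, \<open>phi_rat\<close>,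
  \<open>the_inv_into\<close>), so each must be shown to be well defined before it can be computed.
  \<open>tangent_space\<close> needs uniqueness, \<open>exponent\<close> a symplectic basis of W
  \<inter> \<Lambda>; the exponent then cancels from \<open>epsilon\<close>, once it is known to be
  nonzero. The same elementary divisor argument proves in the converse direction that W \<inter>
  \<Lambda> is a lattice, which is why it starts from a group of vectors and not from a lattice.
  Condition (a) is the (1,1) condition: the alternating form of \<omega> is invariant under
  multiplication by i, hence is the imaginary part of a hermitian form, from which Riesz
  representation produces f. The constant in (b) comes from n! prod (i - r) = n! (g - r)! / (n - r)!
  for r \<le> n, which times the binomial coefficient g over r is g! times n over r, the coefficient
  of t^r in g! (1 + t)^n. The case r = 0, absent from (b), is \<theta>^g = g! \<chi>(L) \<omega>_0;
  it holds for every \<omega> and settles the signs.\<close>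

lemma wedge_sign_Un_left:
  assumes "finite T" "finite T'" "finite U" "T \<inter> T' = {}"
  shows "wedge_sign (T \<union> T') U = wedge_sign T U * wedge_sign T' U"
proof -
  let ?f = "\<lambda>T. {(i, j). i \<in> T \<and> j \<in> U \<and> j < i}"
  have fin: "finite (?f A)" if "finite A" for A
    by (rule finite_subset[of _ "A \<times> U"]) (use that assms in auto)
  have "?f (T \<union> T') = ?f T \<union> ?f T'" "?f T \<inter> ?f T' = {}"
    using assms(4) by auto
  then have "card (?f (T \<union> T')) = card (?f T) + card (?f T')"
    using card_Un_disjoint[of "?f T" "?f T'"] fin assms by auto
  then show ?thesis by (simp add: wedge_sign_def power_add)
qed

lemma wedge_sign_Un_right:
  assumes "finite T" "finite U" "finite U'" "U \<inter> U' = {}"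
  shows "wedge_sign T (U \<union> U') = wedge_sign T U * wedge_sign T U'"
proof -
  let ?f = "\<lambda>U. {(i, j). i \<in> T \<and> j \<in> U \<and> j < i}"
  have fin: "finite (?f A)" if "finite A" for A
    by (rule finite_subset[of _ "T \<times> A"]) (use that assms in auto)
  have "?f (U \<union> U') = ?f U \<union> ?f U'" "?f U \<inter> ?f U' = {}"
    using assms(4) by auto
  then have "card (?f (U \<union> U')) = card (?f U) + card (?f U')"
    using card_Un_disjoint[of "?f U" "?f U'"] fin assms by auto
  then show ?thesis by (simp add: wedge_sign_def power_add)
qed

text \<open>Every pair in T x U is an inversion for exactly one of the two orders, because the sets
  are disjoint; so the two inversion counts add up to the number of all pairs.\<close>

lemma wedge_sign_swap:
  assumes "finite T" "finite U" "T \<inter> U = {}"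
  shows "wedge_sign T U = (-1) ^ (card T * card U) * wedge_sign U T"
proof -
  let ?A = "{(i, j). i \<in> T \<and> j \<in> U \<and> j < i}" and ?B = "{(i, j). i \<in> U \<and> j \<in> T \<and> j < i}"
  have fin: "finite ?A" "finite (prod.swap ` ?B)"
    proof -
    show "finite ?A" by (rule finite_subset[of _ "T \<times> U"]) (use assms in auto)
    have "finite ?B" by (rule finite_subset[of _ "U \<times> T"]) (use assms in auto)
    then show "finite (prod.swap ` ?B)" by simp
  qed
  have "T \<times> U \<subseteq> ?A \<union> prod.swap ` ?B"
  proof (rule subsetI)
    fix p assume "p \<in> T \<times> U"
    then obtain i j where p: "p = (i, j)" and ij: "i \<in> T" "j \<in> U" by (rule SigmaE)
    show "p \<in> ?A \<union> prod.swap ` ?B"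
    proof (cases "j < i")
      case False
      moreover have "i \<noteq> j" using ij assms(3) by blast
      ultimately have "p = prod.swap (j, i)" "(j, i) \<in> ?B" using p ij by simp_all
      then show ?thesis by blast
    qed (simp add: p ij)
  qed
  moreover have "?A \<union> prod.swap ` ?B \<subseteq> T \<times> U" by auto
  ultimately have "T \<times> U = ?A \<union> prod.swap ` ?B" by (rule equalityI)
  moreover have "?A \<inter> prod.swap ` ?B = {}" by auto
  ultimately have "card (T \<times> U) = card ?A + card (prod.swap ` ?B)"
    using card_Un_disjoint[OF fin] by simp
  also have "card (prod.swap ` ?B) = card ?B" by (rule card_image) (simp add: inj_on_def)
  finally have "card T * card U = card ?A + card ?B" by (simp only: card_cartesian_product)
  moreover have "(-1::complex) ^ card ?B * (-1) ^ card ?B = 1"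
    using power_mult_distrib[of "-1 :: complex" "-1" "card ?B"] by simp
  ultimately show ?thesis unfolding wedge_sign_def
    by (simp only: power_add mult.assoc mult_1_right)
qed

lemma wedge_sign_empty [simp]: "wedge_sign {} U = 1" "wedge_sign T {} = 1"
  by (simp_all add: wedge_sign_def)

lemma wedge_infinite: "infinite S \<Longrightarrow> wedge a b S = 0"
  by (simp add: wedge_def)

text \<open>Both sides are sums over ordered partitions of S into three blocks, and both signs are
  the product of the three pairwise signs of the blocks. The reindexing trades the pair (union of
  the first two blocks, first block) for (first block, second block).\<close>

lemma wedge_assoc: "wedge (wedge a b) c = wedge a (wedge b c)"
proof
  fix S
  show "wedge (wedge a b) c S = wedge a (wedge b c) S"
  proof (cases "finite S")
    case True
    have fin: "finite T" if "T \<subseteq> S" for T using True that finite_subset by blast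
    let ?g = "\<lambda>R Q. wedge_sign R (S - R) * a R * wedge_sign Q (S - R - Q) * b Q * c (S - R - Q)"
    have "wedge (wedge a b) c S =
        (\<Sum>T\<in>Pow S. \<Sum>R\<in>Pow T.
          wedge_sign T (S - T) * wedge_sign R (T - R) * a R * b (T - R) * c (S - T))"
      unfolding wedge_def sum_distrib_left sum_distrib_right by (simp only: mult.assoc)
    also have "\<dots> = (\<Sum>(T, R)\<in>Sigma (Pow S) Pow.
          wedge_sign T (S - T) * wedge_sign R (T - R) * a R * b (T - R) * c (S - T))"
      by (rule sum.Sigma) (use True fin in auto)
    also have "\<dots> = (\<Sum>(R, Q)\<in>Sigma (Pow S) (\<lambda>R. Pow (S - R)). ?g R Q)"
    proof (rule sum.reindex_bij_witness[of _ "\<lambda>(R, Q). (R \<union> Q, R)" "\<lambda>(T, R). (R, T - R)"], goal_cases)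
      case (5 p)
      then obtain T R where p: "p = (T, R)" and RT: "R \<subseteq> T" and TS: "T \<subseteq> S" by auto
      have 1: "S - R - (T - R) = S - T" using RT by blast
      have fs: "finite R" "finite T" "finite (T - R)" "finite (S - T)" using RT TS fin True by auto
      have "wedge_sign R (S - R) = wedge_sign R (T - R) * wedge_sign R (S - T)"
      proof -
        have "S - R = (T - R) \<union> (S - T)" "(T - R) \<inter> (S - T) = {}" using RT TS by blast+
        then show ?thesis using wedge_sign_Un_right[of R "T - R" "S - T"] fs by simp
      qed
      moreover have "wedge_sign T (S - T) = wedge_sign R (S - T) * wedge_sign (T - R) (S - T)"
        using wedge_sign_Un_left[of R "T - R" "S - T"] fs RT by (simp add: Un_absorb1 Diff_Int_distrib)
      ultimately show ?case unfolding p by (simp add: 1)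
    qed auto
    also have "\<dots> = (\<Sum>R\<in>Pow S. \<Sum>Q\<in>Pow (S - R). ?g R Q)"
      by (rule sum.Sigma[symmetric]) (use True in auto)
    also have "\<dots> = wedge a (wedge b c) S"
      unfolding wedge_def sum_distrib_left by (simp only: mult.assoc)
    finally show ?thesis .
  qed (simp add: wedge_infinite)
qed

text \<open>The hypothesis asks for one sign valid on the whole supports. It covers the two cases
  that occur: s = -1 for forms of degree one, s = 1 for forms of even degree.\<close>

lemma wedge_commute:
  assumes "\<And>T U. a T \<noteq> 0 \<Longrightarrow> b U \<noteq> 0 \<Longrightarrow> (-1) ^ (card T * card U) = s"
  shows "wedge a b = (\<lambda>S. s * wedge b a S)"
proof
  fix S
  show "wedge a b S = s * wedge b a S"
  proof (cases "finite S")
    case True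
    have "wedge a b S = (\<Sum>T\<in>Pow S. wedge_sign (S - T) T * a (S - T) * b T)"
      unfolding wedge_def
      by (rule sum.reindex_bij_witness[of _ "\<lambda>T. S - T" "\<lambda>T. S - T"]) (auto simp: double_diff)
    also have "\<dots> = (\<Sum>T\<in>Pow S. s * (wedge_sign T (S - T) * b T * a (S - T)))"
    proof (rule sum.cong[OF refl])
      fix T assume "T \<in> Pow S"
      then have "finite T" "finite (S - T)" "(S - T) \<inter> T = {}" using True finite_subset by auto
      then show "wedge_sign (S - T) T * a (S - T) * b T = s * (wedge_sign T (S - T) * b T * a (S - T))"
        using wedge_sign_swap[of "S - T" T] assms[of "S - T" T]
        by (cases "a (S - T) = 0 \<or> b T = 0") auto
    qed
    finally show ?thesis by (simp add: wedge_def sum_distrib_left)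
  qed (simp add: wedge_infinite)
qed

lemma wedge_add_left: "wedge (\<lambda>S. a S + b S) c = (\<lambda>S. wedge a c S + wedge b c S)"
  and wedge_add_right: "wedge c (\<lambda>S. a S + b S) = (\<lambda>S. wedge c a S + wedge c b S)"
  and wedge_scale_left: "wedge (\<lambda>S. k * a S) c = (\<lambda>S. k * wedge a c S)"
  and wedge_scale_right: "wedge c (\<lambda>S. k * a S) = (\<lambda>S. k * wedge c a S)"
  and wedge_zero_left: "wedge (\<lambda>S. 0) c = (\<lambda>S. 0)"
  and wedge_zero_right: "wedge c (\<lambda>S. 0) = (\<lambda>S. 0)"
  by (simp_all add: wedge_def fun_eq_iff algebra_simps sum.distrib sum_distrib_left)

lemma wedge_sum_left: "wedge (\<lambda>S. \<Sum>i\<in>I. a i S) c = (\<lambda>S. \<Sum>i\<in>I. wedge (a i) c S)"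
  by (induction I rule: infinite_finite_induct) (simp_all add: wedge_zero_left wedge_add_left)

lemma wedge_sum_right: "wedge c (\<lambda>S. \<Sum>i\<in>I. a i S) = (\<lambda>S. \<Sum>i\<in>I. wedge c (a i) S)"
  by (induction I rule: infinite_finite_induct) (simp_all add: wedge_zero_right wedge_add_right)

text \<open>On an infinite S the sum over \<open>Pow S\<close> is 0 by convention, so
  \<open>form_one\<close> is neutral only at finite index sets. This is why vanishing at infinite
  index sets is carried along below.\<close>

lemma wedge_one_left: "finite S \<Longrightarrow> wedge form_one a S = a S"
proof -
  assume "finite S"
  have "wedge form_one a S = (\<Sum>T\<in>Pow S. if T = {} then a S else 0)"
    unfolding wedge_def form_one_def by (rule sum.cong) auto
  then show ?thesis using \<open>finite S\<close> by simp
qed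

lemma wedge_nonzeroE:
  assumes "wedge a b S \<noteq> 0"
  obtains T U where "finite T" "finite U" "T \<inter> U = {}" "S = T \<union> U" "a T \<noteq> 0" "b U \<noteq> 0"
proof -
  have "finite S" using assms wedge_infinite by blast
  moreover have "\<exists>T\<in>Pow S. wedge_sign T (S - T) * a T * b (S - T) \<noteq> 0"
    using assms unfolding wedge_def by (meson sum.neutral)
  then obtain T where "T \<subseteq> S" "a T \<noteq> 0" "b (S - T) \<noteq> 0" by auto
  ultimately show thesis
    using that[of T "S - T"] finite_subset[of T S] by (simp add: Un_absorb1)
qed

subsection \<open>Linear and quadratic forms\<close>

definition lin_form :: "nat \<Rightarrow> (nat \<Rightarrow> complex) \<Rightarrow> form" where
  "lin_form m c = (\<lambda>S. \<Sum>i<m. c i * dx i S)"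

definition quad_form :: "nat \<Rightarrow> (nat \<Rightarrow> nat \<Rightarrow> complex) \<Rightarrow> form" where
  "quad_form m b = (\<lambda>S. \<Sum>j<m. \<Sum>i<j. b i j * wedge (dx i) (dx j) S)"

lemma dx_nonzero_iff: "dx i S \<noteq> 0 \<longleftrightarrow> S = {i}"
  by (simp add: dx_def)

lemma wedge_dx_anticommute: "wedge (dx i) (dx j) S = - wedge (dx j) (dx i) S"
  using wedge_commute[of "dx i" "dx j" "-1"] by (simp add: dx_nonzero_iff)

lemma complex_eq_minus_self: "x = - x \<Longrightarrow> x = 0" for x :: complex
  by (simp add: complex_eq_iff)

lemma wedge_dx_same: "wedge (dx i) (dx i) S = 0"
  by (rule complex_eq_minus_self) (rule wedge_dx_anticommute)

lemma wedge_dx_left: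
  "wedge (dx i) b S = (if finite S \<and> i \<in> S then wedge_sign {i} (S - {i}) * b (S - {i}) else 0)"
proof (cases "finite S \<and> i \<in> S")
  case True
  have "wedge (dx i) b S = (\<Sum>T\<in>Pow S. if T = {i} then wedge_sign {i} (S - {i}) * b (S - {i}) else 0)"
    unfolding wedge_def dx_def by (rule sum.cong) auto
  then show ?thesis using True by simp
next
  case False
  then show ?thesis
    by (cases "wedge (dx i) b S = 0") (auto elim!: wedge_nonzeroE simp: dx_nonzero_iff)
qed

lemma wedge_dx_dx:
  assumes "i < j" shows "wedge (dx i) (dx j) S = (if S = {i, j} then 1 else 0)"
proof -
  have "{(i', j'). i' \<in> {i} \<and> j' \<in> {j} \<and> j' < i'} = {}" using assms by auto
  then have sgn: "wedge_sign {i} {j} = 1" unfolding wedge_sign_def by (simp only: card.empty power_0)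
  show ?thesis
  proof (cases "S = {i, j}")
    case True
    have 1: "{i, j} - {i} = {j}" using assms by auto
    show ?thesis unfolding True wedge_dx_left 1 by (simp add: dx_def sgn)
  next
    case False
    then have "\<not> (i \<in> S \<and> S - {i} = {j})" by blast
    then show ?thesis using False unfolding wedge_dx_left by (simp add: dx_def)
  qed
qed

lemma lin_form_nonzeroE:
  assumes "lin_form m c S \<noteq> 0" obtains i where "i < m" "S = {i}"
  using assms unfolding lin_form_def
  by (metis (mono_tags, lifting) dx_nonzero_iff lessThan_iff mult_zero_right sum.neutral)

lemma wedge_lin_form_anticommute:
  "wedge (lin_form m c) (lin_form m d) = (\<lambda>S. - wedge (lin_form m d) (lin_form m c) S)"
proof -
  have "(-1::complex) ^ (card T * card U) = -1"
    if "lin_form m c T \<noteq> 0" "lin_form m d U \<noteq> 0" for T U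
    using that by (auto elim!: lin_form_nonzeroE)
  from wedge_commute[OF this] show ?thesis by simp
qed

lemma wedge_lin_form_self: "wedge (lin_form m c) (lin_form m c) = (\<lambda>S. 0)"
  by (rule ext, rule complex_eq_minus_self) (rule wedge_lin_form_anticommute[THEN fun_cong])

lemma quad_form_eval:
  assumes "i < j" "j < m" shows "quad_form m b {i, j} = b i j"
proof -
  have "quad_form m b {i, j} = (\<Sum>j'<m. \<Sum>i'<j'. if i' = i \<and> j' = j then b i j else 0)"
    unfolding quad_form_def using assms
    by (intro sum.cong refl) (auto simp: wedge_dx_dx doubleton_eq_iff)
  also have "\<dots> = (\<Sum>j'<m. if j' = j then b i j else 0)"
    using assms by (intro sum.cong refl) auto
  finally show ?thesis using assms by simp
qed

lemma quad_form_nonzeroE: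
  assumes "quad_form m b S \<noteq> 0" obtains i j where "i < j" "j < m" "S = {i, j}"
proof -
  obtain j where j: "j < m" "(\<Sum>i<j. b i j * wedge (dx i) (dx j) S) \<noteq> 0"
    using assms unfolding quad_form_def by (metis (mono_tags, lifting) lessThan_iff sum.neutral)
  then obtain i where "i < j" "b i j * wedge (dx i) (dx j) S \<noteq> 0"
    by (metis (mono_tags, lifting) lessThan_iff sum.neutral)
  then show thesis using that[of i j] j by (auto simp: wedge_dx_dx split: if_splits)
qed

lemma quad_form_cong:
  "(\<And>i j. i < j \<Longrightarrow> j < m \<Longrightarrow> b i j = c i j) \<Longrightarrow> quad_form m b = quad_form m c"
  unfolding quad_form_def by (intro ext sum.cong refl) auto

lemma quad_form_sum:
  "quad_form m (\<lambda>i j. \<Sum>k\<in>K. b k i j) = (\<lambda>S. \<Sum>k\<in>K. quad_form m (b k) S)"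
  by (induction K rule: infinite_finite_induct)
    (simp_all add: fun_eq_iff quad_form_def distrib_right sum.distrib)

lemma quad_form_scale: "quad_form m (\<lambda>i j. k * b i j) = (\<lambda>S. k * quad_form m b S)"
  by (simp add: quad_form_def sum_distrib_left mult_ac)

lemma rational_two_form_eq_quad_form:
  assumes "\<omega> \<in> rational_two_forms m" shows "\<omega> = quad_form m (\<lambda>i j. \<omega> {i, j})"
proof
  fix S
  show "\<omega> S = quad_form m (\<lambda>i j. \<omega> {i, j}) S"
  proof (cases "\<exists>i j. i < j \<and> j < m \<and> S = {i, j}")
    case True
    then obtain i j where "i < j" "j < m" "S = {i, j}" by blast
    then show ?thesis by (simp add: quad_form_eval)
  next
    case False
    have "\<omega> S = 0"
    proof (rule ccontr)
      assume "\<omega> S \<noteq> 0"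
      then have "S \<subseteq> {..<m}" "card S = 2" using assms by (auto simp: rational_two_forms_def)
      then obtain i j where ij: "S = {i, j}" "i \<noteq> j" "i < m" "j < m" by (auto simp: card_2_iff)
      then have "i < j \<or> j < i" "S = {j, i}" by auto
      with ij False show False by blast
    qed
    moreover have "quad_form m (\<lambda>i j. \<omega> {i, j}) S = 0"
      using False by (rule contrapos_np) (erule quad_form_nonzeroE, blast)
    ultimately show ?thesis by simp
  qed
qed

text \<open>The coefficients are the 2 x 2 minors of the pair c, d. The induction splits off row and
  column m of the double sum; anticommutativity folds the row into the column, and the diagonal
  vanishes.\<close>

lemma wedge_lin_form:
  "wedge (lin_form m c) (lin_form m d) = quad_form m (\<lambda>i j. c i * d j - c j * d i)"
proof
  fix S
  let ?w = "\<lambda>i j. wedge (dx i) (dx j) S"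
  have "wedge (lin_form m c) (lin_form m d) S = (\<Sum>i<m. \<Sum>j<m. c i * d j * ?w i j)"
    unfolding lin_form_def wedge_sum_left wedge_scale_left
    by (simp add: wedge_sum_right wedge_scale_right sum_distrib_left mult.assoc)
  also have "\<dots> = (\<Sum>j<m. \<Sum>i<j. (c i * d j - c j * d i) * ?w i j)"
  proof (induction m)
    case (Suc m)
    have 1: "(\<Sum>i<Suc m. \<Sum>j<Suc m. c i * d j * ?w i j) =
      (\<Sum>i<m. \<Sum>j<m. c i * d j * ?w i j) + (\<Sum>i<m. c i * d m * ?w i m)
        + (\<Sum>j<m. c m * d j * ?w m j)"
      by (simp add: sum.distrib wedge_dx_same)
    have 2: "(\<Sum>j<m. c m * d j * ?w m j) = - (\<Sum>j<m. c m * d j * ?w j m)"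
      unfolding sum_negf[symmetric] by (intro sum.cong refl, subst wedge_dx_anticommute) simp
    have 3: "(\<Sum>j<Suc m. \<Sum>i<j. (c i * d j - c j * d i) * ?w i j) =
      (\<Sum>j<m. \<Sum>i<j. (c i * d j - c j * d i) * ?w i j)
      + ((\<Sum>i<m. c i * d m * ?w i m) - (\<Sum>j<m. c m * d j * ?w j m))"
      by (simp add: sum_subtractf left_diff_distrib)
    show ?case unfolding 1 2 3 Suc.IH by simp
  qed simp
  finally show "wedge (lin_form m c) (lin_form m d) S = quad_form m (\<lambda>i j. c i * d j - c j * d i) S"
    by (simp add: quad_form_def)
qed

subsection \<open>Commuting square-zero elements\<close>

lemma add_square_zero_power_Suc:
  fixes x y :: "'a::comm_ring_1"
  assumes "y * y = 0"
  shows "(x + y) ^ Suc n = x ^ Suc n + of_nat (Suc n) * x ^ n * y"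
proof (induction n)
  case (Suc n)
  have "(x + y) ^ Suc (Suc n) = (x + y) * (x ^ Suc n + of_nat (Suc n) * x ^ n * y)"
    by (simp only: power_Suc[of "x + y" "Suc n"] Suc.IH)
  also have "\<dots> = x ^ Suc (Suc n) + of_nat (Suc n) * x ^ Suc n * y + x ^ Suc n * y
      + of_nat (Suc n) * x ^ n * (y * y)"
    by (simp add: algebra_simps)
  also have "\<dots> = x ^ Suc (Suc n) + of_nat (Suc (Suc n)) * x ^ Suc n * y"
    by (simp add: assms algebra_simps)
  finally show ?case .
qed simp

text \<open>The vanishing of the next power is carried along because the induction needs it: after
  adding one more square-zero term the binomial expansion stops at the linear term, and of its two
  summands only the one with the new factor survives.\<close>

lemma sum_square_zero_power:
  fixes \<eta> :: "'i \<Rightarrow> 'a::comm_ring_1"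
  assumes "finite K" "\<And>k. k \<in> K \<Longrightarrow> \<eta> k * \<eta> k = 0"
  shows "(\<Sum>k\<in>K. \<eta> k) ^ card K = of_nat (fact (card K)) * (\<Prod>k\<in>K. \<eta> k)
    \<and> (\<Sum>k\<in>K. \<eta> k) ^ Suc (card K) = 0"
  using assms
proof (induction K rule: finite_induct)
  case (insert k K)
  let ?s = "\<Sum>k\<in>K. \<eta> k"
  have IH: "?s ^ card K = of_nat (fact (card K)) * (\<Prod>k\<in>K. \<eta> k)" "?s ^ Suc (card K) = 0"
    using insert by auto
  have e: "(\<Sum>k\<in>insert k K. \<eta> k) = ?s + \<eta> k" using insert.hyps by (simp add: add.commute)
  have c: "card (insert k K) = Suc (card K)" using insert.hyps by simp
  have y: "\<eta> k * \<eta> k = 0" using insert.prems by simp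
  have "(?s + \<eta> k) ^ Suc (card K) = of_nat (fact (Suc (card K))) * (\<eta> k * (\<Prod>k\<in>K. \<eta> k))"
    unfolding add_square_zero_power_Suc[OF y] IH by (simp add: algebra_simps)
  moreover have "(?s + \<eta> k) ^ Suc (Suc (card K)) = 0"
    unfolding add_square_zero_power_Suc[OF y] power_Suc[of ?s "Suc (card K)"] IH by simp
  ultimately show ?case unfolding e c using insert.hyps by simp
qed simp

subsection \<open>The commutative algebra of even forms\<close>

text \<open>Forms of even degree commute. As a type of class \<open>comm_ring_1\<close> they inherit
  the binomial theorem and the laws of powers and finite products. Members vanish at infinite index
  sets so that \<open>form_one\<close> is a unit.\<close>

typedef even_form = "{a :: form. \<forall>S. a S \<noteq> 0 \<longrightarrow> finite S \<and> even (card S)}"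
  by (rule exI[of _ "\<lambda>S. 0"]) simp

setup_lifting type_definition_even_form

lemma form_one_even: "form_one S \<noteq> 0 \<Longrightarrow> finite S \<and> even (card S)"
  by (auto simp: form_one_def split: if_splits)

lemma wedge_even:
  assumes "\<And>S. a S \<noteq> 0 \<Longrightarrow> finite S \<and> even (card S)" "\<And>S. b S \<noteq> 0 \<Longrightarrow> finite S \<and> even (card S)"
    and "wedge a b S \<noteq> 0"
  shows "finite S \<and> even (card S)"
  using assms(3)
proof (rule wedge_nonzeroE)
  fix T U assume "finite T" "finite U" "T \<inter> U = {}" "S = T \<union> U" "a T \<noteq> 0" "b U \<noteq> 0"
  then show ?thesis using assms(1,2) by (simp add: card_Un_disjoint)
qed

instantiation even_form :: comm_ring_1
begin

lift_definition zero_even_form :: even_form is "\<lambda>S. 0" by simp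
lift_definition one_even_form :: even_form is form_one by (rule form_one_even)
lift_definition plus_even_form :: "even_form \<Rightarrow> even_form \<Rightarrow> even_form" is "\<lambda>a b S. a S + b S"
  by (metis add.right_neutral add_0)
lift_definition minus_even_form :: "even_form \<Rightarrow> even_form \<Rightarrow> even_form" is "\<lambda>a b S. a S - b S"
  by (metis diff_zero)
lift_definition uminus_even_form :: "even_form \<Rightarrow> even_form" is "\<lambda>a S. - a S" by simp
lift_definition times_even_form :: "even_form \<Rightarrow> even_form \<Rightarrow> even_form" is wedge
  by (rule wedge_even)

instance
proof
  fix a b c :: even_form
  show "a * b * c = a * (b * c)" by transfer (rule wedge_assoc)
  show "a * b = b * a"
  proof (transfer, goal_cases)
    case (1 a b)
    have "(-1::complex) ^ (card T * card U) = 1" if "a T \<noteq> 0" "b U \<noteq> 0" for T U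
      using 1 that by simp
    from wedge_commute[OF this] show ?case by simp
  qed
  show "1 * a = a"
  proof (transfer, rule ext, goal_cases)
    case (1 a S)
    then show ?case by (cases "finite S") (auto simp: wedge_one_left wedge_infinite)
  qed
  show "(a + b) * c = a * c + b * c" by transfer (rule wedge_add_left)
  show "(0::even_form) \<noteq> 1" by transfer (auto simp: form_one_def dest: fun_cong[of _ _ "{}"])
qed (transfer, simp add: algebra_simps)+

end

text \<open>Complex scalars as forms of degree 0; scalar multiplication is thereby expressed by the
  ring multiplication.\<close>

lift_definition const_form :: "complex \<Rightarrow> even_form" is "\<lambda>c S. if S = {} then c else 0"
  by (auto split: if_splits)

lemma const_form_eq: "(\<lambda>S. if S = {} then c else 0) = (\<lambda>S. c * form_one S)"
  by (auto simp: form_one_def)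

lemma Rep_const_form_mult: "Rep_even_form (const_form c * x) = (\<lambda>S. c * Rep_even_form x S)"
proof (transfer, goal_cases)
  case (1 c x)
  have "wedge form_one x S = x S" for S
    using 1 by (cases "finite S") (auto simp: wedge_one_left wedge_infinite)
  then show ?case by (simp add: const_form_eq wedge_scale_left)
qed

lemma const_form_1: "const_form 1 = 1" by transfer (simp add: form_one_def)

lemma const_form_add: "const_form (a + b) = const_form a + const_form b"
  by transfer auto

lemma const_form_mult: "const_form (a * b) = const_form a * const_form b"
  by (rule Rep_even_form_inject[THEN iffD1]) (simp add: Rep_const_form_mult const_form.rep_eq fun_eq_iff)

lemma const_form_power: "const_form (a ^ n) = const_form a ^ n"
  by (induction n) (simp_all add: const_form_1 const_form_mult)

lemma const_form_prod: "const_form (\<Prod>k\<in>K. a k) = (\<Prod>k\<in>K. const_form (a k))"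
  by (induction K rule: infinite_finite_induct) (simp_all add: const_form_1 const_form_mult)

lemma const_form_of_nat: "const_form (of_nat n) = of_nat n"
proof (induction n)
  case 0
  show ?case by (simp, transfer) auto
qed (simp add: const_form_add const_form_1)

lemma Rep_sum: "Rep_even_form (\<Sum>k\<in>K. x k) = (\<lambda>S. \<Sum>k\<in>K. Rep_even_form (x k) S)"
  by (induction K rule: infinite_finite_induct) (simp_all add: zero_even_form.rep_eq plus_even_form.rep_eq)

lemma Rep_power: "Rep_even_form (x ^ n) = wedge_power (Rep_even_form x) n"
  by (induction n) (simp_all add: wedge_power_def wedge_list_def one_even_form.rep_eq times_even_form.rep_eq)

lemma Rep_prod_list: "Rep_even_form (prod_list xs) = wedge_list (map Rep_even_form xs)"
  by (induction xs) (simp_all add: wedge_list_def one_even_form.rep_eq times_even_form.rep_eq)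

lemma Abs_quad_form: "Rep_even_form (Abs_even_form (quad_form m b)) = quad_form m b"
  by (rule Abs_even_form_inverse) (auto elim!: quad_form_nonzeroE)

text \<open>The coefficients b are kept general because three instances occur: b = - d_i for
  \<theta> in the coordinates x, and b = 1 and b = 1 + t a_k in an eigenbasis.\<close>

lemma sum_wedge_power:
  fixes \<eta> :: "nat \<Rightarrow> even_form"
  assumes "\<And>k. k < g \<Longrightarrow> \<eta> k * \<eta> k = 0"
  shows "(\<Sum>k<g. const_form (b k) * \<eta> k) ^ g = const_form (fact g * (\<Prod>k<g. b k)) * (\<Prod>k<g. \<eta> k)"
proof -
  have sq: "const_form (b k) * \<eta> k * (const_form (b k) * \<eta> k) = const_form (b k) * const_form (b k) * (\<eta> k * \<eta> k)" for k
    by (simp only: mult_ac)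
  then have "const_form (b k) * \<eta> k * (const_form (b k) * \<eta> k) = 0" if "k \<in> {..<g}" for k
    using assms[of k] that by (simp only: sq lessThan_iff mult_zero_right)
  from sum_square_zero_power[OF finite_lessThan this]
  have "(\<Sum>k<g. const_form (b k) * \<eta> k) ^ card {..<g} =
      of_nat (fact (card {..<g})) * (\<Prod>k<g. const_form (b k) * \<eta> k)"
    by (rule conjunct1)
  moreover have "of_nat (fact g) = const_form (fact g)"
    unfolding const_form_of_nat[symmetric] of_nat_fact ..
  ultimately show ?thesis
    by (simp add: prod.distrib const_form_mult const_form_prod mult.assoc)
qed

subsection \<open>Interior products\<close>

text \<open>Interior product with the constant vector field that is the sum of the X_i d/dx_i. The
  sign is the one that moves dx_i to the front.\<close>

definition contract :: "nat \<Rightarrow> (nat \<Rightarrow> complex) \<Rightarrow> form \<Rightarrow> form" where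
  "contract m X a = (\<lambda>S. \<Sum>i<m. X i *
     (if i \<in> S \<or> infinite S then 0 else wedge_sign {i} S * a (insert i S)))"

lemma wedge_sign_square: "wedge_sign T U * wedge_sign T U = 1"
proof -
  have "(-1::complex) ^ n * (-1) ^ n = 1" for n
    using power_mult_distrib[of "-1 :: complex" "-1" n] by simp
  then show ?thesis by (simp only: wedge_sign_def)
qed

lemma contract_add: "contract m X (\<lambda>S. a S + b S) = (\<lambda>S. contract m X a S + contract m X b S)"
  unfolding contract_def sum.distrib[symmetric] by (intro ext sum.cong refl) (simp add: distrib_left)

lemma contract_scale: "contract m X (\<lambda>S. k * a S) = (\<lambda>S. k * contract m X a S)"
  unfolding contract_def sum_distrib_left by (intro ext sum.cong refl) simp

lemma contract_zero: "contract m X (\<lambda>S. 0) = (\<lambda>S. 0)"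
  by (simp add: contract_def)

lemma contract_sum: "contract m X (\<lambda>S. \<Sum>i\<in>I. a i S) = (\<lambda>S. \<Sum>i\<in>I. contract m X (a i) S)"
  by (induction I rule: infinite_finite_induct) (simp_all add: contract_zero contract_add)

lemma contract_infinite: "infinite S \<Longrightarrow> contract m X a S = 0"
  by (simp add: contract_def)

text \<open>The antiderivation rule for one basis vector and one dx_j, coefficient by coefficient.
  For i different from j the minus sign comes from
  \<open>wedge_sign {i} {j} * wedge_sign {j} {i} = -1\<close>; for i = j the contraction of dx_j
  contributes the extra \<open>b S\<close>.\<close>

lemma contract_wedge_dx_basis:
  assumes "finite S"
  shows "(if i \<in> S then 0 else wedge_sign {i} S * wedge (dx j) b (insert i S)) =
    (if i = j then b S else 0)
    - wedge (dx j) (\<lambda>S. if i \<in> S \<or> infinite S then 0 else wedge_sign {i} S * b (insert i S)) S"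
proof (cases "i = j")
  case True
  let ?c = "\<lambda>S. if i \<in> S \<or> infinite S then 0 else wedge_sign {i} S * b (insert i S)"
  have sq: "wedge_sign T U * (wedge_sign T U * x) = x" for T U x
    by (simp only: wedge_sign_square mult.assoc[symmetric] mult_1_left)
  show ?thesis
  proof (cases "i \<in> S")
    case iS: True
    have "?c (S - {i}) = wedge_sign {i} (S - {i}) * b S"
      using assms iS by (simp add: insert_absorb)
    then have "wedge (dx i) ?c S = b S"
      using iS assms by (simp only: wedge_dx_left simp_thms if_True sq)
    then show ?thesis using iS True by simp
  next
    case iS: False
    then have "wedge (dx i) ?c S = 0" by (simp only: wedge_dx_left simp_thms if_False)
    moreover have "wedge (dx i) b (insert i S) = wedge_sign {i} S * b S"
      using assms iS by (simp add: wedge_dx_left)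
    ultimately show ?thesis using iS True by (simp add: sq)
  qed
next
  case False
  show ?thesis
  proof (cases "i \<notin> S \<and> j \<in> S")
    case ij: True
    define R where "R = S - {j}"
    have R: "finite R" "i \<notin> R" "j \<notin> R" "S = R \<union> {j}" "insert i S - {j} = R \<union> {i}" "S - {j} = R"
      "insert i R = R \<union> {i}"
      using ij assms False by (auto simp: R_def)
    have 1: "wedge_sign {i} S = wedge_sign {i} R * wedge_sign {i} {j}"
      unfolding R(4) by (rule wedge_sign_Un_right) (use R(1,3) in simp_all)
    have 2: "wedge_sign {j} (R \<union> {i}) = wedge_sign {j} R * wedge_sign {j} {i}"
      by (rule wedge_sign_Un_right) (use R(1,2) in simp_all)
    have 3: "wedge_sign {i} {j} * wedge_sign {j} {i} = -1"
    proof -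
      have "wedge_sign {i} {j} = - wedge_sign {j} {i}"
        using wedge_sign_swap[of "{i}" "{j}"] False by simp
      then show ?thesis by (simp only: minus_mult_left[symmetric] wedge_sign_square)
    qed
    have "wedge_sign {i} R * wedge_sign {i} {j} * (wedge_sign {j} R * wedge_sign {j} {i} * x) =
        (wedge_sign {i} {j} * wedge_sign {j} {i}) * (wedge_sign {j} R * (wedge_sign {i} R * x))" for x
      by (simp only: mult_ac)
    then have 4: "wedge_sign {i} R * wedge_sign {i} {j} * (wedge_sign {j} R * wedge_sign {j} {i} * x) =
        - (wedge_sign {j} R * (wedge_sign {i} R * x))" for x
      by (simp add: 3)
    have "wedge (dx j) b (insert i S) = wedge_sign {j} (R \<union> {i}) * b (R \<union> {i})"
      using ij assms by (simp only: wedge_dx_left R(5) finite_insert insert_iff simp_thms if_True)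
    then have 5: "wedge_sign {i} S * wedge (dx j) b (insert i S) =
        - (wedge_sign {j} R * (wedge_sign {i} R * b (R \<union> {i})))"
      by (simp only: 1 2 4)
    have 6: "wedge (dx j) (\<lambda>S. if i \<in> S \<or> infinite S then 0 else wedge_sign {i} S * b (insert i S)) S =
        wedge_sign {j} R * (wedge_sign {i} R * b (R \<union> {i}))"
      using ij assms R(1,2) by (simp only: wedge_dx_left R(6,7) simp_thms if_True if_False)
    show ?thesis unfolding 5 6 using ij False by simp
  next
    case no: False
    show ?thesis
    proof (cases "i \<in> S")
      case True
      then have "wedge (dx j) (\<lambda>S. if i \<in> S \<or> infinite S then 0 else wedge_sign {i} S * b (insert i S)) S = 0"
        using False by (simp add: wedge_dx_left)
      then show ?thesis using True False by simp
    next
      case iS: False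
      then have "j \<notin> S" using no by simp
      then show ?thesis using False by (simp add: wedge_dx_left)
    qed
  qed
qed

text \<open>The term \<open>b S\<close> appears bare on the right, whereas contractions and wedges
  vanish at infinite index sets; hence the hypothesis on b.\<close>

lemma contract_wedge_dx:
  assumes "\<And>S. infinite S \<Longrightarrow> b S = 0"
  shows "contract m X (wedge (dx j) b) =
    (\<lambda>S. (if j < m then X j else 0) * b S - wedge (dx j) (contract m X b) S)"
proof
  fix S
  show "contract m X (wedge (dx j) b) S =
    (if j < m then X j else 0) * b S - wedge (dx j) (contract m X b) S"
  proof (cases "finite S")
    case True
    let ?c = "\<lambda>i S. if i \<in> S \<or> infinite S then 0 else wedge_sign {i} S * b (insert i S)"
    have "contract m X (wedge (dx j) b) S = (\<Sum>i<m. X i * ((if i = j then b S else 0) - wedge (dx j) (?c i) S))"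
      unfolding contract_def by (intro sum.cong refl) (simp add: True contract_wedge_dx_basis[OF True, symmetric])
    also have "\<dots> = (\<Sum>i<m. if i = j then X j * b S else 0) - (\<Sum>i<m. X i * wedge (dx j) (?c i) S)"
      unfolding sum_subtractf[symmetric] by (intro sum.cong refl) (auto simp: algebra_simps)
    also have "(\<Sum>i<m. X i * wedge (dx j) (?c i) S) = wedge (dx j) (contract m X b) S"
      unfolding contract_def wedge_sum_right wedge_scale_right ..
    finally show ?thesis by simp
  qed (simp add: contract_infinite wedge_infinite assms)
qed

lemma contract_wedge_lin_form:
  assumes "\<And>S. infinite S \<Longrightarrow> b S = 0"
  shows "contract m X (wedge (lin_form m c) b) =
    (\<lambda>S. (\<Sum>i<m. X i * c i) * b S - wedge (lin_form m c) (contract m X b) S)"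
proof
  fix S
  have "contract m X (wedge (lin_form m c) b) S =
      (\<Sum>j<m. c j * ((if j < m then X j else 0) * b S - wedge (dx j) (contract m X b) S))"
    unfolding lin_form_def wedge_sum_left wedge_scale_left contract_sum contract_scale
    by (intro sum.cong refl) (simp add: contract_wedge_dx assms)
  also have "\<dots> = (\<Sum>j<m. X j * c j * b S) - (\<Sum>j<m. c j * wedge (dx j) (contract m X b) S)"
    unfolding sum_subtractf[symmetric] by (intro sum.cong refl) (simp add: algebra_simps)
  finally show "contract m X (wedge (lin_form m c) b) S =
      (\<Sum>i<m. X i * c i) * b S - wedge (lin_form m c) (contract m X b) S"
    unfolding lin_form_def wedge_sum_left wedge_scale_left by (simp add: sum_distrib_right)
qed

text \<open>Since R is killed by both contractions, they act only on the 2-form, and what remains is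
  its value on (X, Y) times R. This is how a value of \<omega> is recovered from its wedge product
  with R.\<close>

lemma contract_wedge_quad_form:
  assumes R: "\<And>S. infinite S \<Longrightarrow> R S = 0" and X: "contract m X R = (\<lambda>S. 0)" and Y: "contract m Y R = (\<lambda>S. 0)"
  shows "contract m Y (contract m X (wedge (quad_form m b) R)) =
    (\<lambda>S. (\<Sum>j<m. \<Sum>i<j. b i j * (X i * Y j - X j * Y i)) * R S)"
proof
  fix S
  have *: "contract m Y (contract m X (wedge (wedge (dx i) (dx j)) R)) S = (X i * Y j - X j * Y i) * R S"
    if "i < m" "j < m" for i j
  proof -
    have x: "contract m X (wedge (dx k) R) = (\<lambda>S. X k * R S)"
      and y: "contract m Y (wedge (dx k) R) = (\<lambda>S. Y k * R S)" if "k < m" for k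
      using that by (simp_all add: contract_wedge_dx R X Y wedge_zero_right)
    have "contract m X (wedge (dx i) (wedge (dx j) R)) =
        (\<lambda>S. X i * wedge (dx j) R S + (- X j) * wedge (dx i) R S)"
      using that by (simp add: contract_wedge_dx wedge_infinite x wedge_scale_right)
    then show ?thesis
      using that by (simp add: wedge_assoc contract_add contract_scale y algebra_simps
          del: mult_minus_left)
  qed
  have "contract m Y (contract m X (wedge (quad_form m b) R)) S =
      (\<Sum>j<m. \<Sum>i<j. b i j * contract m Y (contract m X (wedge (wedge (dx i) (dx j)) R)) S)"
    unfolding quad_form_def wedge_sum_left wedge_scale_left contract_sum contract_scale ..
  also have "\<dots> = (\<Sum>j<m. \<Sum>i<j. b i j * (X i * Y j - X j * Y i) * R S)"
    by (intro sum.cong refl) (simp add: *)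
  finally show "contract m Y (contract m X (wedge (quad_form m b) R)) S =
      (\<Sum>j<m. \<Sum>i<j. b i j * (X i * Y j - X j * Y i)) * R S"
    by (simp add: sum_distrib_right)
qed

subsection \<open>Products of linear forms\<close>

lemma wedge_list_infinite: "infinite S \<Longrightarrow> wedge_list as S = 0"
  by (cases as) (auto simp: wedge_list_def form_one_def wedge_infinite)

lemma wedge_list_Cons: "wedge_list (a # as) = wedge a (wedge_list as)"
  by (simp add: wedge_list_def)

lemma contract_wedge_list_lin_form:
  assumes "\<And>k. k \<in> set ks \<Longrightarrow> (\<Sum>i<m. X i * c k i) = 0"
  shows "contract m X (wedge_list (map (\<lambda>k. lin_form m (c k)) ks)) = (\<lambda>S. 0)"
  using assms
proof (induction ks)
  case Nil
  show ?case by (auto simp: wedge_list_def contract_def form_one_def intro!: sum.neutral)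
next
  case (Cons k ks)
  then show ?case
    by (simp add: wedge_list_Cons contract_wedge_lin_form[OF wedge_list_infinite] wedge_zero_right)
qed

text \<open>The X k are vectors dual to the linear forms. Contracting with the vector dual to the
  first factor kills all the others and returns the product of the remaining factors, so induction
  peels off one factor at a time.\<close>

lemma wedge_list_lin_form_nonzero:
  assumes "distinct ks" "\<And>k l. k \<in> set ks \<Longrightarrow> l \<in> set ks \<Longrightarrow> (\<Sum>i<m. X k i * c l i) = (if k = l then 1 else 0)"
  shows "wedge_list (map (\<lambda>k. lin_form m (c k)) ks) \<noteq> (\<lambda>S. 0)"
  using assms
proof (induction ks)
  case Nil
  show ?case by (auto simp: wedge_list_def form_one_def dest: fun_cong[of _ _ "{}"])
next
  case (Cons k ks)
  let ?R = "wedge_list (map (\<lambda>k. lin_form m (c k)) ks)"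
  have "contract m (X k) ?R = (\<lambda>S. 0)"
    by (rule contract_wedge_list_lin_form) (use Cons.prems in auto)
  then have "contract m (X k) (wedge (lin_form m (c k)) ?R) = ?R"
    using Cons.prems(2)[of k k]
    by (simp add: contract_wedge_lin_form[OF wedge_list_infinite] wedge_zero_right)
  moreover have "?R \<noteq> (\<lambda>S. 0)" using Cons by simp
  ultimately show ?case by (metis list.simps(9) wedge_list_Cons contract_zero)
qed

lemma wedge_lin_form_wedge_list:
  assumes "l \<in> set ks"
  shows "wedge (lin_form m (c l)) (wedge_list (map (\<lambda>k. lin_form m (c k)) ks)) = (\<lambda>S. 0)"
  using assms
proof (induction ks)
  case (Cons k ks)
  let ?R = "wedge_list (map (\<lambda>k. lin_form m (c k)) ks)"
  show ?case
  proof (cases "k = l")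
    case True
    then show ?thesis
      by (simp add: wedge_list_Cons wedge_assoc[symmetric] wedge_lin_form_self wedge_zero_left)
  next
    case False
    have "wedge (lin_form m (c l)) (wedge (lin_form m (c k)) ?R) =
        wedge (\<lambda>S. -1 * wedge (lin_form m (c k)) (lin_form m (c l)) S) ?R"
      using wedge_lin_form_anticommute[of m "c l" "c k"] by (simp add: wedge_assoc[symmetric])
    also have "\<dots> = (\<lambda>S. -1 * wedge (lin_form m (c k)) (wedge (lin_form m (c l)) ?R) S)"
      by (simp only: wedge_scale_left wedge_assoc)
    finally show ?thesis using Cons False by (simp add: wedge_list_Cons wedge_zero_right)
  qed
qed simp

section \<open>Hermitian forms\<close>

lemma vec_eq_if_diff_eq_0:
  fixes u v :: "'a::ab_group_add vec"
  assumes "u \<in> carrier_vec g" "v \<in> carrier_vec g" "u - v = 0\<^sub>v g"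
  shows "u = v"
proof (rule eq_vecI)
  fix i assume i: "i < dim_vec v"
  have "(u - v) $ i = 0" using assms(2,3) i by simp
  then show "u $ i = v $ i" using assms(1,2) i by simp
qed (use assms in simp)

text \<open>A x is built up column by column, staying in W. The scalar set K is a parameter so that
  one argument serves integer combinations in a lattice, real combinations for real-linear or
  antilinear functionals, and complex combinations.\<close>

lemma mult_mat_vec_mem_and_linear:
  fixes F :: "complex vec \<Rightarrow> complex"
  assumes A: "A \<in> carrier_mat g m" and x: "x \<in> carrier_vec m"
    and W: "W \<subseteq> carrier_vec g" "0\<^sub>v g \<in> W" "\<And>u v. u \<in> W \<Longrightarrow> v \<in> W \<Longrightarrow> u + v \<in> W"
      "\<And>c v. c \<in> K \<Longrightarrow> v \<in> W \<Longrightarrow> c \<cdot>\<^sub>v v \<in> W"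
    and cols: "\<And>j. j < m \<Longrightarrow> col A j \<in> W" and K: "\<And>j. j < m \<Longrightarrow> x $ j \<in> K"
    and add: "\<And>u v. u \<in> W \<Longrightarrow> v \<in> W \<Longrightarrow> F (u + v) = F u + F v"
    and scale: "\<And>c v. c \<in> K \<Longrightarrow> v \<in> W \<Longrightarrow> F (c \<cdot>\<^sub>v v) = c * F v"
  shows "A *\<^sub>v x \<in> W" "F (A *\<^sub>v x) = (\<Sum>j<m. x $ j * F (col A j))"
proof -
  define s where "s k = vec g (\<lambda>i. \<Sum>j<k. A $$ (i, j) * x $ j)" for k
  have s0: "s 0 = 0\<^sub>v g" by (auto simp: s_def)
  have F0: "F (0\<^sub>v g) = 0" using add[OF W(2) W(2)] by simp
  have sS: "s (Suc k) = s k + x $ k \<cdot>\<^sub>v col A k" if "k < m" for k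
    using that A by (auto simp: s_def)
  have "s k \<in> W \<and> F (s k) = (\<Sum>j<k. x $ j * F (col A j))" if "k \<le> m" for k
    using that
  proof (induction k)
    case 0
    show ?case by (simp add: s0 F0 W)
  next
    case (Suc k)
    then have k: "k < m" "s k \<in> W" "F (s k) = (\<Sum>j<k. x $ j * F (col A j))" by auto
    have "x $ k \<cdot>\<^sub>v col A k \<in> W" by (rule W(4)[OF K[OF k(1)] cols[OF k(1)]])
    moreover have "F (x $ k \<cdot>\<^sub>v col A k) = x $ k * F (col A k)"
      by (rule scale[OF K[OF k(1)] cols[OF k(1)]])
    ultimately show ?case using k by (simp add: sS[OF k(1)] W(3) add)
  qed
  from this[OF order_refl] have "s m \<in> W" "F (s m) = (\<Sum>j<m. x $ j * F (col A j))" by auto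
  moreover have "s m = A *\<^sub>v x"
    using A x by (auto simp: s_def scalar_prod_def atLeast0LessThan intro!: sum.cong)
  ultimately show "A *\<^sub>v x \<in> W" "F (A *\<^sub>v x) = (\<Sum>j<m. x $ j * F (col A j))" by simp_all
qed

text \<open>A is padded with zero rows to a square matrix B. Its last row is zero, so the last unit
  vector lies in the kernel of the transpose and det B = 0.\<close>

lemma exists_kernel_vec:
  fixes A :: "'a::field mat"
  assumes A: "A \<in> carrier_mat k n" and "k < n"
  shows "\<exists>x\<in>carrier_vec n. x \<noteq> 0\<^sub>v n \<and> A *\<^sub>v x = 0\<^sub>v k"
proof -
  define B where "B = mat n n (\<lambda>(i, j). if i < k then A $$ (i, j) else 0)"
  have B: "B \<in> carrier_mat n n" by (simp add: B_def)
  have "transpose_mat B *\<^sub>v unit_vec n (n - 1) = 0\<^sub>v n"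
  proof (rule eq_vecI)
    fix i assume "i < dim_vec (0\<^sub>v n :: 'a vec)"
    then have i: "i < n" by simp
    have "col B i $ (n - 1) = 0" using i \<open>k < n\<close> by (auto simp: B_def)
    then show "(transpose_mat B *\<^sub>v unit_vec n (n - 1)) $ i = 0\<^sub>v n $ i"
      using i B \<open>k < n\<close> by simp
  qed (use B in simp)
  moreover have "unit_vec n (n - 1) \<noteq> (0\<^sub>v n :: 'a vec)" using \<open>k < n\<close> by (intro unit_vec_nonzero) simp
  ultimately have "det (transpose_mat B) = 0"
    using det_0_iff_vec_prod_zero_field[OF transpose_carrier_mat[THEN iffD2, OF B]] unit_vec_carrier[of n "n - 1"] by blast
  then have "det B = 0" using det_transpose[OF B] by simp
  then obtain x where x: "x \<in> carrier_vec n" "x \<noteq> 0\<^sub>v n" "B *\<^sub>v x = 0\<^sub>v n"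
    using det_0_iff_vec_prod_zero_field[OF B] by blast
  have "A *\<^sub>v x = 0\<^sub>v k"
  proof (rule eq_vecI)
    fix i assume "i < dim_vec (0\<^sub>v k :: 'a vec)"
    then have i: "i < k" by simp
    have "row B i = row A i" using i A \<open>k < n\<close> by (auto simp: B_def)
    then have "(A *\<^sub>v x) $ i = (B *\<^sub>v x) $ i" using i A B \<open>k < n\<close> by simp
    also have "\<dots> = 0" using x i \<open>k < n\<close> by simp
    finally show "(A *\<^sub>v x) $ i = 0\<^sub>v k $ i" using i by simp
  qed (use A in simp)
  with x show ?thesis by blast
qed

text \<open>
  If \<open>p(f)\<close> annihilates a nonzero vector, stripping the linear factors of \<open>p\<close> one at a time produces an
  eigenvector.
\<close>

lemma eigenvector_of_annihilating_poly:
  fixes f :: "complex vec \<Rightarrow> complex vec"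
  assumes U: "U \<subseteq> carrier_vec g" "\<And>u v. u \<in> U \<Longrightarrow> v \<in> U \<Longrightarrow> u + v \<in> U"
      "\<And>c v. v \<in> U \<Longrightarrow> c \<cdot>\<^sub>v v \<in> U"
    and f: "\<And>u. u \<in> U \<Longrightarrow> f u \<in> U" "\<And>u v. u \<in> U \<Longrightarrow> v \<in> U \<Longrightarrow> f (u + v) = f u + f v"
      "\<And>c v. v \<in> U \<Longrightarrow> f (c \<cdot>\<^sub>v v) = c \<cdot>\<^sub>v f v"
    and "p \<noteq> 0" "degree p = n" "u \<in> U" "u \<noteq> 0\<^sub>v g"
    and "\<And>l. l < g \<Longrightarrow> (\<Sum>i\<le>n. coeff p i * (f ^^ i) u $ l) = 0"
  shows "\<exists>w\<in>U. w \<noteq> 0\<^sub>v g \<and> (\<exists>c. f w = c \<cdot>\<^sub>v w)"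
  using assms(7-)
proof (induction n arbitrary: p u)
  case 0
  then have "u $ l = 0" if "l < g" for l
    using that leading_coeff_0_iff[of p] by fastforce
  then have "u = 0\<^sub>v g" using 0 U(1) by (intro eq_vecI) auto
  then show ?case using 0 by blast
next
  case (Suc n)
  have "\<not> constant (poly p)" using Suc.prems(2) by (simp add: constant_degree)
  then obtain z where "poly p z = 0" using fundamental_theorem_of_algebra by blast
  then obtain q where p: "p = [:-z, 1:] * q" by (metis dvdE poly_eq_0_iff_dvd)
  then have q0: "q \<noteq> 0" using Suc.prems(1) by auto
  then have dq: "degree q = n"
    using Suc.prems(2) p degree_mult_eq[of "[:-z, 1:]" q] by simp
  define w where "w = f u + (- z) \<cdot>\<^sub>v u"
  have wU: "w \<in> U" unfolding w_def using Suc.prems U f by blast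
  have fi: "(f ^^ i) u \<in> U" for i by (induction i) (use Suc.prems f in auto)
  have fw: "(f ^^ i) w = (f ^^ Suc i) u + (- z) \<cdot>\<^sub>v (f ^^ i) u" for i
  proof (induction i)
    case (Suc i)
    then have "(f ^^ Suc i) w = f ((f ^^ Suc i) u + (- z) \<cdot>\<^sub>v (f ^^ i) u)" by simp
    also have "\<dots> = f ((f ^^ Suc i) u) + f ((- z) \<cdot>\<^sub>v (f ^^ i) u)"
      by (rule f(2)) (use fi U in blast)+
    also have "f ((- z) \<cdot>\<^sub>v (f ^^ i) u) = (- z) \<cdot>\<^sub>v (f ^^ Suc i) u"
      using f(3)[OF fi] by simp
    finally show ?case by simp
  qed (simp add: w_def)
  show ?case
  proof (cases "w = 0\<^sub>v g")
    case True
    have "f u = z \<cdot>\<^sub>v u"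
    proof (rule eq_vecI)
      have d: "dim_vec u = g" "dim_vec (f u) = g"
        using Suc.prems(3) f(1)[OF Suc.prems(3)] U(1) carrier_vecD by blast+
      then show "dim_vec (f u) = dim_vec (z \<cdot>\<^sub>v u)" by simp
      fix l assume "l < dim_vec (z \<cdot>\<^sub>v u)"
      then have l: "l < g" using d by simp
      have "w $ l = 0" using True l by simp
      then show "f u $ l = (z \<cdot>\<^sub>v u) $ l" using l d by (simp add: w_def)
    qed
    then show ?thesis using Suc.prems by blast
  next
    case False
    have "(\<Sum>i\<le>n. coeff q i * (f ^^ i) w $ l) = 0" if l: "l < g" for l
    proof -
      let ?x = "\<lambda>i. (f ^^ i) u $ l"
      have d: "dim_vec ((f ^^ i) u) = g" for i using fi[of i] U(1) by auto
      have x: "(f ^^ i) w $ l = ?x (Suc i) - z * ?x i" for i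
        unfolding fw using d[of i] d[of "Suc i"] l by simp
      have c: "coeff p 0 = - z * coeff q 0" "coeff p (Suc i) = coeff q i - z * coeff q (Suc i)" for i
        unfolding p by simp_all
      have "0 = (\<Sum>i\<le>Suc n. coeff p i * ?x i)" using Suc.prems(5)[OF l] by simp
      also have "\<dots> = coeff p 0 * ?x 0 + (\<Sum>i\<le>n. coeff p (Suc i) * ?x (Suc i))"
        by (rule sum.atMost_Suc_shift)
      also have "\<dots> = (\<Sum>i\<le>n. coeff q i * ?x (Suc i))
          - z * (coeff q 0 * ?x 0 + (\<Sum>i\<le>n. coeff q (Suc i) * ?x (Suc i)))"
        unfolding c left_diff_distrib sum_subtractf by (simp add: distrib_left sum_distrib_left mult.assoc)
      also have "coeff q 0 * ?x 0 + (\<Sum>i\<le>n. coeff q (Suc i) * ?x (Suc i)) = (\<Sum>i\<le>Suc n. coeff q i * ?x i)"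
        by (rule sum.atMost_Suc_shift[symmetric])
      also have "\<dots> = (\<Sum>i\<le>n. coeff q i * ?x i)" using dq by (simp add: coeff_eq_0)
      finally show ?thesis
        unfolding x right_diff_distrib sum_subtractf by (simp add: sum_distrib_left mult.left_commute)
    qed
    then show ?thesis using Suc.IH[OF q0 dq wU False] by blast
  qed
qed

text \<open>The g + 1 vectors u, f u, ..., f^g u in C^g are linearly dependent; a kernel vector of
  the matrix with these columns is the coefficient list of a nonzero polynomial p with p(f) u = 0.
  Arguing with iterates avoids choosing a basis of U.\<close>

lemma invariant_subspace_eigenvector:
  fixes f :: "complex vec \<Rightarrow> complex vec"
  assumes U: "U \<subseteq> carrier_vec g" "\<And>u v. u \<in> U \<Longrightarrow> v \<in> U \<Longrightarrow> u + v \<in> U"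
      "\<And>c v. v \<in> U \<Longrightarrow> c \<cdot>\<^sub>v v \<in> U"
    and f: "\<And>u. u \<in> U \<Longrightarrow> f u \<in> U" "\<And>u v. u \<in> U \<Longrightarrow> v \<in> U \<Longrightarrow> f (u + v) = f u + f v"
      "\<And>c v. v \<in> U \<Longrightarrow> f (c \<cdot>\<^sub>v v) = c \<cdot>\<^sub>v f v"
    and u: "u \<in> U" "u \<noteq> 0\<^sub>v g"
  shows "\<exists>w\<in>U. w \<noteq> 0\<^sub>v g \<and> (\<exists>c. f w = c \<cdot>\<^sub>v w)"
proof -
  define A where "A = mat g (Suc g) (\<lambda>(l, i). (f ^^ i) u $ l)"
  have A: "A \<in> carrier_mat g (Suc g)" by (simp add: A_def)
  obtain x where x: "x \<in> carrier_vec (Suc g)" "x \<noteq> 0\<^sub>v (Suc g)" "A *\<^sub>v x = 0\<^sub>v g"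
    using exists_kernel_vec[OF A] by auto
  define p where "p = (\<Sum>i\<le>g. monom (x $ i) i)"
  have cp: "coeff p i = (if i \<le> g then x $ i else 0)" for i
    by (simp add: p_def coeff_sum sum.delta)
  have "p \<noteq> 0"
  proof
    assume "p = 0"
    then have "x $ i = 0" if "i \<le> g" for i using cp[of i] that by simp
    then have "x = 0\<^sub>v (Suc g)" using x(1) by (intro eq_vecI) auto
    then show False using x(2) by simp
  qed
  moreover have "(\<Sum>i\<le>degree p. coeff p i * (f ^^ i) u $ l) = 0" if l: "l < g" for l
  proof -
    have dp: "degree p \<le> g" by (rule degree_le) (simp add: cp)
    have "(\<Sum>i\<le>degree p. coeff p i * (f ^^ i) u $ l) = (\<Sum>i\<le>g. coeff p i * (f ^^ i) u $ l)"
      by (rule sum.mono_neutral_left) (use dp in \<open>auto simp: coeff_eq_0\<close>)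
    also have "\<dots> = (\<Sum>i<Suc g. A $$ (l, i) * x $ i)"
      using l unfolding lessThan_Suc_atMost by (intro sum.cong refl) (simp add: cp A_def)
    also have "\<dots> = (A *\<^sub>v x) $ l"
      using l x(1) A by (simp add: scalar_prod_def atLeast0LessThan del: sum.lessThan_Suc)
    finally show ?thesis using x(3) l by simp
  qed
  ultimately show ?thesis using eigenvector_of_annihilating_poly[OF U f _ refl u] by blast
qed

section \<open>Definite hermitian forms and the spectral theorem\<close>

locale definite_hermitian =
  fixes g :: nat and H :: "complex vec \<Rightarrow> complex vec \<Rightarrow> complex"
  assumes hermitian: "hermitian_form (carrier_vec g) H"
    and definite: "v \<in> carrier_vec g \<Longrightarrow> v \<noteq> 0\<^sub>v g \<Longrightarrow> Re (H v v) > 0"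
begin

lemma H_outside: "v \<notin> carrier_vec g \<or> w \<notin> carrier_vec g \<Longrightarrow> H v w = 0"
  and H_add_left: "u \<in> carrier_vec g \<Longrightarrow> v \<in> carrier_vec g \<Longrightarrow> w \<in> carrier_vec g \<Longrightarrow> H (u + v) w = H u w + H v w"
  and H_smult_left: "v \<in> carrier_vec g \<Longrightarrow> w \<in> carrier_vec g \<Longrightarrow> H (c \<cdot>\<^sub>v v) w = c * H v w"
  and H_commute: "v \<in> carrier_vec g \<Longrightarrow> w \<in> carrier_vec g \<Longrightarrow> H w v = cnj (H v w)"
  using hermitian unfolding hermitian_form_def by blast+

lemma H_add_right:
  assumes "u \<in> carrier_vec g" "v \<in> carrier_vec g" "w \<in> carrier_vec g"
  shows "H w (u + v) = H w u + H w v"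
  using assms by (simp add: H_commute[of _ w] H_add_left)

lemma H_smult_right:
  assumes "v \<in> carrier_vec g" "w \<in> carrier_vec g" shows "H w (c \<cdot>\<^sub>v v) = cnj c * H w v"
  using assms by (simp add: H_commute[of _ w] H_smult_left)

lemma H_zero_left: "w \<in> carrier_vec g \<Longrightarrow> H (0\<^sub>v g) w = 0"
  using H_add_left[of "0\<^sub>v g" "0\<^sub>v g" w] by simp

lemma H_diff_left:
  assumes "u \<in> carrier_vec g" "v \<in> carrier_vec g" "w \<in> carrier_vec g"
  shows "H (u - v) w = H u w - H v w"
proof -
  have "u - v = u + (-1) \<cdot>\<^sub>v v" using assms by auto
  then show ?thesis using assms by (simp add: H_add_left H_smult_left)
qed

lemma Im_H_self: "v \<in> carrier_vec g \<Longrightarrow> Im (H v v) = 0"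
  using H_commute[of v v] by (simp add: complex_eq_iff)

lemma H_self_eq_0: "v \<in> carrier_vec g \<Longrightarrow> H v v = 0 \<Longrightarrow> v = 0\<^sub>v g"
  using definite by force

lemma eq_if_H_eq:
  assumes "u \<in> carrier_vec g" "v \<in> carrier_vec g" "\<And>w. w \<in> carrier_vec g \<Longrightarrow> H u w = H v w"
  shows "u = v"
proof -
  have "H (u - v) (u - v) = 0" using assms by (simp add: H_diff_left)
  then have z: "u - v = 0\<^sub>v g" using assms by (intro H_self_eq_0) auto
  show ?thesis
  proof (rule eq_vecI)
    fix i assume "i < dim_vec v"
    then have "(u - v) $ i = 0" using z assms by simp
    then show "u $ i = v $ i" using \<open>i < dim_vec v\<close> assms by simp
  qed (use assms in simp)
qed

text \<open>Moving f to the other argument of H turns linearity of f into linearity of H in its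
  first argument; definiteness then removes the test vector. This makes \<open>endo\<close> linear,
  although it is defined pointwise by a choice.\<close>

lemma self_adjoint_linear:
  assumes f: "\<And>v. v \<in> carrier_vec g \<Longrightarrow> f v \<in> carrier_vec g"
    and sa: "\<And>v w. v \<in> carrier_vec g \<Longrightarrow> w \<in> carrier_vec g \<Longrightarrow> H (f v) w = H v (f w)"
  shows "\<And>u v. u \<in> carrier_vec g \<Longrightarrow> v \<in> carrier_vec g \<Longrightarrow> f (u + v) = f u + f v"
    and "\<And>c v. v \<in> carrier_vec g \<Longrightarrow> f (c \<cdot>\<^sub>v v) = c \<cdot>\<^sub>v f v"
proof -
  fix u v :: "complex vec" assume uv: "u \<in> carrier_vec g" "v \<in> carrier_vec g"
  show "f (u + v) = f u + f v"
    by (rule eq_if_H_eq) (use uv f in \<open>simp_all add: sa H_add_left\<close>)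
next
  fix c and v :: "complex vec" assume v: "v \<in> carrier_vec g"
  show "f (c \<cdot>\<^sub>v v) = c \<cdot>\<^sub>v f v"
    by (rule eq_if_H_eq) (use v f in \<open>simp_all add: sa H_smult_left\<close>)
qed

text \<open>Induction on the number k of eigenvectors found. Their H-orthogonal complement U is
  invariant by self-adjointness, and it is nonzero for k < g, being cut out of C^g by k linear
  equations.\<close>

lemma spectral_theorem:
  assumes f: "\<And>v. v \<in> carrier_vec g \<Longrightarrow> f v \<in> carrier_vec g"
    and sa: "\<And>v w. v \<in> carrier_vec g \<Longrightarrow> w \<in> carrier_vec g \<Longrightarrow> H (f v) w = H v (f w)"
  obtains v a where "\<And>i. i < g \<Longrightarrow> v i \<in> carrier_vec g"
    "\<And>i. i < g \<Longrightarrow> f (v i) = complex_of_real (a i) \<cdot>\<^sub>v v i"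
    "\<And>i j. i < g \<Longrightarrow> j < g \<Longrightarrow> H (v i) (v j) = (if i = j then 1 else 0)"
proof -
  have lin: "\<And>u v. u \<in> carrier_vec g \<Longrightarrow> v \<in> carrier_vec g \<Longrightarrow> f (u + v) = f u + f v"
    "\<And>c v. v \<in> carrier_vec g \<Longrightarrow> f (c \<cdot>\<^sub>v v) = c \<cdot>\<^sub>v f v"
    by (rule self_adjoint_linear[of f]; use f sa in blast)+
  have "\<exists>v a. (\<forall>i<k. v i \<in> carrier_vec g \<and> f (v i) = complex_of_real (a i) \<cdot>\<^sub>v v i) \<and>
      (\<forall>i<k. \<forall>j<k. H (v i) (v j) = (if i = j then 1 else 0))" if "k \<le> g" for k
    using that
  proof (induction k)
    case (Suc k)
    then have "\<exists>v a. (\<forall>i<k. v i \<in> carrier_vec g \<and> f (v i) = complex_of_real (a i) \<cdot>\<^sub>v v i) \<and>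
      (\<forall>i<k. \<forall>j<k. H (v i) (v j) = (if i = j then 1 else 0))" by simp
    then obtain v a where "(\<forall>i<k. v i \<in> carrier_vec g \<and> f (v i) = complex_of_real (a i) \<cdot>\<^sub>v v i) \<and>
      (\<forall>i<k. \<forall>j<k. H (v i) (v j) = (if i = j then 1 else 0))" by blast
    then have va: "\<And>i. i < k \<Longrightarrow> v i \<in> carrier_vec g"
      "\<And>i. i < k \<Longrightarrow> f (v i) = complex_of_real (a i) \<cdot>\<^sub>v v i"
      "\<And>i j. i < k \<Longrightarrow> j < k \<Longrightarrow> H (v i) (v j) = (if i = j then 1 else 0)" by blast+
    define U where "U = {u \<in> carrier_vec g. \<forall>i<k. H u (v i) = 0}"
    have U: "U \<subseteq> carrier_vec g" "\<And>u v. u \<in> U \<Longrightarrow> v \<in> U \<Longrightarrow> u + v \<in> U"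
      "\<And>c v. v \<in> U \<Longrightarrow> c \<cdot>\<^sub>v v \<in> U"
      by (auto simp: U_def H_add_left H_smult_left va)
    have fU: "f u \<in> U" if "u \<in> U" for u
      using that by (auto simp: U_def f sa va H_smult_right)
    define A where "A = mat k g (\<lambda>(i, l). H (unit_vec g l) (v i))"
    have A: "A \<in> carrier_mat k g" by (simp add: A_def)
    obtain u where u: "u \<in> carrier_vec g" "u \<noteq> 0\<^sub>v g" "A *\<^sub>v u = 0\<^sub>v k"
      using exists_kernel_vec[OF A] Suc.prems by auto
    have "H u (v i) = 0" if i: "i < k" for i
    proof -
      have "H (1\<^sub>m g *\<^sub>v u) (v i) = (\<Sum>l<g. u $ l * H (col (1\<^sub>m g) l) (v i))"
        by (rule mult_mat_vec_mem_and_linear(2)[where W = "carrier_vec g" and K = UNIV])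
          (use i u(1) va(1) in \<open>auto simp: H_add_left H_smult_left\<close>)
      also have "\<dots> = (A *\<^sub>v u) $ i"
        using i u(1) A by (auto simp: scalar_prod_def atLeast0LessThan A_def intro!: sum.cong)
      finally show ?thesis using u i by simp
    qed
    then have "u \<in> U" using u by (simp add: U_def)
    then obtain w c where w: "w \<in> U" "w \<noteq> 0\<^sub>v g" and fw: "f w = c \<cdot>\<^sub>v w"
      using invariant_subspace_eigenvector[of U g f, OF U fU _ _ _ u(2)] lin U(1) by blast
    have wc: "w \<in> carrier_vec g" using w U by blast
    have Hw: "H w w \<noteq> 0" "Re (H w w) > 0" "Im (H w w) = 0"
      using definite[OF wc w(2)] Im_H_self[OF wc] by auto
    \<comment> \<open>The two sides are H (f w) w and H w (f w): the eigenvalue is real.\<close>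
    have "c * H w w = cnj c * H w w" using sa[OF wc wc] wc by (simp add: fw H_smult_left H_smult_right)
    then have "c = cnj c" using Hw(1) mult_right_cancel by blast
    define b where "b = Re c"
    have c: "c = complex_of_real b" using arg_cong[OF \<open>c = cnj c\<close>, of Im] by (simp add: complex_eq_iff b_def)
    define r where "r = 1 / sqrt (Re (H w w))"
    define w' where "w' = complex_of_real r \<cdot>\<^sub>v w"
    have w': "w' \<in> U" "w' \<in> carrier_vec g" using w U by (auto simp: w'_def)
    have "r * (r * Re (H w w)) = 1" using Hw by (simp add: r_def)
    moreover have "H w' w' = complex_of_real r * (complex_of_real r * H w w)"
      using wc by (simp add: w'_def H_smult_left H_smult_right)
    ultimately have n: "H w' w' = 1" using Hw by (simp add: complex_eq_iff)
    have fw': "f w' = complex_of_real b \<cdot>\<^sub>v w'"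
      unfolding w'_def by (simp add: lin(2)[OF wc] fw c smult_smult_assoc mult.commute)
    have o: "H w' (v i) = 0" "H (v i) w' = 0" if "i < k" for i
      using w' that va(1) H_commute[of w' "v i"] by (auto simp: U_def)
    show ?case
      by (rule exI[of _ "v(k := w')"], rule exI[of _ "a(k := b)"])
        (use va w' n fw' o in \<open>auto simp: less_Suc_eq\<close>)
  qed simp
  from this[OF order_refl] obtain v a where
    "\<forall>i<g. v i \<in> carrier_vec g \<and> f (v i) = complex_of_real (a i) \<cdot>\<^sub>v v i"
    "\<forall>i<g. \<forall>j<g. H (v i) (v j) = (if i = j then 1 else 0)" by blast
  then show thesis by (intro that[of v a]) simp_all
qed

end

section \<open>Orthonormal bases: expansion, Parseval and Riesz\<close>

locale orthonormal_basis = definite_hermitian +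
  fixes v :: "nat \<Rightarrow> complex vec"
  assumes v_carrier: "i < g \<Longrightarrow> v i \<in> carrier_vec g"
    and v_orthonormal: "i < g \<Longrightarrow> j < g \<Longrightarrow> H (v i) (v j) = (if i = j then 1 else 0)"
begin

definition V :: "complex mat" where "V = mat g g (\<lambda>(l, i). v i $ l)"

lemma V_carrier: "V \<in> carrier_mat g g" by (simp add: V_def)

lemma col_V: "i < g \<Longrightarrow> col V i = v i"
  using v_carrier[of i] by (intro eq_vecI) (auto simp: V_def)

lemma V_linear:
  assumes "x \<in> carrier_vec g"
    and "\<And>u w. u \<in> carrier_vec g \<Longrightarrow> w \<in> carrier_vec g \<Longrightarrow> F (u + w) = F u + F w"
    and "\<And>c w. w \<in> carrier_vec g \<Longrightarrow> F (c \<cdot>\<^sub>v w) = c * F w"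
  shows "F (V *\<^sub>v x) = (\<Sum>k<g. x $ k * F (v k))"
proof -
  have "F (V *\<^sub>v x) = (\<Sum>k<g. x $ k * F (col V k))"
    by (rule mult_mat_vec_mem_and_linear(2)[where W = "carrier_vec g" and K = UNIV])
      (use assms V_carrier v_carrier in \<open>auto simp: col_V\<close>)
  then show ?thesis by (simp add: col_V)
qed

text \<open>B maps a vector to its pairings with the v k. Orthonormality says B V = 1; for square
  matrices this gives V B = 1, which is the completeness of the g vectors.\<close>

lemma expansion:
  assumes "w \<in> carrier_vec g" shows "w = V *\<^sub>v vec g (\<lambda>k. H w (v k))"
proof -
  define B where "B = mat g g (\<lambda>(k, l). H (unit_vec g l) (v k))"
  have B: "B \<in> carrier_mat g g" by (simp add: B_def)
  have Bu: "B *\<^sub>v u = vec g (\<lambda>k. H u (v k))" if u: "u \<in> carrier_vec g" for u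
  proof (rule eq_vecI)
    fix k assume "k < dim_vec (vec g (\<lambda>k. H u (v k)))"
    then have k: "k < g" by simp
    have "H (1\<^sub>m g *\<^sub>v u) (v k) = (\<Sum>l<g. u $ l * H (col (1\<^sub>m g) l) (v k))"
      by (rule mult_mat_vec_mem_and_linear(2)[where W = "carrier_vec g" and K = UNIV])
        (use k u v_carrier in \<open>auto simp: H_add_left H_smult_left\<close>)
    also have "\<dots> = (B *\<^sub>v u) $ k"
      using k u B by (auto simp: scalar_prod_def atLeast0LessThan B_def intro!: sum.cong)
    finally show "(B *\<^sub>v u) $ k = vec g (\<lambda>k. H u (v k)) $ k" using u k by simp
  qed (use B in simp)
  have "B * V = 1\<^sub>m g"
  proof (rule eq_matI)
    fix i j assume "i < dim_row (1\<^sub>m g :: complex mat)" "j < dim_col (1\<^sub>m g :: complex mat)"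
    then have ij: "i < g" "j < g" by auto
    then have "(B * V) $$ (i, j) = (B *\<^sub>v col V j) $ i" using B V_carrier by simp
    also have "\<dots> = H (v j) (v i)" using ij by (simp add: Bu col_V v_carrier)
    finally show "(B * V) $$ (i, j) = 1\<^sub>m g $$ (i, j)" using ij by (simp add: v_orthonormal)
  qed (use B V_carrier in auto)
  then have "V * B = 1\<^sub>m g" by (rule mat_mult_left_right_inverse[OF B V_carrier])
  then have "w = (V * B) *\<^sub>v w" using assms by simp
  also have "\<dots> = V *\<^sub>v (B *\<^sub>v w)" by (rule assoc_mult_mat_vec[OF V_carrier B assms])
  finally show ?thesis by (simp add: Bu assms)
qed

lemma H_linear_expansion:
  assumes "w \<in> carrier_vec g"
    and "\<And>u w. u \<in> carrier_vec g \<Longrightarrow> w \<in> carrier_vec g \<Longrightarrow> F (u + w) = F u + F w"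
    and "\<And>c w. w \<in> carrier_vec g \<Longrightarrow> F (c \<cdot>\<^sub>v w) = c * F w"
  shows "F w = (\<Sum>k<g. H w (v k) * F (v k))"
proof -
  have "F (V *\<^sub>v vec g (\<lambda>k. H w (v k))) = (\<Sum>k<g. vec g (\<lambda>k. H w (v k)) $ k * F (v k))"
    by (rule V_linear) (use assms in auto)
  then show ?thesis using expansion[OF assms(1)] by simp
qed

lemma parseval:
  assumes "u \<in> carrier_vec g" "w \<in> carrier_vec g"
  shows "H u w = (\<Sum>k<g. H u (v k) * cnj (H w (v k)))"
proof -
  have "H u w = (\<Sum>k<g. H u (v k) * H (v k) w)"
    using assms by (rule_tac H_linear_expansion[where F = "\<lambda>u. H u w"]) (auto simp: H_add_left H_smult_left)
  also have "\<dots> = (\<Sum>k<g. H u (v k) * cnj (H w (v k)))"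
    using assms v_carrier by (intro sum.cong refl) (auto simp: H_commute[of w])
  finally show ?thesis .
qed

lemma eq_0_if_orthogonal:
  assumes "w \<in> carrier_vec g" "\<And>k. k < g \<Longrightarrow> H w (v k) = 0" shows "w = 0\<^sub>v g"
  using assms by (intro H_self_eq_0) (simp_all add: parseval[of w w])

text \<open>Since H u (v k) is the k-th coefficient of u, the representing vector must have the
  coefficients l (v k). Conjugation makes the antilinear l accessible to the expansion of linear
  maps.\<close>

lemma riesz_basis:
  assumes l: "l \<in> antidual (carrier_vec g)"
  shows "\<exists>u\<in>carrier_vec g. H u = l"
proof -
  define u where "u = V *\<^sub>v vec g (\<lambda>k. l (v k))"
  have u: "u \<in> carrier_vec g" using V_carrier by (simp add: u_def)
  have "H u w = l w" for w
  proof (cases "w \<in> carrier_vec g")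
    case True
    have "H u w = (\<Sum>k<g. vec g (\<lambda>k. l (v k)) $ k * H (v k) w)"
      unfolding u_def by (rule V_linear) (use True in \<open>auto simp: H_add_left H_smult_left\<close>)
    moreover have "cnj (l w) = (\<Sum>k<g. H w (v k) * cnj (l (v k)))"
      by (rule H_linear_expansion[where F = "\<lambda>w. cnj (l w)"]) (use True l in \<open>auto simp: antidual_def\<close>)
    then have "l w = cnj (\<Sum>k<g. H w (v k) * cnj (l (v k)))" by (metis complex_cnj_cnj)
    ultimately show ?thesis using True v_carrier
      by (auto simp: H_commute[of w] mult.commute intro!: sum.cong)
  next
    case False
    then show ?thesis using l by (simp add: antidual_def H_outside)
  qed
  with u show ?thesis by blast
qed

end

context definite_hermitian
begin

text \<open>An eigenbasis of the zero map, which is self-adjoint, replaces Gram-Schmidt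
  orthogonalization.\<close>

lemma exists_orthonormal_basis: "\<exists>v. orthonormal_basis g H v"
proof -
  obtain v a where v: "\<And>i. i < g \<Longrightarrow> v i \<in> carrier_vec g"
    "\<And>i. i < g \<Longrightarrow> (0\<^sub>v g) = complex_of_real (a i) \<cdot>\<^sub>v v i"
    "\<And>i j. i < g \<Longrightarrow> j < g \<Longrightarrow> H (v i) (v j) = (if i = j then 1 else 0)"
    by (rule spectral_theorem[of "\<lambda>v. 0\<^sub>v g"]) (auto simp: H_zero_left H_commute[of "0\<^sub>v g"])
  have "orthonormal_basis g H v" by unfold_locales (use v in auto)
  then show ?thesis by blast
qed

lemma riesz:
  assumes "l \<in> antidual (carrier_vec g)" shows "\<exists>u\<in>carrier_vec g. H u = l"
  using exists_orthonormal_basis orthonormal_basis.riesz_basis[OF _ assms] by blast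

end

section \<open>Subspaces and lattices\<close>

lemma complex_subspace_iff:
  "complex_subspace g W \<longleftrightarrow> W \<subseteq> carrier_vec g \<and> 0\<^sub>v g \<in> W \<and>
    (\<forall>u\<in>W. \<forall>v\<in>W. u + v \<in> W) \<and> (\<forall>c. \<forall>v\<in>W. c \<cdot>\<^sub>v v \<in> W)"
proof -
  interpret V: vec_space "TYPE(complex)" g .
  show ?thesis
    unfolding complex_subspace_def VectorSpace.subspace_def submodule_def
    using V.vectorspace_axioms V.module_axioms
    by (auto simp: module_vec_simps class_ring_simps)
qed

lemma subspace_diff:
  assumes W: "complex_subspace g W" and uv: "u \<in> W" "v \<in> W"
  shows "u - v \<in> W"
proof -
  have "u \<in> carrier_vec g" "v \<in> carrier_vec g" using W uv by (auto simp: complex_subspace_iff)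
  then have eq: "u - v = u + (-1) \<cdot>\<^sub>v v" by auto
  have "(-1) \<cdot>\<^sub>v v \<in> W" using W uv by (simp add: complex_subspace_iff)
  then show ?thesis unfolding eq using W uv by (simp add: complex_subspace_iff)
qed

lemma subspace_carrier: "complex_subspace g (carrier_vec g)"
  by (auto simp: complex_subspace_iff)

section \<open>The alternating form E = Im H\<close>

context definite_hermitian
begin

definition E :: "complex vec \<Rightarrow> complex vec \<Rightarrow> real" where
  "E v w = Im (H v w)"

lemma E_add_left: "u \<in> carrier_vec g \<Longrightarrow> v \<in> carrier_vec g \<Longrightarrow> w \<in> carrier_vec g \<Longrightarrow> E (u + v) w = E u w + E v w"
  and E_add_right: "u \<in> carrier_vec g \<Longrightarrow> v \<in> carrier_vec g \<Longrightarrow> w \<in> carrier_vec g \<Longrightarrow> E w (u + v) = E w u + E w v"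
  and E_diff_left: "u \<in> carrier_vec g \<Longrightarrow> v \<in> carrier_vec g \<Longrightarrow> w \<in> carrier_vec g \<Longrightarrow> E (u - v) w = E u w - E v w"
  and E_smult_left: "v \<in> carrier_vec g \<Longrightarrow> w \<in> carrier_vec g \<Longrightarrow> E (complex_of_real r \<cdot>\<^sub>v v) w = r * E v w"
  and E_smult_right: "v \<in> carrier_vec g \<Longrightarrow> w \<in> carrier_vec g \<Longrightarrow> E w (complex_of_real r \<cdot>\<^sub>v v) = r * E w v"
  by (simp_all add: E_def H_add_left H_add_right H_diff_left H_smult_left H_smult_right)

lemma E_swap: "v \<in> carrier_vec g \<Longrightarrow> w \<in> carrier_vec g \<Longrightarrow> E w v = - E v w"
  using H_commute[of v w] by (simp add: E_def)

lemma E_self: "v \<in> carrier_vec g \<Longrightarrow> E v v = 0"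
  by (simp add: E_def Im_H_self)

lemma E_i_right: "v \<in> carrier_vec g \<Longrightarrow> w \<in> carrier_vec g \<Longrightarrow> E w (\<i> \<cdot>\<^sub>v v) = - Re (H w v)"
  by (simp add: E_def H_smult_right)

text \<open>Testing against i u, which lies in the complex subspace W, gives E u (i u) = - H u u,
  and this is negative unless u = 0.\<close>

lemma eq_0_if_E_eq_0:
  assumes "complex_subspace g W" "u \<in> W" "\<And>w. w \<in> W \<Longrightarrow> E u w = 0"
  shows "u = 0\<^sub>v g"
proof -
  have u: "u \<in> carrier_vec g" "\<i> \<cdot>\<^sub>v u \<in> W" using assms(1,2) by (auto simp: complex_subspace_iff)
  have "Re (H u u) = 0" using assms(3)[OF u(2)] E_i_right[OF u(1) u(1)] by simp
  then show ?thesis using definite[OF u(1)] by fastforce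
qed

lemma E_mult_mat_vec:
  assumes A: "A \<in> carrier_mat g m" and x: "x \<in> carrier_vec m" and w: "w \<in> carrier_vec g"
  shows "E (A *\<^sub>v map_vec complex_of_real x) w = (\<Sum>j<m. x $ j * E (col A j) w)"
proof -
  have "complex_of_real (E (A *\<^sub>v map_vec complex_of_real x) w) =
      (\<Sum>j<m. map_vec complex_of_real x $ j * complex_of_real (E (col A j) w))"
  proof (rule mult_mat_vec_mem_and_linear(2)[where W = "carrier_vec g" and K = "\<real>"])
    fix c :: complex and v :: "complex vec" assume "c \<in> \<real>" "v \<in> carrier_vec g"
    then show "complex_of_real (E (c \<cdot>\<^sub>v v) w) = c * complex_of_real (E v w)"
      using w by (elim Reals_cases) (simp add: E_smult_left)
  qed (use A x w in \<open>auto simp: E_add_left\<close>)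
  also have "\<dots> = complex_of_real (\<Sum>j<m. x $ j * E (col A j) w)" using x by simp
  finally show ?thesis by (simp only: of_real_eq_iff)
qed

end

context orthonormal_basis
begin

text \<open>The v k with k in I form a basis of W: pairing with v k reads off coefficients, which
  gives independence, and for w in W the combination with coefficients H w (v k) differs from w by a
  vector orthogonal to the whole basis.\<close>

lemma complex_dim_eq_card:
  assumes I: "I \<subseteq> {..<g}"
    and W: "W = {w \<in> carrier_vec g. \<forall>k<g. k \<notin> I \<longrightarrow> H w (v k) = 0}"
  shows "complex_dim g W = card I"
proof -
  interpret V: vec_space "TYPE(complex)" g .
  have sub: "complex_subspace g W"
    by (auto simp: complex_subspace_iff W H_add_left H_smult_left H_zero_left v_carrier)
  then have subsp: "VectorSpace.subspace class_ring W V.V" and subm: "submodule class_ring W V.V"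
    by (simp_all add: complex_subspace_def VectorSpace.subspace_def)
  interpret S: vectorspace class_ring "V.V\<lparr>carrier := W\<rparr>"
    by (rule V.subspace_is_vs[OF subsp])
  let ?A = "v ` I"
  have inj: "inj_on v I"
  proof (rule inj_onI)
    fix i j assume ij: "i \<in> I" "j \<in> I" "v i = v j"
    then have "i < g" "j < g" using I by auto
    then show "i = j" using v_orthonormal[of i j] v_orthonormal[of i i] ij(3) by (auto split: if_splits)
  qed
  have fin: "finite ?A" using I finite_subset by blast
  have AW: "?A \<subseteq> W" using I by (auto simp: W v_carrier v_orthonormal subset_iff)
  have AV: "?A \<subseteq> carrier_vec g" using AW W by blast
  have lc: "V.lincomb a B \<in> carrier_vec g \<and> H (V.lincomb a B) w = (\<Sum>u\<in>B. a u * H u w)"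
    if "w \<in> carrier_vec g" "finite B" "B \<subseteq> carrier_vec g" for a B w
    using that(2,3)
  proof (induction B rule: finite_induct)
    case empty
    then show ?case using that(1) by (simp add: V.lincomb_def H_zero_left)
  next
    case (insert u B)
    have "V.lincomb a (insert u B) = a u \<cdot>\<^sub>v u + V.lincomb a B"
      using insert by (subst V.lincomb_insert2) (auto simp: class_ring_simps module_vec_simps)
    then show ?case using insert that(1) by (simp add: H_add_left H_smult_left)
  qed
  have coeff: "H (V.lincomb a ?A) (v k) = a (v k)" if "k \<in> I" for a k
  proof -
    have k: "k < g" using that I by auto
    have "H (V.lincomb a ?A) (v k) = (\<Sum>i\<in>I. a (v i) * H (v i) (v k))"
      using lc[OF v_carrier[OF k] fin AV] inj by (simp add: sum.reindex)
    also have "\<dots> = (\<Sum>i\<in>I. if i = k then a (v k) else 0)"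
      using I k by (intro sum.cong refl) (auto simp: v_orthonormal subset_iff)
    finally show ?thesis using that I finite_subset[OF I] by simp
  qed
  have indep: "\<forall>u\<in>?A. a u = 0" if "V.lincomb a ?A = 0\<^sub>v g" for a
  proof -
    have "a (v k) = 0" if "k \<in> I" for k
      using coeff[OF that, of a] \<open>V.lincomb a ?A = 0\<^sub>v g\<close> that I
      by (auto simp: H_zero_left v_carrier subset_iff)
    then show ?thesis by blast
  qed
  have li: "V.lin_indpt ?A"
    by (rule V.finite_lin_indpt2[OF fin])
      (use AV indep in \<open>auto simp: class_ring_simps module_vec_simps\<close>)
  have sp: "V.span ?A = W"
  proof
    show "V.span ?A \<subseteq> W" by (rule V.span_is_subset[OF AW subm])
    show "W \<subseteq> V.span ?A"
    proof
      fix w assume w: "w \<in> W"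
      then have wc: "w \<in> carrier_vec g" by (simp add: W)
      let ?l = "V.lincomb (H w) ?A"
      have l: "?l \<in> carrier_vec g" using lc[OF wc fin AV] by blast
      have "?l \<in> V.span ?A" unfolding V.span_def using fin by (auto simp: class_ring_simps)
      then have lW: "?l \<in> W" using \<open>V.span ?A \<subseteq> W\<close> by blast
      have "w - ?l = 0\<^sub>v g"
      proof (rule eq_0_if_orthogonal)
        fix k assume "k < g"
        then show "H (w - ?l) (v k) = 0"
          using wc l w lW coeff[of k "H w"] v_carrier[of k]
          by (cases "k \<in> I") (simp_all add: H_diff_left W)
      qed (use wc l in simp)
      then have "w $ i = ?l $ i" if "i < g" for i
        using that wc l by (metis (no_types, lifting) carrier_vecD eq_iff_diff_eq_0 index_minus_vec(1) index_zero_vec(1))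
      then have "w = ?l" using wc l by (intro eq_vecI) auto
      then show "w \<in> V.span ?A" using \<open>?l \<in> V.span ?A\<close> by simp
    qed
  qed
  have "S.basis ?A"
    unfolding S.basis_def using V.span_li_not_depend[OF AW subm] li sp AW by simp
  then have "S.dim = card ?A" using fin by (rule S.dim_basis[rotated])
  then show ?thesis unfolding complex_dim_def using inj by (simp add: card_image)
qed

end

lemma mult_unit_vec_eq_col:
  assumes "B \<in> carrier_mat g m" "j < m"
  shows "B *\<^sub>v map_vec complex_of_int (unit_vec m j) = col B j"
proof -
  have "map_vec complex_of_int (unit_vec m j) = unit_vec m j" by (auto simp: unit_vec_def)
  then show ?thesis using assms by (intro eq_vecI) auto
qed

lemma lattice_basis_facts:
  assumes "lattice_basis g W \<Gamma> B"
  shows "B \<in> carrier_mat g (dim_col B)" "\<Gamma> \<subseteq> W" "\<And>j. j < dim_col B \<Longrightarrow> col B j \<in> \<Gamma>"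
    and "\<And>w. w \<in> W \<Longrightarrow> \<exists>x\<in>carrier_vec (dim_col B). w = B *\<^sub>v map_vec complex_of_real x"
    and "\<And>x. x \<in> carrier_vec (dim_col B) \<Longrightarrow> B *\<^sub>v map_vec complex_of_real x \<in> W"
proof -
  let ?m = "dim_col B"
  have dr: "dim_row B = g"
    and bij: "bij_betw (\<lambda>x. B *\<^sub>v map_vec complex_of_real x) (carrier_vec ?m) W"
    and \<Gamma>: "\<Gamma> = (\<lambda>x. B *\<^sub>v map_vec complex_of_int x) ` carrier_vec ?m"
    using assms by (auto simp: lattice_basis_def)
  show "B \<in> carrier_mat g ?m" using dr by auto
  have img: "(\<lambda>x. B *\<^sub>v map_vec complex_of_real x) ` carrier_vec ?m = W"
    using bij by (rule bij_betw_imp_surj_on)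
  then show "\<exists>x\<in>carrier_vec ?m. w = B *\<^sub>v map_vec complex_of_real x" if "w \<in> W" for w
    using that by blast
  show mem: "B *\<^sub>v map_vec complex_of_real x \<in> W" if "x \<in> carrier_vec ?m" for x
    using that img by blast
  show "\<Gamma> \<subseteq> W"
  proof
    fix l assume "l \<in> \<Gamma>"
    then obtain x where x: "x \<in> carrier_vec ?m" "l = B *\<^sub>v map_vec complex_of_int x"
      using \<Gamma> by blast
    have "map_vec complex_of_int x = map_vec complex_of_real (map_vec real_of_int x)" by auto
    then show "l \<in> W" using x mem[of "map_vec real_of_int x"] by simp
  qed
  show "col B j \<in> \<Gamma>" if "j < ?m" for j
  proof -
    have "B \<in> carrier_mat g ?m" using dr by auto
    then have "col B j = B *\<^sub>v map_vec complex_of_int (unit_vec ?m j)"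
      using that by (simp only: mult_unit_vec_eq_col)
    then show ?thesis unfolding \<Gamma> by (rule image_eqI) simp
  qed
qed

section \<open>Symplectic bases\<close>

context definite_hermitian
begin

text \<open>The sign is that of \<open>has_type\<close>, opposite to the one of the period basis,
  where E pairs column i with column g + i to - d_i. The divisibility chain is stated separately by
  \<open>elementary_divisors\<close>.\<close>

definition symplectic_columns :: "complex mat \<Rightarrow> nat list \<Rightarrow> bool" where
  "symplectic_columns B es \<longleftrightarrow> B \<in> carrier_mat g (2 * length es) \<and> (\<forall>e\<in>set es. 0 < e) \<and>
     (\<forall>i<length es. \<forall>j<length es.
        E (col B i) (col B j) = 0 \<and>
        E (col B (length es + i)) (col B (length es + j)) = 0 \<and>
        E (col B i) (col B (length es + j)) = (if i = j then real (es ! i) else 0))"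

text \<open>Each coordinate is read off by pairing with the partner column; the minus sign in the
  second half comes from swapping the arguments of E. For v outside the real span of the columns the
  formula gives the coordinates of its E-orthogonal projection to that span.\<close>

definition symplectic_coords :: "complex mat \<Rightarrow> nat list \<Rightarrow> complex vec \<Rightarrow> real vec" where
  "symplectic_coords B es v = vec (2 * length es) (\<lambda>j.
     if j < length es then E v (col B (length es + j)) / es ! j
     else - E v (col B (j - length es)) / es ! (j - length es))"

lemma sum_split_double: "(\<Sum>j<2 * k. f j) = (\<Sum>j<k. f j) + (\<Sum>j<k. f (k + j))"
  for f :: "nat \<Rightarrow> 'a::comm_monoid_add"
proof -
  have "(\<Sum>j<k + n. f j) = (\<Sum>j<k. f j) + (\<Sum>j<n. f (k + j))" for n
    by (induction n) (simp_all add: add.assoc)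
  then show ?thesis by (simp only: mult_2)
qed

lemma symplectic_pairing:
  assumes B: "symplectic_columns B es" and x: "x \<in> carrier_vec (2 * length es)" and j: "j < length es"
  shows "E (B *\<^sub>v map_vec complex_of_real x) (col B (length es + j)) = x $ j * es ! j"
    and "E (B *\<^sub>v map_vec complex_of_real x) (col B j) = - (x $ (length es + j) * es ! j)"
proof -
  let ?k = "length es"
  have Bc: "B \<in> carrier_mat g (2 * ?k)" and c: "\<And>i. col B i \<in> carrier_vec g"
    using B by (auto simp: symplectic_columns_def)
  have p: "E (col B i) (col B j) = 0" "E (col B (?k + i)) (col B (?k + j)) = 0"
    "E (col B i) (col B (?k + j)) = (if i = j then real (es ! i) else 0)"
    "E (col B (?k + i)) (col B j) = - (if i = j then real (es ! i) else 0)" if "i < ?k" for i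
    using B that j E_swap[OF c c, of "?k + i" j] by (auto simp: symplectic_columns_def)
  show "E (B *\<^sub>v map_vec complex_of_real x) (col B (?k + j)) = x $ j * es ! j"
  proof -
    have "E (B *\<^sub>v map_vec complex_of_real x) (col B (?k + j)) =
        (\<Sum>i<?k. x $ i * (if i = j then real (es ! i) else 0)) + (\<Sum>i<?k. x $ (?k + i) * 0)"
      unfolding E_mult_mat_vec[OF Bc x c] sum_split_double
      by (intro arg_cong2[of _ _ _ _ "(+)"] sum.cong refl) (simp_all add: p)
    also have "\<dots> = x $ j * es ! j" using j by (simp add: if_distrib cong: if_cong)
    finally show ?thesis .
  qed
  show "E (B *\<^sub>v map_vec complex_of_real x) (col B j) = - (x $ (?k + j) * es ! j)"
  proof -
    have "E (B *\<^sub>v map_vec complex_of_real x) (col B j) =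
        (\<Sum>i<?k. x $ i * 0) + (\<Sum>i<?k. x $ (?k + i) * - (if i = j then real (es ! i) else 0))"
      unfolding E_mult_mat_vec[OF Bc x c] sum_split_double
      by (intro arg_cong2[of _ _ _ _ "(+)"] sum.cong refl) (simp_all add: p)
    also have "\<dots> = - (x $ (?k + j) * es ! j)" using j by (simp add: if_distrib cong: if_cong)
    finally show ?thesis .
  qed
qed

lemma symplectic_coords_carrier: "symplectic_coords B es v \<in> carrier_vec (2 * length es)"
  by (simp add: symplectic_coords_def)

lemma symplectic_coords_mult:
  assumes "symplectic_columns B es" "x \<in> carrier_vec (2 * length es)"
  shows "symplectic_coords B es (B *\<^sub>v map_vec complex_of_real x) = x"
proof (rule eq_vecI)
  let ?k = "length es"
  show "dim_vec (symplectic_coords B es (B *\<^sub>v map_vec complex_of_real x)) = dim_vec x"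
    using assms by (simp add: symplectic_coords_def)
  fix j assume "j < dim_vec x"
  then have j: "j < 2 * ?k" using assms by simp
  have pos: "es ! i > 0" if "i < ?k" for i using assms that by (auto simp: symplectic_columns_def)
  show "symplectic_coords B es (B *\<^sub>v map_vec complex_of_real x) $ j = x $ j"
  proof (cases "j < ?k")
    case True
    then show ?thesis
      using j pos[OF True] symplectic_pairing(1)[OF assms True] by (simp add: symplectic_coords_def)
  next
    case False
    then obtain i where i: "j = ?k + i" "i < ?k" using j by (metis add_less_cancel_left le_Suc_ex linorder_not_less mult_2)
    then show ?thesis
      using j pos[OF i(2)] symplectic_pairing(2)[OF assms i(2)] by (simp add: symplectic_coords_def)
  qed
qed

lemma symplectic_coords_orthogonal:
  assumes B: "symplectic_columns B es" and v: "v \<in> carrier_vec g" and j: "j < 2 * length es"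
  shows "E (v - B *\<^sub>v map_vec complex_of_real (symplectic_coords B es v)) (col B j) = 0"
proof -
  let ?k = "length es" and ?x = "symplectic_coords B es v"
  have Bc: "B \<in> carrier_mat g (2 * ?k)" and c: "\<And>i. col B i \<in> carrier_vec g"
    using B by (auto simp: symplectic_columns_def)
  have pos: "es ! i > 0" if "i < ?k" for i using B that by (auto simp: symplectic_columns_def)
  have Bx: "B *\<^sub>v map_vec complex_of_real ?x \<in> carrier_vec g"
    by (rule mult_mat_vec_carrier[OF Bc]) (simp add: symplectic_coords_carrier)
  have "E (B *\<^sub>v map_vec complex_of_real ?x) (col B j) = E v (col B j)"
  proof (cases "j < ?k")
    case True
    then show ?thesis using symplectic_pairing(2)[OF B symplectic_coords_carrier True] pos[OF True]
      by (simp add: symplectic_coords_def)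
  next
    case False
    then obtain i where i: "j = ?k + i" "i < ?k" using j by (metis add_less_cancel_left le_Suc_ex linorder_not_less mult_2)
    then show ?thesis using symplectic_pairing(1)[OF B symplectic_coords_carrier i(2)] pos[OF i(2)]
      by (simp add: symplectic_coords_def)
  qed
  then show ?thesis using E_diff_left[OF v Bx c] by simp
qed

end

text \<open>E is integral and nondegenerate on \<Gamma>, while discreteness and finite generation
  are conclusions. This matters because the normal form is also applied to W \<inter> \<Lambda> in
  order to prove that it is a lattice in W.\<close>

locale integral_group = definite_hermitian +
  fixes \<Gamma> :: "complex vec set"
  assumes \<Gamma>_carrier: "z \<in> \<Gamma> \<Longrightarrow> z \<in> carrier_vec g"
    and \<Gamma>_zero: "0\<^sub>v g \<in> \<Gamma>"
    and \<Gamma>_add: "z \<in> \<Gamma> \<Longrightarrow> w \<in> \<Gamma> \<Longrightarrow> z + w \<in> \<Gamma>"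
    and \<Gamma>_smult: "z \<in> \<Gamma> \<Longrightarrow> complex_of_int q \<cdot>\<^sub>v z \<in> \<Gamma>"
    and \<Gamma>_integral: "z \<in> \<Gamma> \<Longrightarrow> w \<in> \<Gamma> \<Longrightarrow> E z w \<in> \<int>"
    and \<Gamma>_nondegenerate: "z \<in> \<Gamma> \<Longrightarrow> (\<And>w. w \<in> \<Gamma> \<Longrightarrow> E z w = 0) \<Longrightarrow> z = 0\<^sub>v g"
begin

definition perp :: "nat \<Rightarrow> (nat \<Rightarrow> complex vec) \<Rightarrow> (nat \<Rightarrow> complex vec) \<Rightarrow> complex vec set" where
  "perp k x y = {z \<in> \<Gamma>. \<forall>i<k. E z (x i) = 0 \<and> E z (y i) = 0}"

text \<open>
  A partial symplectic basis, with what is needed to extend it: every pairing with one of its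
  vectors, and every pairing within its orthogonal complement, is divisible by the divisors
  found so far, and \<open>\<Gamma>\<close> projects to that complement.
\<close>

definition partial_basis ::
    "nat \<Rightarrow> (nat \<Rightarrow> complex vec) \<Rightarrow> (nat \<Rightarrow> complex vec) \<Rightarrow> (nat \<Rightarrow> nat) \<Rightarrow> bool" where
  "partial_basis k x y e \<longleftrightarrow>
    (\<forall>i<k. x i \<in> \<Gamma> \<and> y i \<in> \<Gamma> \<and> 0 < e i) \<and>
    (\<forall>i<k. \<forall>j<k. E (x i) (x j) = 0 \<and> E (y i) (y j) = 0 \<and>
      E (x i) (y j) = (if i = j then real (e i) else 0)) \<and>
    (\<forall>i<k. \<forall>z\<in>\<Gamma>. (\<exists>q::int. E z (x i) = real_of_int q * real (e i)) \<and> (\<exists>q::int. E z (y i) = real_of_int q * real (e i))) \<and>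
    (\<forall>i. Suc i < k \<longrightarrow> e i dvd e (Suc i)) \<and>
    (\<forall>z\<in>perp k x y. \<forall>w\<in>perp k x y. \<forall>i<k. \<exists>q::int. E z w = real_of_int q * real (e i)) \<and>
    (\<forall>z\<in>\<Gamma>. \<exists>z'\<in>perp k x y. \<forall>u\<in>perp k x y. E z' u = E z u)"

lemma E_int_left: "v \<in> carrier_vec g \<Longrightarrow> w \<in> carrier_vec g \<Longrightarrow> E (complex_of_int q \<cdot>\<^sub>v v) w = of_int q * E v w"
  and E_int_right: "v \<in> carrier_vec g \<Longrightarrow> w \<in> carrier_vec g \<Longrightarrow> E w (complex_of_int q \<cdot>\<^sub>v v) = of_int q * E w v"
  using E_smult_left[of v w "of_int q"] E_smult_right[of v w "of_int q"] by simp_all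

lemma E_zero_left: "w \<in> carrier_vec g \<Longrightarrow> E (0\<^sub>v g) w = 0"
  by (simp add: E_def H_zero_left)

lemma perp_carrier: "z \<in> perp k x y \<Longrightarrow> z \<in> \<Gamma> \<and> z \<in> carrier_vec g"
  by (simp add: perp_def \<Gamma>_carrier)

lemma perp_combination:
  assumes "\<And>i. i < k \<Longrightarrow> x i \<in> \<Gamma> \<and> y i \<in> \<Gamma>" "z \<in> perp k x y" "w \<in> perp k x y"
  shows "z + complex_of_int q \<cdot>\<^sub>v w \<in> perp k x y"
  using assms by (auto simp: perp_def \<Gamma>_add \<Gamma>_smult E_add_left E_int_left \<Gamma>_carrier)

text \<open>The new pair (a, b) realizes the least positive value d of E on the complement.
  Minimality kills remainders: if a relevant value were not divisible by d, correcting by a multiple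
  of a or b would produce a smaller positive one.\<close>

lemma partial_basis_step:
  assumes st: "partial_basis k x y e" and ne: "perp k x y \<noteq> {0\<^sub>v g}"
  shows "\<exists>a b d. partial_basis (Suc k) (x(k := a)) (y(k := b)) (e(k := d))"
proof -
  let ?P = "perp k x y"
  have xy: "\<And>i. i < k \<Longrightarrow> x i \<in> \<Gamma> \<and> y i \<in> \<Gamma>" and e: "\<And>i. i < k \<Longrightarrow> 0 < e i"
    and pair: "\<And>i j. i < k \<Longrightarrow> j < k \<Longrightarrow> E (x i) (x j) = 0 \<and> E (y i) (y j) = 0 \<and>
      E (x i) (y j) = (if i = j then real (e i) else 0)"
    and div: "\<And>i z. i < k \<Longrightarrow> z \<in> \<Gamma> \<Longrightarrow>
      (\<exists>q::int. E z (x i) = real_of_int q * real (e i)) \<and> (\<exists>q::int. E z (y i) = real_of_int q * real (e i))"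
    and chain: "\<And>i. Suc i < k \<Longrightarrow> e i dvd e (Suc i)"
    and divP: "\<And>z w i. z \<in> ?P \<Longrightarrow> w \<in> ?P \<Longrightarrow> i < k \<Longrightarrow> \<exists>q::int. E z w = real_of_int q * real (e i)"
    and proj: "\<And>z. z \<in> \<Gamma> \<Longrightarrow> \<exists>z'\<in>?P. \<forall>u\<in>?P. E z' u = E z u"
    using st unfolding partial_basis_def by blast+
  have Pc: "z \<in> carrier_vec g" "z \<in> \<Gamma>" if "z \<in> ?P" for z using perp_carrier[OF that] by auto
  have comb: "z + complex_of_int q \<cdot>\<^sub>v w \<in> ?P" if "z \<in> ?P" "w \<in> ?P" for z w q
    by (rule perp_combination[OF xy that])
  define D where "D = (\<lambda>d::nat. 0 < d \<and> (\<exists>z\<in>?P. \<exists>w\<in>?P. E z w = real d))"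
  have "\<exists>d. D d"
  proof -
    have "0\<^sub>v g \<in> ?P"
      using xy by (auto simp: perp_def \<Gamma>_zero \<Gamma>_carrier E_zero_left)
    then obtain z where z: "z \<in> ?P" "z \<noteq> 0\<^sub>v g" using ne by blast
    then obtain w where w: "w \<in> \<Gamma>" "E z w \<noteq> 0" using \<Gamma>_nondegenerate[OF Pc(2)[OF z(1)]] by blast
    \<comment> \<open>Nondegeneracy gives a partner only in \<Gamma>; the projection clause of
      \<open>partial_basis\<close> moves it into the complement without changing its pairing with
      z.\<close>
    obtain w' where w': "w' \<in> ?P" "E w' z = E w z" using proj[OF w(1)] z by blast
    have "E w' z \<noteq> 0" using w' w E_swap[OF Pc(1)[OF z(1)] \<Gamma>_carrier[OF w(1)]] by simp
    moreover obtain m :: int where m: "E w' z = of_int m"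
      using \<Gamma>_integral[OF Pc(2)[OF w'(1)] Pc(2)[OF z(1)]] by (auto elim: Ints_cases)
    moreover have "E z w' = of_int (- m)" using E_swap[OF Pc(1)[OF w'(1)] Pc(1)[OF z(1)]] m by simp
    ultimately have "0 < nat \<bar>m\<bar>" by simp
    have "E w' z = real (nat \<bar>m\<bar>) \<or> E z w' = real (nat \<bar>m\<bar>)"
      using m \<open>E z w' = of_int (- m)\<close> by (cases "m > 0") auto
    with \<open>0 < nat \<bar>m\<bar>\<close> have "D (nat \<bar>m\<bar>)" unfolding D_def using z(1) w'(1) by blast
    then show ?thesis by blast
  qed
  then have D: "D (LEAST d. D d)" by (auto intro: LeastI)
  define d where "d = (LEAST d. D d)"
  have "D d" using D by (simp only: d_def)
  then have "0 < d" "\<exists>z\<in>?P. \<exists>w\<in>?P. E z w = real d" by (simp_all only: D_def)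
  then obtain a b where ab: "a \<in> ?P" "b \<in> ?P" "E a b = real d" and d: "0 < d" by blast
  have small: "r = 0" if "z \<in> ?P" "w \<in> ?P" "E z w = of_int r" "0 \<le> r" "r < int d" for z w r
  proof (rule ccontr)
    assume "r \<noteq> 0"
    then have "0 < nat r" "E z w = real (nat r)" using that by simp_all
    then have "D (nat r)" unfolding D_def using that(1,2) by blast
    then have "d \<le> nat r" unfolding d_def by (rule Least_le)
    then show False using that by linarith
  qed
  have int: "\<exists>m::int. E z w = of_int m" if "z \<in> ?P" "w \<in> ?P" for z w
    using \<Gamma>_integral[OF Pc(2)[OF that(1)] Pc(2)[OF that(2)]] by (auto elim: Ints_cases)
  have md: "real_of_int m - of_int (m div int d) * real d = of_int (m mod int d)" for m
  proof -
    have "of_int (m div int d) * real d + of_int (m mod int d) = real_of_int m"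
      by (metis div_mult_mod_eq of_int_add of_int_mult of_int_of_nat_eq)
    then show ?thesis by linarith
  qed
  have mr: "m mod int d = 0 \<Longrightarrow> real_of_int m = of_int (m div int d) * real d" for m
    using md[of m] by simp
  have ba: "E b a = - real d" using E_swap[of a b] ab Pc by simp
  have divb: "\<exists>q::int. E z b = real_of_int q * real d" if z: "z \<in> ?P" for z
  proof -
    obtain m where m: "E z b = of_int m" using int[OF z ab(2)] by blast
    let ?z = "z + complex_of_int (- (m div int d)) \<cdot>\<^sub>v a"
    have "E ?z b = E z b + of_int (- (m div int d)) * E a b"
      using Pc z ab by (simp add: E_add_left E_int_left del: of_int_minus)
    then have "E ?z b = of_int (m mod int d)" using md[of m] m ab(3) by simp
    then have "m mod int d = 0" by (rule small[OF comb[OF z ab(1)] ab(2)]) (use d in auto)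
    then show ?thesis using m mr by metis
  qed
  have diva: "\<exists>q::int. E z a = real_of_int q * real d" if z: "z \<in> ?P" for z
  proof -
    obtain m where m: "E z a = of_int m" using int[OF z ab(1)] by blast
    let ?z = "z + complex_of_int (m div int d) \<cdot>\<^sub>v b"
    have "E ?z a = E z a + of_int (m div int d) * E b a"
      using Pc z ab by (simp add: E_add_left E_int_left)
    then have "E ?z a = of_int (m mod int d)" using md[of m] m ba by simp
    then have "m mod int d = 0" by (rule small[OF comb[OF z ab(2)] ab(1)]) (use d in auto)
    then show ?thesis using m mr by metis
  qed
  have divd: "\<exists>q::int. E z w = real_of_int q * real d"
    if z: "z \<in> ?P" "E z b = 0" and w: "w \<in> ?P" "E w a = 0" for z w
  proof -
    obtain m where m: "E z w = of_int m" using int[OF z(1) w(1)] by blast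
    \<comment> \<open>Because E z b = 0 and E w a = 0, pairing z + a with w - q b gives E z w - q d:
      the coupled vectors reduce E z w to its remainder modulo d, to which minimality applies. This
      is the source of the divisibility chain.\<close>
    let ?z = "z + complex_of_int 1 \<cdot>\<^sub>v a" and ?w = "w + complex_of_int (- (m div int d)) \<cdot>\<^sub>v b"
    have "E a w = 0" using E_swap[of w a] w ab Pc by simp
    then have "E ?z ?w = E z w + of_int (- (m div int d)) * E a b"
      using Pc z w ab by (simp add: E_add_left E_add_right E_int_right del: of_int_minus)
    then have "E ?z ?w = of_int (m mod int d)" using md[of m] m ab(3) by simp
    then have "m mod int d = 0"
      by (rule small[OF comb[OF z(1) ab(1)] comb[OF w(1) ab(2)]]) (use d in auto)
    then show ?thesis using m mr by metis
  qed
  let ?x = "x(k := a)" and ?y = "y(k := b)" and ?e = "e(k := d)"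
  have P': "z \<in> perp (Suc k) ?x ?y \<longleftrightarrow> z \<in> ?P \<and> E z a = 0 \<and> E z b = 0" for z
    by (auto simp: perp_def less_Suc_eq)
  have 1: "\<forall>i<Suc k. ?x i \<in> \<Gamma> \<and> ?y i \<in> \<Gamma> \<and> 0 < ?e i"
    using xy e d ab Pc by (auto simp: less_Suc_eq)
  have orth: "E (x i) a = 0 \<and> E (y i) a = 0 \<and> E (x i) b = 0 \<and> E (y i) b = 0 \<and>
      E a (x i) = 0 \<and> E a (y i) = 0 \<and> E b (x i) = 0 \<and> E b (y i) = 0" if "i < k" for i
  proof -
    have "E z (x i) = 0 \<and> E z (y i) = 0 \<and> E (x i) z = 0 \<and> E (y i) z = 0" if "z \<in> ?P" for z
      using that \<open>i < k\<close> xy[OF \<open>i < k\<close>] E_swap[of z "x i"] E_swap[of z "y i"] by (auto simp: perp_def \<Gamma>_carrier)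
    then show ?thesis using ab by blast
  qed
  have 2: "\<forall>i<Suc k. \<forall>j<Suc k. E (?x i) (?x j) = 0 \<and> E (?y i) (?y j) = 0 \<and>
      E (?x i) (?y j) = (if i = j then real (?e i) else 0)"
    using pair orth ab E_self Pc by (auto simp: less_Suc_eq)
  have 3: "\<forall>i<Suc k. \<forall>z\<in>\<Gamma>. (\<exists>q::int. E z (?x i) = real_of_int q * real (?e i)) \<and> (\<exists>q::int. E z (?y i) = real_of_int q * real (?e i))"
  proof (intro allI impI ballI)
    fix i z assume i: "i < Suc k" and z: "z \<in> \<Gamma>"
    obtain z' where z': "z' \<in> ?P" "\<forall>u\<in>?P. E z' u = E z u" using proj[OF z] by blast
    have "(\<exists>q::int. E z a = real_of_int q * real d) \<and> (\<exists>q::int. E z b = real_of_int q * real d)"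
      using diva[OF z'(1)] divb[OF z'(1)] z'(2) ab by simp
    then show "(\<exists>q::int. E z (?x i) = real_of_int q * real (?e i)) \<and> (\<exists>q::int. E z (?y i) = real_of_int q * real (?e i))"
      using div[OF _ z, of i] i by (cases "i = k") simp_all
  qed
  have 4: "\<forall>i. Suc i < Suc k \<longrightarrow> ?e i dvd ?e (Suc i)"
  proof (intro allI impI)
    fix i assume i: "Suc i < Suc k"
    show "?e i dvd ?e (Suc i)"
    proof (cases "Suc i = k")
      case True
      then obtain q :: int where "E a b = real_of_int q * real (e i)" using divP[OF ab(1,2), of i] by auto
      then have "real_of_int (int d) = of_int (q * int (e i))" using ab(3) by simp
      then have "int d = q * int (e i)" by (simp only: of_int_eq_iff)
      then have "int (e i) dvd int d" by simp
      then show ?thesis using True by simp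
    qed (use i chain in auto)
  qed
  have 5: "\<forall>z\<in>perp (Suc k) ?x ?y. \<forall>w\<in>perp (Suc k) ?x ?y. \<forall>i<Suc k. \<exists>q::int. E z w = real_of_int q * real (?e i)"
    using divd divP by (auto simp: P' less_Suc_eq)
  have 6: "\<forall>z\<in>\<Gamma>. \<exists>z'\<in>perp (Suc k) ?x ?y. \<forall>u\<in>perp (Suc k) ?x ?y. E z' u = E z u"
  proof
    fix z assume z: "z \<in> \<Gamma>"
    obtain z' where z': "z' \<in> ?P" "\<forall>u\<in>?P. E z' u = E z u" using proj[OF z] by blast
    obtain p r where p: "E z' b = real_of_int p * real d" and r: "E z' a = real_of_int r * real d"
      using diva[OF z'(1)] divb[OF z'(1)] by blast
    \<comment> \<open>With E z' b = p d and E z' a = r d this removes the components of z' along a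
      and b; the two signs differ because E b a = - d.\<close>
    let ?z = "(z' + complex_of_int (- p) \<cdot>\<^sub>v a) + complex_of_int r \<cdot>\<^sub>v b"
    have zP: "?z \<in> ?P" by (intro comb z' ab)
    have Ez: "E ?z u = E z' u - of_int p * E a u + of_int r * E b u" if "u \<in> carrier_vec g" for u
    proof -
      have "E ?z u = E z' u + of_int (- p) * E a u + of_int r * E b u"
        using Pc z' ab that by (simp add: E_add_left E_int_left del: of_int_minus)
      then show ?thesis by simp
    qed
    have "?z \<in> perp (Suc k) ?x ?y"
      unfolding P' using zP Ez[OF Pc(1)[OF ab(1)]] Ez[OF Pc(1)[OF ab(2)]] p r ab ba E_self Pc by simp
    moreover have "E ?z u = E z u" if u: "u \<in> perp (Suc k) ?x ?y" for u
    proof -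
      have u': "u \<in> ?P" "E u a = 0" "E u b = 0" using u P' by auto
      then have "E a u = 0" "E b u = 0" using E_swap[of u a] E_swap[of u b] ab Pc by simp_all
      then show ?thesis using Ez[OF Pc(1)[OF u'(1)]] z'(2) u' by simp
    qed
    ultimately show "\<exists>z'\<in>perp (Suc k) ?x ?y. \<forall>u\<in>perp (Suc k) ?x ?y. E z' u = E z u" by blast
  qed
  show ?thesis using 1 2 3 4 5 6 unfolding partial_basis_def by blast
qed

text \<open>The x i are independent over the reals, since pairing with y j isolates the j-th
  coefficient, and they lie in a real space of dimension 2 g. A crude bound suffices to stop the
  extension process. The matrix A lists real parts above imaginary parts.\<close>

lemma partial_basis_bound:
  assumes "partial_basis k x y e" shows "k \<le> 2 * g"
proof (rule ccontr)
  assume "\<not> k \<le> 2 * g"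
  then have lt: "2 * g < k" by simp
  have xc: "x i \<in> carrier_vec g" "y i \<in> carrier_vec g" if "i < k" for i
    using assms that \<Gamma>_carrier by (auto simp: partial_basis_def)
  define A :: "real mat" where
    "A = mat (2 * g) k (\<lambda>(l, j). if l < g then Re (x j $ l) else Im (x j $ (l - g)))"
  have A: "A \<in> carrier_mat (2 * g) k" by (simp add: A_def)
  obtain c where c: "c \<in> carrier_vec k" "c \<noteq> 0\<^sub>v k" "A *\<^sub>v c = 0\<^sub>v (2 * g)"
    using exists_kernel_vec[OF A lt] by blast
  define M where "M = mat g k (\<lambda>(l, j). x j $ l)"
  have M: "M \<in> carrier_mat g k" by (simp add: M_def)
  have cM: "col M j = x j" if "j < k" for j
    using that xc(1)[OF that] by (intro eq_vecI) (auto simp: M_def)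
  have "M *\<^sub>v map_vec complex_of_real c = 0\<^sub>v g"
  proof (rule eq_vecI)
    fix l assume "l < dim_vec (0\<^sub>v g :: complex vec)"
    then have l: "l < g" by simp
    have "(A *\<^sub>v c) $ l = 0" "(A *\<^sub>v c) $ (g + l) = 0" using c(3) l by auto
    then have "(\<Sum>j<k. Re (x j $ l) * c $ j) = 0" "(\<Sum>j<k. Im (x j $ l) * c $ j) = 0"
      using l c(1) A by (simp_all add: A_def scalar_prod_def atLeast0LessThan)
    moreover have "(M *\<^sub>v map_vec complex_of_real c) $ l = (\<Sum>j<k. x j $ l * complex_of_real (c $ j))"
      using l c(1) M by (simp add: M_def scalar_prod_def atLeast0LessThan)
    ultimately show "(M *\<^sub>v map_vec complex_of_real c) $ l = 0\<^sub>v g $ l"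
      using l by (simp add: complex_eq_iff)
  qed (use M in simp)
  then have z: "(\<Sum>i<k. c $ i * E (x i) (y j)) = 0" if "j < k" for j
    using E_mult_mat_vec[OF M c(1) xc(2)[OF that]] E_zero_left[OF xc(2)[OF that]]
    by (simp add: cM)
  have "c $ j = 0" if j: "j < k" for j
  proof -
    have "(\<Sum>i<k. c $ i * E (x i) (y j)) = (\<Sum>i<k. if i = j then c $ j * e j else 0)"
      using assms j by (intro sum.cong refl) (auto simp: partial_basis_def)
    then have "c $ j * e j = 0" using z[OF j] j by simp
    moreover have "0 < e j" using assms j by (simp add: partial_basis_def)
    ultimately show ?thesis by simp
  qed
  then have "c = 0\<^sub>v k" using c(1) by (intro eq_vecI) auto
  then show False using c(2) by simp
qed

lemma maximal_partial_basis:
  "\<exists>k x y e. partial_basis k x y e \<and> perp k x y = {0\<^sub>v g}"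
proof (rule ccontr)
  assume no: "\<not> ?thesis"
  have "\<exists>x y e. partial_basis k x y e" for k
  proof (induction k)
    case 0
    have "partial_basis 0 x y e" for x y e
      unfolding partial_basis_def perp_def by auto
    then show ?case by blast
  next
    case (Suc k)
    then obtain x y e where "partial_basis k x y e" by blast
    moreover from this have "perp k x y \<noteq> {0\<^sub>v g}" using no by blast
    ultimately obtain a b d where "partial_basis (Suc k) (x(k := a)) (y(k := b)) (e(k := d))"
      using partial_basis_step by blast
    then show ?case by blast
  qed
  then have "Suc (2 * g) \<le> 2 * g" using partial_basis_bound by blast
  then show False by simp
qed

text \<open>With a trivial complement, the symplectic coordinates of z in \<Gamma> are integers by
  the divisibility of E z (x i) and E z (y i), and z minus the corresponding integral combination
  lies in the complement, hence is 0.\<close>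

lemma frobenius_normal_form:
  obtains B es where "elementary_divisors es" "symplectic_columns B es"
    "\<Gamma> = (\<lambda>x. B *\<^sub>v map_vec complex_of_int x) ` carrier_vec (2 * length es)"
proof -
  obtain k x y e where pb: "partial_basis k x y e" and P0: "perp k x y = {0\<^sub>v g}"
    using maximal_partial_basis by blast
  define es where "es = map e [0..<k]"
  have es: "es ! i = e i" if "i < k" for i using that by (simp add: es_def)
  have len: "length es = k" by (simp add: es_def)
  define B where "B = mat g (2 * k) (\<lambda>(l, j). if j < k then x j $ l else y (j - k) $ l)"
  have B: "B \<in> carrier_mat g (2 * k)" by (simp add: B_def)
  have xy: "x i \<in> \<Gamma>" "y i \<in> \<Gamma>" "0 < e i" if "i < k" for i
    using pb that by (auto simp: partial_basis_def)
  have cx: "col B i = x i" "col B (k + i) = y i" if "i < k" for i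
    using that xy[OF that] \<Gamma>_carrier[of "x i"] \<Gamma>_carrier[of "y i"]
    by (auto simp: B_def intro!: eq_vecI)
  have div: "\<exists>q::int. E z (x i) = real_of_int q * real (e i)" "\<exists>q::int. E z (y i) = real_of_int q * real (e i)"
    if "i < k" "z \<in> \<Gamma>" for i z
    using pb that by (auto simp: partial_basis_def)
  have sc: "symplectic_columns B es"
    unfolding symplectic_columns_def len
    using B pb by (auto simp: es cx partial_basis_def es_def)
  have ed: "elementary_divisors es"
    using pb by (auto simp: elementary_divisors_def len es partial_basis_def)
  have BZ: "B *\<^sub>v map_vec complex_of_int c \<in> \<Gamma>" if "c \<in> carrier_vec (2 * k)" for c
  proof (rule mult_mat_vec_mem_and_linear(1)[OF B, where K = "\<int>" and F = "\<lambda>_. 0"])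
    show "col B j \<in> \<Gamma>" if "j < 2 * k" for j
    proof (cases "j < k")
      case False
      then have "j = k + (j - k)" "j - k < k" using that by simp_all
      then show ?thesis using cx(2)[of "j - k"] xy(2)[of "j - k"] by simp
    qed (simp add: cx xy)
    show "c \<cdot>\<^sub>v v \<in> \<Gamma>" if "c \<in> \<int>" "v \<in> \<Gamma>" for c v
      using that by (elim Ints_cases) (simp add: \<Gamma>_smult)
  qed (use that in \<open>auto simp: \<Gamma>_zero \<Gamma>_add \<Gamma>_carrier\<close>)
  have "z \<in> (\<lambda>x. B *\<^sub>v map_vec complex_of_int x) ` carrier_vec (2 * length es)" if z: "z \<in> \<Gamma>" for z
  proof -
    let ?c = "symplectic_coords B es z"
    have zc: "z \<in> carrier_vec g" using z by (rule \<Gamma>_carrier)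
    have c_int: "?c $ j \<in> \<int>" if j: "j < 2 * k" for j
    proof (cases "j < k")
      case True
      then obtain q :: int where "E z (y j) = real_of_int q * real (e j)" using div(2)[OF _ z] by blast
      then show ?thesis using True j xy(3)[OF True] by (simp add: symplectic_coords_def len cx es)
    next
      case False
      then obtain i where i: "j = k + i" "i < k" using j by (metis add_less_cancel_left le_Suc_ex linorder_not_less mult_2)
      then obtain q :: int where "E z (x i) = real_of_int q * real (e i)" using div(1)[OF _ z] by blast
      then show ?thesis using i j xy(3)[OF i(2)] by (simp add: symplectic_coords_def len cx es)
    qed
    define q where "q j = \<lfloor>?c $ j\<rfloor>" for j
    have q: "?c $ j = of_int (q j)" if "j < 2 * k" for j
      using c_int[OF that] by (auto simp: q_def elim: Ints_cases)
    let ?q = "vec (2 * k) q"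
    have c: "map_vec complex_of_real ?c = map_vec complex_of_int ?q"
      using symplectic_coords_carrier[of B es z] by (intro eq_vecI) (auto simp: q len)
    let ?u = "z - B *\<^sub>v map_vec complex_of_int ?q"
    have Bq: "B *\<^sub>v map_vec complex_of_int ?q \<in> \<Gamma>" by (rule BZ) simp
    have "?u = z + complex_of_int (-1) \<cdot>\<^sub>v (B *\<^sub>v map_vec complex_of_int ?q)"
      using zc \<Gamma>_carrier[OF Bq] by auto
    then have "?u \<in> \<Gamma>" using \<Gamma>_add[OF z \<Gamma>_smult[OF Bq, of "-1"]] by simp
    have orth: "E ?u (col B j) = 0" if "j < 2 * k" for j
      using symplectic_coords_orthogonal[OF sc zc, of j] that by (simp add: len c)
    have "E ?u (x i) = 0" "E ?u (y i) = 0" if "i < k" for i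
      using orth[of i] orth[of "k + i"] cx[OF that] that by simp_all
    with \<open>?u \<in> \<Gamma>\<close> have "?u \<in> perp k x y" by (simp add: perp_def)
    then have "?u = 0\<^sub>v g" using P0 by simp
    then have "z = B *\<^sub>v map_vec complex_of_int ?q"
      by (rule vec_eq_if_diff_eq_0[OF zc \<Gamma>_carrier[OF Bq]])
    then show ?thesis by (intro image_eqI[of _ _ ?q]) (simp_all add: len)
  qed
  then have "\<Gamma> = (\<lambda>x. B *\<^sub>v map_vec complex_of_int x) ` carrier_vec (2 * length es)"
    using BZ by (auto simp: len)
  then show thesis by (rule that[OF ed sc])
qed

end

section \<open>Line bundles and subtori\<close>

text \<open>The exponential determines its exponent only modulo 2 pi i, so equality is required for
  all real multiples t. The chosen t makes the exponents differ by pi i, hence the exponentials by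
  the sign -1.\<close>

lemma eq_if_exp_eq:
  fixes a b :: real
  assumes "\<And>t::real. exp (2 * complex_of_real pi * \<i> * complex_of_real (t * a)) =
    exp (2 * complex_of_real pi * \<i> * complex_of_real (t * b))"
  shows "a = b"
proof (rule ccontr)
  assume ne: "a \<noteq> b"
  define t where "t = 1 / (2 * (a - b))"
  have "2 * (t * a) = 2 * (t * b) + 1" using ne by (simp add: t_def field_simps)
  then have "complex_of_real (2 * (t * a)) = complex_of_real (2 * (t * b) + 1)" by (rule arg_cong)
  then have "2 * complex_of_real pi * \<i> * complex_of_real (t * a) =
      2 * complex_of_real pi * \<i> * complex_of_real (t * b) + complex_of_real pi * \<i>"
    by (simp add: algebra_simps)
  then have "exp (2 * complex_of_real pi * \<i> * complex_of_real (t * a)) =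
      - exp (2 * complex_of_real pi * \<i> * complex_of_real (t * b))"
    by (simp add: exp_add)
  then have "exp (2 * complex_of_real pi * \<i> * complex_of_real (t * b)) =
      - exp (2 * complex_of_real pi * \<i> * complex_of_real (t * b))"
    unfolding assms[of t] .
  then show False using complex_eq_minus_self by fastforce
qed

text \<open>An antilinear functional is real-linear, and \<Gamma> spans W over the reals.\<close>

lemma antidual_eqI:
  assumes W: "complex_subspace g W" and lb: "lattice_basis g W \<Gamma> B"
    and l: "l \<in> antidual W" "l' \<in> antidual W"
    and eq: "\<And>m. m \<in> \<Gamma> \<Longrightarrow> l m = l' m"
  shows "l = l'"
proof
  fix w
  show "l w = l' w"
  proof (cases "w \<in> W")
    case True
    obtain x where x: "x \<in> carrier_vec (dim_col B)" "w = B *\<^sub>v map_vec complex_of_real x"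
      using lattice_basis_facts(4)[OF lb True] by blast
    have "l w = (\<Sum>j<dim_col B. map_vec complex_of_real x $ j * l (col B j))" if l: "l \<in> antidual W" for l
    proof -
      have W': "W \<subseteq> carrier_vec g" "0\<^sub>v g \<in> W" "\<And>u v. u \<in> W \<Longrightarrow> v \<in> W \<Longrightarrow> u + v \<in> W"
          "\<And>c v. v \<in> W \<Longrightarrow> c \<cdot>\<^sub>v v \<in> W"
        using W by (simp_all add: complex_subspace_iff)
      have l': "\<And>u v. u \<in> W \<Longrightarrow> v \<in> W \<Longrightarrow> l (u + v) = l u + l v"
          "\<And>c v. v \<in> W \<Longrightarrow> l (c \<cdot>\<^sub>v v) = cnj c * l v"
        using l unfolding antidual_def by blast+
      have cnj: "cnj c = c" if "c \<in> \<real>" for c using that by (simp add: Reals_cnj_iff)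
      have cols: "col B j \<in> W" if "j < dim_col B" for j
        using lattice_basis_facts(2,3)[OF lb] that by blast
      show ?thesis
        unfolding x(2)
        by (rule mult_mat_vec_mem_and_linear(2)[OF lattice_basis_facts(1)[OF lb] _ W', where K = "\<real>"])
          (use x(1) in \<open>simp_all add: cols l' cnj\<close>)
    qed
    from this[OF l(1)] this[OF l(2)] show ?thesis using eq lattice_basis_facts(3)[OF lb] by simp
  qed (use l in \<open>simp add: antidual_def\<close>)
qed

lemma hermitian_form_linear_to_antidual:
  assumes h: "hermitian_form W h" and W: "complex_subspace g W"
  shows "linear_to_antidual W h"
proof -
  have cl: "u + v \<in> W" "c \<cdot>\<^sub>v v \<in> W" if "u \<in> W" "v \<in> W" for c u v
    using W that by (auto simp: complex_subspace_iff)
  have out: "\<And>v w. v \<notin> W \<or> w \<notin> W \<Longrightarrow> h v w = 0"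
    and add: "\<And>u v w. u \<in> W \<Longrightarrow> v \<in> W \<Longrightarrow> w \<in> W \<Longrightarrow> h (u + v) w = h u w + h v w"
    and sc: "\<And>c v w. v \<in> W \<Longrightarrow> w \<in> W \<Longrightarrow> h (c \<cdot>\<^sub>v v) w = c * h v w"
    and cj: "\<And>v w. v \<in> W \<Longrightarrow> w \<in> W \<Longrightarrow> h w v = cnj (h v w)"
    using h unfolding hermitian_form_def by blast+
  have add_right: "h w (u + v) = h w u + h w v" if "u \<in> W" "v \<in> W" "w \<in> W" for u v w
    using that by (simp only: cj[of _ w] cl add complex_cnj_add)
  have sc_right: "h w (c \<cdot>\<^sub>v v) = cnj c * h w v" if "v \<in> W" "w \<in> W" for c v w
    using that by (simp only: cj[of _ w] cl sc complex_cnj_mult)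
  have "h v \<in> antidual W" if "v \<in> W" for v
    using that unfolding antidual_def by (simp add: out add_right sc_right)
  moreover have "h (u + v) w = h u w + h v w" if "u \<in> W" "v \<in> W" for u v w
    using that by (cases "w \<in> W") (simp_all add: add out)
  moreover have "h (c \<cdot>\<^sub>v v) w = c * h v w" if "v \<in> W" for c v w
    using that by (cases "w \<in> W") (simp_all add: sc out)
  ultimately show ?thesis unfolding linear_to_antidual_def by (simp add: fun_eq_iff out)
qed

text \<open>Translating M by v multiplies its semicharacter by exp (2 pi i Im (H v l)), with H the
  hermitian form of M, so the homomorphism is induced by v -> H v; the work is in uniqueness. The
  hypotheses on \<open>snd M\<close> hold for members of \<open>Pic\<close> and for restrictions to
  a subtorus alike.\<close>

lemma phi_eq:
  assumes h: "hermitian_form W (fst M)" and W: "complex_subspace g W" and lb: "lattice_basis g W \<Gamma> B"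
    and nz: "\<And>m. m \<in> \<Gamma> \<Longrightarrow> snd M m \<noteq> 0" and one: "\<And>m. m \<notin> \<Gamma> \<Longrightarrow> snd M m = 1"
  shows "phi W \<Gamma> M = fst M"
  unfolding phi_def
proof (rule the_equality)
  have lin: "linear_to_antidual W (fst M)" by (rule hermitian_form_linear_to_antidual[OF h W])
  have "Pic0_point \<Gamma> (fst M v) = tensor (translate \<Gamma> v M) (dual_bundle M)" for v
    unfolding Pic0_point_def tensor_def translate_def dual_bundle_def
    using nz one by (auto simp: fun_eq_iff)
  with lin show "linear_to_antidual W (fst M) \<and>
      (\<forall>v\<in>W. Pic0_point \<Gamma> (fst M v) = tensor (translate \<Gamma> v M) (dual_bundle M))" by blast
  fix F assume "linear_to_antidual W F \<and>
      (\<forall>v\<in>W. Pic0_point \<Gamma> (F v) = tensor (translate \<Gamma> v M) (dual_bundle M))"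
  then have F: "linear_to_antidual W F"
    and P: "\<And>v. v \<in> W \<Longrightarrow> Pic0_point \<Gamma> (F v) = tensor (translate \<Gamma> v M) (dual_bundle M)" by auto
  have scale: "G (c \<cdot>\<^sub>v v) m = c * G v m" if "linear_to_antidual W G" "v \<in> W" for G c v m
    using that unfolding linear_to_antidual_def by metis
  have Wsc: "c \<cdot>\<^sub>v v \<in> W" if "v \<in> W" for c v using W that by (auto simp: complex_subspace_iff)
  have e: "exp (2 * complex_of_real pi * \<i> * complex_of_real (Im (F v m))) =
      exp (2 * complex_of_real pi * \<i> * complex_of_real (Im (fst M v m)))" if v: "v \<in> W" and m: "m \<in> \<Gamma>" for v m
  proof -
    have "snd (Pic0_point \<Gamma> (F v)) m = snd (tensor (translate \<Gamma> v M) (dual_bundle M)) m"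
      by (simp only: P[OF v])
    then show ?thesis
      using m nz[OF m] by (simp add: Pic0_point_def tensor_def translate_def dual_bundle_def field_simps)
  qed
  \<comment> \<open>A character determines Im (F v m) only modulo integers; linearity in v supplies
    equality of the characters at all real multiples of v. Replacing v by i v afterwards yields the
    real parts.\<close>
  have Im: "Im (F v m) = Im (fst M v m)" if v: "v \<in> W" and m: "m \<in> \<Gamma>" for v m
  proof (rule eq_if_exp_eq)
    fix t :: real
    show "exp (2 * complex_of_real pi * \<i> * complex_of_real (t * Im (F v m))) =
        exp (2 * complex_of_real pi * \<i> * complex_of_real (t * Im (fst M v m)))"
      using e[OF Wsc[OF v, of "complex_of_real t"] m] by (simp add: scale F lin v)
  qed
  have eq: "F v m = fst M v m" if v: "v \<in> W" and m: "m \<in> \<Gamma>" for v m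
    using Im[OF v m] Im[OF Wsc[OF v, of \<i>] m] by (simp add: scale F lin v complex_eq_iff)
  show "F = fst M"
  proof
    fix v
    show "F v = fst M v"
    proof (cases "v \<in> W")
      case True
      show ?thesis
        by (rule antidual_eqI[OF W lb]) (use F lin True eq in \<open>auto simp: linear_to_antidual_def\<close>)
    qed (use F lin in \<open>simp add: linear_to_antidual_def\<close>)
  qed
qed

lemma phi_inverse_eq:
  assumes phi: "phi W \<Gamma> M = fst M" and W: "complex_subspace g W" and h: "hermitian_form W (fst M)"
    and pos: "\<And>v. v \<in> W \<Longrightarrow> v \<noteq> 0\<^sub>v g \<Longrightarrow> Re (fst M v v) > 0" and v: "v \<in> W"
  shows "phi_inverse W \<Gamma> M (fst M v) = v"
  unfolding phi_inverse_def phi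
proof (rule the_inv_into_f_f[OF _ v])
  show "inj_on (fst M) W"
  proof (rule inj_onI)
    fix u v assume uv: "u \<in> W" "v \<in> W" "fst M u = fst M v"
    have Wc: "W \<subseteq> carrier_vec g" using W by (simp add: complex_subspace_iff)
    have "(-1) \<cdot>\<^sub>v v \<in> W" "u + (-1) \<cdot>\<^sub>v v \<in> W" using W uv by (auto simp: complex_subspace_iff)
    moreover have eq: "u - v = u + (-1) \<cdot>\<^sub>v v" using Wc uv by auto
    ultimately have d: "u - v \<in> W" by simp
    have "fst M (u - v) (u - v) = fst M u (u - v) + (-1) * fst M v (u - v)"
      using h uv d \<open>(-1) \<cdot>\<^sub>v v \<in> W\<close> unfolding hermitian_form_def by (metis eq)
    then have "fst M (u - v) (u - v) = 0" using uv(3) by simp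
    then have "u - v = 0\<^sub>v g" using pos[OF d] by fastforce
    then show "u = v" using vec_eq_if_diff_eq_0 uv Wc by blast
  qed
qed

context definite_hermitian
begin

lemma nondegenerate_on_lattice:
  assumes W: "complex_subspace g W" and lb: "lattice_basis g W \<Gamma> B"
    and u: "u \<in> W" "\<And>m. m \<in> \<Gamma> \<Longrightarrow> E u m = 0"
  shows "u = 0\<^sub>v g"
proof (rule eq_0_if_E_eq_0[OF W u(1)])
  fix w assume "w \<in> W"
  then obtain x where x: "x \<in> carrier_vec (dim_col B)" "w = B *\<^sub>v map_vec complex_of_real x"
    using lattice_basis_facts(4)[OF lb] by blast
  have Wc: "W \<subseteq> carrier_vec g" using W by (simp add: complex_subspace_iff)
  have c: "col B j \<in> carrier_vec g" for j using lattice_basis_facts(1)[OF lb] by auto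
  have uc: "u \<in> carrier_vec g" "w \<in> carrier_vec g" using u(1) \<open>w \<in> W\<close> Wc by auto
  have "E w u = (\<Sum>j<dim_col B. x $ j * E (col B j) u)"
    unfolding x(2) by (rule E_mult_mat_vec[OF lattice_basis_facts(1)[OF lb] x(1) uc(1)])
  also have "\<dots> = 0"
    using u(2) lattice_basis_facts(3)[OF lb] E_swap[OF uc(1) c] by simp
  finally show "E u w = 0" using E_swap[OF uc(2,1)] by simp
qed

text \<open>Nondegeneracy is assumed for vectors of W tested against \<Gamma>: for v in W, the
  difference between v and its symplectic projection is orthogonal to \<Gamma>, hence 0. So the
  columns that generate \<Gamma> over the integers also span W over the reals.\<close>

lemma exists_symplectic_lattice_basis:
  assumes W: "complex_subspace g W" and \<Gamma>W: "\<Gamma> \<subseteq> W"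
    and zero: "0\<^sub>v g \<in> \<Gamma>" and add: "\<And>z w. z \<in> \<Gamma> \<Longrightarrow> w \<in> \<Gamma> \<Longrightarrow> z + w \<in> \<Gamma>"
    and smult: "\<And>q z. z \<in> \<Gamma> \<Longrightarrow> complex_of_int q \<cdot>\<^sub>v z \<in> \<Gamma>"
    and int: "\<And>z w. z \<in> \<Gamma> \<Longrightarrow> w \<in> \<Gamma> \<Longrightarrow> E z w \<in> \<int>"
    and nondeg: "\<And>u. u \<in> W \<Longrightarrow> (\<And>m. m \<in> \<Gamma> \<Longrightarrow> E u m = 0) \<Longrightarrow> u = 0\<^sub>v g"
  obtains B es where "elementary_divisors es" "symplectic_columns B es" "lattice_basis g W \<Gamma> B"
proof -
  have Wc: "W \<subseteq> carrier_vec g" using W by (simp add: complex_subspace_iff)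
  interpret integral_group g H \<Gamma>
    by unfold_locales (use Wc \<Gamma>W zero add smult int nondeg in auto)
  obtain B es where es: "elementary_divisors es" and sc: "symplectic_columns B es"
    and \<Gamma>: "\<Gamma> = (\<lambda>x. B *\<^sub>v map_vec complex_of_int x) ` carrier_vec (2 * length es)"
    by (rule frobenius_normal_form)
  let ?m = "2 * length es"
  have B: "B \<in> carrier_mat g ?m" using sc by (simp add: symplectic_columns_def)
  have cols: "col B j \<in> \<Gamma>" if "j < ?m" for j
    unfolding \<Gamma> using mult_unit_vec_eq_col[OF B that] by (intro image_eqI[of _ _ "unit_vec ?m j"]) auto
  have BW: "B *\<^sub>v map_vec complex_of_real x \<in> W" if "x \<in> carrier_vec ?m" for x
    by (rule mult_mat_vec_mem_and_linear(1)[OF B, where K = UNIV and F = "\<lambda>_. 0"])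
      (use that W cols \<Gamma>W in \<open>auto simp: complex_subspace_iff\<close>)
  have inv: "B *\<^sub>v map_vec complex_of_real (symplectic_coords B es v) = v" if v: "v \<in> W" for v
  proof -
    let ?w = "B *\<^sub>v map_vec complex_of_real (symplectic_coords B es v)"
    have vc: "v \<in> carrier_vec g" using v Wc by blast
    have wW: "?w \<in> W" by (rule BW[OF symplectic_coords_carrier])
    have d: "v - ?w \<in> W" by (rule subspace_diff[OF W v wW])
    have "v - ?w = 0\<^sub>v g"
    proof (rule nondeg[OF d])
      fix m assume "m \<in> \<Gamma>"
      then obtain x where x: "x \<in> carrier_vec ?m" "m = B *\<^sub>v map_vec complex_of_int x" using \<Gamma> by blast
      have "map_vec complex_of_int x = map_vec complex_of_real (map_vec real_of_int x)" by auto
      then have m: "m = B *\<^sub>v map_vec complex_of_real (map_vec real_of_int x)" using x by simp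
      have dc: "v - ?w \<in> carrier_vec g" and mc: "m \<in> carrier_vec g"
        using d Wc \<open>m \<in> \<Gamma>\<close> \<Gamma>_carrier by auto
      have "E m (v - ?w) = (\<Sum>j<?m. map_vec real_of_int x $ j * E (col B j) (v - ?w))"
        unfolding m by (rule E_mult_mat_vec[OF B _ dc]) (use x in simp)
      also have "\<dots> = 0"
      proof (rule sum.neutral, rule ballI)
        fix j assume "j \<in> {..<?m}"
        then have j: "j < ?m" by simp
        then have "E (col B j) (v - ?w) = 0"
          using symplectic_coords_orthogonal[OF sc vc j] E_swap[OF dc \<Gamma>_carrier[OF cols[OF j]]] by simp
        then show "map_vec real_of_int x $ j * E (col B j) (v - ?w) = 0" by simp
      qed
      finally show "E (v - ?w) m = 0" using E_swap[OF mc dc] by simp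
    qed
    then show ?thesis using vec_eq_if_diff_eq_0[OF vc] wW Wc by (metis subsetD)
  qed
  have "lattice_basis g W \<Gamma> B"
    unfolding lattice_basis_def
  proof (intro conjI)
    have dc: "dim_col B = ?m" using B by simp
    show "dim_row B = g" using B by simp
    show "\<Gamma> = (\<lambda>x. B *\<^sub>v map_vec complex_of_int x) ` carrier_vec (dim_col B)"
      using \<Gamma> dc by simp
    show "bij_betw (\<lambda>x. B *\<^sub>v map_vec complex_of_real x) (carrier_vec (dim_col B)) W"
      unfolding dc
      by (rule bij_betw_byWitness[where f' = "symplectic_coords B es"])
        (use inv BW symplectic_coords_mult[OF sc] symplectic_coords_carrier in auto)
  qed
  then show thesis by (rule that[OF es sc])
qed

end

section \<open>Polarized tori and the tangent spaces of their subtori\<close>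

locale polarized_torus = definite_hermitian g "fst L" for g :: nat and L :: line_bundle +
  fixes \<Lambda> :: "complex vec set" and P :: "complex mat"
  assumes L_Pic: "L \<in> Pic (carrier_vec g) \<Lambda>"
    and period_basis: "lattice_basis g (carrier_vec g) \<Lambda> P"
begin

abbreviation H :: "complex vec \<Rightarrow> complex vec \<Rightarrow> complex" where "H \<equiv> fst L"

lemma \<Lambda>_carrier: "z \<in> \<Lambda> \<Longrightarrow> z \<in> carrier_vec g"
  using lattice_basis_facts(2)[OF period_basis] by blast

lemma \<Lambda>_eq: "\<Lambda> = (\<lambda>x. P *\<^sub>v map_vec complex_of_int x) ` carrier_vec (dim_col P)"
  using period_basis by (simp add: lattice_basis_def)

lemma P_carrier: "P \<in> carrier_mat g (dim_col P)"
  by (rule lattice_basis_facts(1)[OF period_basis])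

lemma \<Lambda>_zero: "0\<^sub>v g \<in> \<Lambda>"
proof -
  have "dim_row P = g" using P_carrier by (rule carrier_matD(1))
  then have eq: "0\<^sub>v g = P *\<^sub>v map_vec complex_of_int (0\<^sub>v (dim_col P))"
    by (intro eq_vecI) (simp_all add: scalar_prod_def)
  show ?thesis unfolding \<Lambda>_eq by (rule image_eqI[where x = "0\<^sub>v (dim_col P)"], rule eq) simp
qed

lemma \<Lambda>_add: assumes "z \<in> \<Lambda>" "w \<in> \<Lambda>" shows "z + w \<in> \<Lambda>"
proof -
  obtain x y where x: "x \<in> carrier_vec (dim_col P)" "z = P *\<^sub>v map_vec complex_of_int x"
    and y: "y \<in> carrier_vec (dim_col P)" "w = P *\<^sub>v map_vec complex_of_int y"
    using assms unfolding \<Lambda>_eq by blast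
  have "map_vec complex_of_int (x + y) = map_vec complex_of_int x + map_vec complex_of_int y"
    using x y by auto
  then have "P *\<^sub>v map_vec complex_of_int (x + y) = z + w"
    using x y mult_add_distrib_mat_vec[OF P_carrier, of "map_vec complex_of_int x" "map_vec complex_of_int y"]
    by simp
  then show ?thesis unfolding \<Lambda>_eq using x y by (intro image_eqI[of _ _ "x + y"]) auto
qed

lemma \<Lambda>_smult: assumes "z \<in> \<Lambda>" shows "complex_of_int q \<cdot>\<^sub>v z \<in> \<Lambda>"
proof -
  obtain x where x: "x \<in> carrier_vec (dim_col P)" "z = P *\<^sub>v map_vec complex_of_int x"
    using assms unfolding \<Lambda>_eq by blast
  have "map_vec complex_of_int (q \<cdot>\<^sub>v x) = complex_of_int q \<cdot>\<^sub>v map_vec complex_of_int x"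
    using x by auto
  then have "P *\<^sub>v map_vec complex_of_int (q \<cdot>\<^sub>v x) = complex_of_int q \<cdot>\<^sub>v z"
    using x mult_mat_vec[OF P_carrier, of "map_vec complex_of_int x"] by simp
  then show ?thesis unfolding \<Lambda>_eq using x by (intro image_eqI[of _ _ "q \<cdot>\<^sub>v x"]) auto
qed

lemma E_integral: "z \<in> \<Lambda> \<Longrightarrow> w \<in> \<Lambda> \<Longrightarrow> E z w \<in> \<int>"
  using L_Pic unfolding Pic_def E_def by auto

lemma countable_\<Lambda>: "countable \<Lambda>"
proof -
  have "\<Lambda> \<subseteq> range (\<lambda>xs. P *\<^sub>v map_vec complex_of_int (vec_of_list xs))"
  proof
    fix z assume "z \<in> \<Lambda>"
    then obtain x where "z = P *\<^sub>v map_vec complex_of_int x" unfolding \<Lambda>_eq by blast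
    then have "z = P *\<^sub>v map_vec complex_of_int (vec_of_list (list_of_vec x))" by (simp add: vec_list)
    then show "z \<in> range (\<lambda>xs. P *\<^sub>v map_vec complex_of_int (vec_of_list xs))" by blast
  qed
  then show ?thesis by (rule countable_subset) simp
qed

lemma phi_L: "phi (carrier_vec g) \<Lambda> M = fst M" if "M \<in> Pic (carrier_vec g) \<Lambda>"
proof (rule phi_eq[OF _ subspace_carrier period_basis])
  show "hermitian_form (carrier_vec g) (fst M)" using that by (auto simp: Pic_def)
  show "snd M m \<noteq> 0" if "m \<in> \<Lambda>" for m using \<open>M \<in> _\<close> that by (force simp: Pic_def)
  show "snd M m = 1" if "m \<notin> \<Lambda>" for m using \<open>M \<in> _\<close> that by (auto simp: Pic_def)
qed

lemma phi_inverse_L: "v \<in> carrier_vec g \<Longrightarrow> phi_inverse (carrier_vec g) \<Lambda> L (H v) = v"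
  by (rule phi_inverse_eq[OF phi_L[OF L_Pic] subspace_carrier hermitian]) (use definite in auto)

text \<open>
  A line in \<open>W\<close> contains uncountably many points, so two of them differ from points of \<open>W'\<close> by the
  same element of the countable set \<open>\<Lambda>\<close>.
\<close>

lemma tangent_space_subset:
  assumes W: "is_tangent_space g \<Lambda> X W" and W': "is_tangent_space g \<Lambda> X W'"
  shows "W \<subseteq> W'"
proof
  fix v assume v: "v \<in> W"
  have sW: "complex_subspace g W" "complex_subspace g W'"
    and X: "torus_point \<Lambda> ` W = torus_point \<Lambda> ` W'"
    using W W' by (simp_all add: is_tangent_space_def)
  have vc: "v \<in> carrier_vec g" using v sW by (auto simp: complex_subspace_iff)
  have "\<exists>l\<in>\<Lambda>. \<exists>w\<in>W'. complex_of_real t \<cdot>\<^sub>v v = w + l" for t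
  proof -
    have tv: "complex_of_real t \<cdot>\<^sub>v v \<in> W" using v sW by (simp add: complex_subspace_iff)
    then obtain w where w: "w \<in> W'" "torus_point \<Lambda> (complex_of_real t \<cdot>\<^sub>v v) = torus_point \<Lambda> w"
      using X by blast
    have "complex_of_real t \<cdot>\<^sub>v v + 0\<^sub>v g \<in> torus_point \<Lambda> (complex_of_real t \<cdot>\<^sub>v v)"
      unfolding torus_point_def using \<Lambda>_zero by blast
    then show ?thesis using w vc by (auto simp: torus_point_def)
  qed
  then obtain l where l: "\<And>t. l t \<in> \<Lambda>" "\<And>t. \<exists>w\<in>W'. complex_of_real t \<cdot>\<^sub>v v = w + l t" by metis
  have "\<not> inj l"
  proof
    assume "inj l"
    moreover have "countable (range l)" using countable_\<Lambda> l(1) by (meson countable_subset image_subsetI)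
    ultimately have "countable (UNIV :: real set)" by (metis countable_image_inj_eq)
    then show False using uncountable_UNIV_real by simp
  qed
  then obtain s t where st: "s \<noteq> t" "l s = l t" by (auto simp: inj_def)
  obtain w w' where w: "w \<in> W'" "complex_of_real s \<cdot>\<^sub>v v = w + l s"
    and w': "w' \<in> W'" "complex_of_real t \<cdot>\<^sub>v v = w' + l t" using l(2) by blast
  have wc: "w \<in> carrier_vec g" "w' \<in> carrier_vec g" "l t \<in> carrier_vec g"
    using w w' sW l \<Lambda>_carrier by (auto simp: complex_subspace_iff)
  define r where "r = complex_of_real (1 / (s - t))"
  have "v = r \<cdot>\<^sub>v (w + (-1) \<cdot>\<^sub>v w')"
  proof (rule eq_vecI)
    show "dim_vec v = dim_vec (r \<cdot>\<^sub>v (w + (-1) \<cdot>\<^sub>v w'))" using wc vc by simp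
    fix i assume "i < dim_vec (r \<cdot>\<^sub>v (w + (-1) \<cdot>\<^sub>v w'))"
    then have i: "i < g" using wc by simp
    have "(complex_of_real s \<cdot>\<^sub>v v) $ i = (w + l s) $ i" "(complex_of_real t \<cdot>\<^sub>v v) $ i = (w' + l t) $ i"
      using w w' by simp_all
    then have "complex_of_real s * v $ i = w $ i + l t $ i" "complex_of_real t * v $ i = w' $ i + l t $ i"
      using i wc vc st by simp_all
    then have "complex_of_real (s - t) * v $ i = w $ i - w' $ i" by (simp add: left_diff_distrib)
    moreover have "r * complex_of_real (s - t) = 1"
      using st(1) unfolding r_def of_real_mult[symmetric] by simp
    ultimately have "v $ i = r * (w $ i - w' $ i)" by (metis mult.assoc mult_1)
    then show "v $ i = (r \<cdot>\<^sub>v (w + (-1) \<cdot>\<^sub>v w')) $ i" using i wc by simp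
  qed
  moreover have "(-1) \<cdot>\<^sub>v w' \<in> W'" using sW w' by (simp add: complex_subspace_iff)
  ultimately show "v \<in> W'" using sW w by (simp add: complex_subspace_iff)
qed

lemma tangent_space_eq: "is_tangent_space g \<Lambda> X W \<Longrightarrow> tangent_space g \<Lambda> X = W"
  unfolding tangent_space_def by (rule the_equality) (use tangent_space_subset in blast)+

end

context polarized_torus
begin

text \<open>The hypothesis says that the points of \<Lambda> in W detect all vectors of W. It serves
  for subtori given in advance, and for the fixed space of a rational idempotent, where it is the
  criterion for W \<inter> \<Lambda> to be a lattice.\<close>

lemma nondegenerate_subtorus:
  assumes W: "complex_subspace g W"
    and nondeg: "\<And>u. u \<in> W \<Longrightarrow> (\<And>m. m \<in> W \<inter> \<Lambda> \<Longrightarrow> E u m = 0) \<Longrightarrow> u = 0\<^sub>v g"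
  obtains B es where "elementary_divisors es" "symplectic_columns B es" "lattice_basis g W (W \<inter> \<Lambda>) B"
proof (rule exists_symplectic_lattice_basis[OF W, of "W \<inter> \<Lambda>"])
  show "0\<^sub>v g \<in> W \<inter> \<Lambda>" using W \<Lambda>_zero by (simp add: complex_subspace_iff)
  show "z + w \<in> W \<inter> \<Lambda>" if "z \<in> W \<inter> \<Lambda>" "w \<in> W \<inter> \<Lambda>" for z w
    using that W \<Lambda>_add by (simp add: complex_subspace_iff)
  show "complex_of_int q \<cdot>\<^sub>v z \<in> W \<inter> \<Lambda>" if "z \<in> W \<inter> \<Lambda>" for q z
    using that W \<Lambda>_smult by (simp add: complex_subspace_iff)
  show "E z w \<in> \<int>" if "z \<in> W \<inter> \<Lambda>" "w \<in> W \<inter> \<Lambda>" for z w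
    using that E_integral by blast
qed (use nondeg that in blast)+

lemma subtorus_symplectic_basis:
  assumes W: "complex_subspace g W" and lat: "lattice_in g W (W \<inter> \<Lambda>)"
  obtains B es where "elementary_divisors es" "symplectic_columns B es" "lattice_basis g W (W \<inter> \<Lambda>) B"
proof -
  obtain B0 where B0: "lattice_basis g W (W \<inter> \<Lambda>) B0" using lat by (auto simp: lattice_in_def)
  show thesis
    by (rule nondegenerate_subtorus[OF W nondegenerate_on_lattice[OF W B0]]) (use that in blast)+
qed

text \<open>E-orthogonality to a real basis of W is E-orthogonality to W. As W is closed under
  multiplication by i and E x (i w) = - Re (H x w), this upgrades to H-orthogonality, so u is the
  H-orthogonal projection of v.\<close>

lemma symplectic_projection:
  assumes W: "complex_subspace g W" and sc: "symplectic_columns B es" and lb: "lattice_basis g W \<Gamma> B"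
    and v: "v \<in> carrier_vec g"
  defines "u \<equiv> B *\<^sub>v map_vec complex_of_real (symplectic_coords B es v)"
  shows "u \<in> W" "\<And>w. w \<in> W \<Longrightarrow> H u w = H v w"
proof -
  have B: "B \<in> carrier_mat g (2 * length es)" using sc by (simp add: symplectic_columns_def)
  have dc: "dim_col B = 2 * length es" using B by simp
  have Wc: "w \<in> carrier_vec g" if "w \<in> W" for w using W that by (auto simp: complex_subspace_iff)
  show u: "u \<in> W"
    unfolding u_def by (rule lattice_basis_facts(5)[OF lb]) (simp add: dc symplectic_coords_carrier)
  have d: "v - u \<in> carrier_vec g" using v Wc[OF u] by simp
  have orth: "E (v - u) w = 0" if w: "w \<in> W" for w
  proof -
    obtain x where x: "x \<in> carrier_vec (dim_col B)" "w = B *\<^sub>v map_vec complex_of_real x"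
      using lattice_basis_facts(4)[OF lb w] by blast
    have "E w (v - u) = (\<Sum>j<dim_col B. x $ j * E (col B j) (v - u))"
      unfolding x(2) by (rule E_mult_mat_vec[OF lattice_basis_facts(1)[OF lb] x(1) d])
    also have "\<dots> = 0"
    proof (rule sum.neutral, rule ballI)
      fix j assume "j \<in> {..<dim_col B}"
      then have j: "j < 2 * length es" using dc by simp
      have c: "col B j \<in> carrier_vec g" using B by auto
      have "E (v - u) (col B j) = 0" unfolding u_def by (rule symplectic_coords_orthogonal[OF sc v j])
      then show "x $ j * E (col B j) (v - u) = 0" using E_swap[OF d c] by simp
    qed
    finally show ?thesis using E_swap[OF Wc[OF w] d] by simp
  qed
  show "H u w = H v w" if w: "w \<in> W" for w
  proof -
    have iw: "\<i> \<cdot>\<^sub>v w \<in> W" using W w by (simp add: complex_subspace_iff)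
    have "Im (H (v - u) w) = 0" using orth[OF w] by (simp add: E_def)
    moreover have "Re (H (v - u) w) = 0" using orth[OF iw] E_i_right[OF Wc[OF w] d] by simp
    ultimately have "H (v - u) w = 0" by (simp add: complex_eq_iff)
    then show ?thesis using H_diff_left[OF v Wc[OF u] Wc[OF w]] by simp
  qed
qed

lemma projection_unique:
  assumes W: "complex_subspace g W" and u: "u \<in> W" "u' \<in> W" "\<And>w. w \<in> W \<Longrightarrow> H u w = H u' w"
  shows "u = u'"
proof -
  have c: "u \<in> carrier_vec g" "u' \<in> carrier_vec g" using W u by (auto simp: complex_subspace_iff)
  have d: "u - u' \<in> W" by (rule subspace_diff[OF W u(1,2)])
  have dc: "u - u' \<in> carrier_vec g" using c by simp
  have "H (u - u') (u - u') = 0" using H_diff_left[OF c dc] u(3)[OF d] by simp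
  then show ?thesis using H_self_eq_0[OF dc] vec_eq_if_diff_eq_0[OF c] by blast
qed

section \<open>The symmetric idempotent of a nonzero subtorus\<close>

context
  fixes X W
  assumes tangent: "is_tangent_space g \<Lambda> X W" and W_nonzero: "W \<noteq> {0\<^sub>v g}"
begin

abbreviation "L' \<equiv> restrict_bundle W (W \<inter> \<Lambda>) L"

lemma W_subspace: "complex_subspace g W" and W_lattice: "lattice_in g W (W \<inter> \<Lambda>)"
  using tangent by (simp_all add: is_tangent_space_def)

lemma W_carrier: "w \<in> W \<Longrightarrow> w \<in> carrier_vec g"
  using W_subspace by (auto simp: complex_subspace_iff)

lemma fst_L': "fst L' u w = (if u \<in> W \<and> w \<in> W then H u w else 0)"
  by (simp add: restrict_bundle_def)

lemma hermitian_L': "hermitian_form W (fst L')"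
proof -
  have cl: "u + v \<in> W" "c \<cdot>\<^sub>v v \<in> W" if "u \<in> W" "v \<in> W" for c u v
    using W_subspace that by (auto simp: complex_subspace_iff)
  show ?thesis
    unfolding hermitian_form_def fst_L'
    using cl by (auto simp: H_add_left H_smult_left W_carrier H_commute[symmetric])
qed

lemma phi_L': "phi W (W \<inter> \<Lambda>) L' = fst L'"
proof -
  obtain B where B: "lattice_basis g W (W \<inter> \<Lambda>) B" using W_lattice by (auto simp: lattice_in_def)
  have nz: "snd L m \<noteq> 0" if "m \<in> \<Lambda>" for m using L_Pic that by (force simp: Pic_def)
  show ?thesis
    by (rule phi_eq[OF hermitian_L' W_subspace B]) (auto simp: restrict_bundle_def nz)
qed

lemma phi_inverse_L': "v \<in> W \<Longrightarrow> phi_inverse W (W \<inter> \<Lambda>) L' (fst L' v) = v"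
  by (rule phi_inverse_eq[OF phi_L' W_subspace hermitian_L']) (simp_all add: fst_L' definite W_carrier)

text \<open>\<open>exponent\<close> is the last entry of a chosen type. A symplectic basis shows
  that a type exists, so the chosen list is one; it is nonempty because W is not 0, whence
  \<open>last\<close> is a genuine entry and therefore positive.\<close>

lemma sub_exponent_pos: "0 < sub_exponent g \<Lambda> L X"
proof -
  obtain B es where es: "elementary_divisors es" and sc: "symplectic_columns B es"
    and lb: "lattice_basis g W (W \<inter> \<Lambda>) B"
    by (rule subtorus_symplectic_basis[OF W_subspace W_lattice])
  have dc: "dim_col B = 2 * length es" using sc by (auto simp: symplectic_columns_def)
  have BW: "col B j \<in> W" if "j < 2 * length es" for j using lattice_basis_facts(2,3)[OF lb] that dc by auto
  have "has_type g W (W \<inter> \<Lambda>) L' es"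
    unfolding has_type_def
  proof (intro conjI exI[of _ B] allI impI)
    fix i j assume ij: "i < length es" "j < length es"
    have m: "col B i \<in> W" "col B j \<in> W" "col B (length es + i) \<in> W" "col B (length es + j) \<in> W"
      using ij BW by simp_all
    show "Im (fst L' (col B i) (col B j)) = 0"
      "Im (fst L' (col B (length es + i)) (col B (length es + j))) = 0"
      "Im (fst L' (col B i) (col B (length es + j))) = (if i = j then real (es ! i) else 0)"
      using sc ij m by (simp_all add: symplectic_columns_def fst_L' E_def)
  qed (use es lb dc in simp_all)
  then have "has_type g W (W \<inter> \<Lambda>) L' (SOME es. has_type g W (W \<inter> \<Lambda>) L' es)" by (rule someI)
  then obtain fs where fs: "fs = (SOME es. has_type g W (W \<inter> \<Lambda>) L' es)" "has_type g W (W \<inter> \<Lambda>) L' fs" by blast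
  have "fs \<noteq> []"
  proof
    assume "fs = []"
    then obtain B where B: "lattice_basis g W (W \<inter> \<Lambda>) B" "dim_col B = 0"
      using fs(2) by (auto simp: has_type_def)
    have "w = 0\<^sub>v g" if w: "w \<in> W" for w
    proof -
      obtain x where x: "x \<in> carrier_vec 0" "w = B *\<^sub>v map_vec complex_of_real x"
        using lattice_basis_facts(4)[OF B(1) w] B(2) by auto
      have dr: "dim_row B = g" using B(1) by (simp add: lattice_basis_def)
      show ?thesis unfolding x(2) using x(1) by (intro eq_vecI) (simp_all add: dr scalar_prod_def)
    qed
    moreover have "0\<^sub>v g \<in> W" using W_subspace by (simp add: complex_subspace_iff)
    ultimately show False using W_nonzero by blast
  qed
  then have "0 < last fs" using fs(2) by (simp add: has_type_def elementary_divisors_def last_conv_nth)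
  then show ?thesis
    unfolding sub_exponent_def exponent_def Let_def tangent_space_eq[OF tangent] fs(1) .
qed

text \<open>Restricting H v to W gives the functional of the orthogonal projection u, which
  \<open>phi_inverse\<close> turns back into u. The exponent in \<open>psi\<close> cancels against
  the factor in \<open>epsilon\<close>.\<close>

lemma epsilon_eq:
  assumes v: "v \<in> carrier_vec g" and u: "u \<in> W" "\<And>w. w \<in> W \<Longrightarrow> H u w = H v w"
  shows "epsilon g \<Lambda> L X v = u"
proof -
  have "inclusion_dual g \<Lambda> X (phi (carrier_vec g) \<Lambda> L v) = fst L' u"
    unfolding inclusion_dual_def tangent_space_eq[OF tangent] phi_L[OF L_Pic]
    using u by (auto simp: fst_L' fun_eq_iff)
  then have "norm_endo g \<Lambda> L X v = of_nat (sub_exponent g \<Lambda> L X) \<cdot>\<^sub>v u"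
    unfolding norm_endo_def psi_def Let_def tangent_space_eq[OF tangent]
    using v phi_inverse_L'[OF u(1)] by simp
  then show ?thesis
    unfolding epsilon_def using v sub_exponent_pos by (simp add: smult_smult_assoc)
qed

end

end

section \<open>Real coordinates\<close>

text \<open>Separating real and imaginary parts turns A into a real square matrix M of size 2 g;
  injectivity makes det M nonzero, and the adjugate provides the solution.\<close>

lemma real_combination_of_columns:
  assumes A: "A \<in> carrier_mat g (2 * g)" and v: "v \<in> carrier_vec g"
    and inj: "\<And>x. x \<in> carrier_vec (2 * g) \<Longrightarrow> A *\<^sub>v map_vec complex_of_real x = 0\<^sub>v g \<Longrightarrow> x = 0\<^sub>v (2 * g)"
  shows "\<exists>x\<in>carrier_vec (2 * g). A *\<^sub>v map_vec complex_of_real x = v"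
proof -
  define M :: "real mat" where
    "M = mat (2 * g) (2 * g) (\<lambda>(l, j). if l < g then Re (A $$ (l, j)) else Im (A $$ (l - g, j)))"
  have M: "M \<in> carrier_mat (2 * g) (2 * g)" by (simp add: M_def)
  have ReIm: "Re ((A *\<^sub>v map_vec complex_of_real x) $ l) = (M *\<^sub>v x) $ l"
    "Im ((A *\<^sub>v map_vec complex_of_real x) $ l) = (M *\<^sub>v x) $ (g + l)"
    if "l < g" "x \<in> carrier_vec (2 * g)" for l x
    using that A by (simp_all add: M_def scalar_prod_def)
  have "det M \<noteq> 0"
  proof
    assume "det M = 0"
    then obtain x where x: "x \<in> carrier_vec (2 * g)" "x \<noteq> 0\<^sub>v (2 * g)" "M *\<^sub>v x = 0\<^sub>v (2 * g)"
      using det_0_iff_vec_prod_zero_field[OF M] by blast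
    have "A *\<^sub>v map_vec complex_of_real x = 0\<^sub>v g"
    proof (rule eq_vecI)
      fix l assume "l < dim_vec (0\<^sub>v g :: complex vec)"
      then have l: "l < g" by simp
      have "(M *\<^sub>v x) $ l = 0" "(M *\<^sub>v x) $ (g + l) = 0" using x(3) l by simp_all
      then have "(A *\<^sub>v map_vec complex_of_real x) $ l = 0"
        using ReIm[OF l x(1)] by (simp only: complex_eq_iff zero_complex.sel)
      then show "(A *\<^sub>v map_vec complex_of_real x) $ l = 0\<^sub>v g $ l" using l by simp
    qed (use A in simp)
    then show False using inj[OF x(1)] x(2) by blast
  qed
  define r where "r = vec (2 * g) (\<lambda>l. if l < g then Re (v $ l) else Im (v $ (l - g)))"
  define x where "x = (1 / det M) \<cdot>\<^sub>v (adj_mat M *\<^sub>v r)"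
  have r: "r \<in> carrier_vec (2 * g)" by (simp add: r_def)
  have adj: "adj_mat M \<in> carrier_mat (2 * g) (2 * g)" "M * adj_mat M = det M \<cdot>\<^sub>m 1\<^sub>m (2 * g)"
    using adj_mat[OF M] by auto
  have ar: "adj_mat M *\<^sub>v r \<in> carrier_vec (2 * g)" by (rule mult_mat_vec_carrier[OF adj(1) r])
  then have x: "x \<in> carrier_vec (2 * g)" by (simp add: x_def)
  have "M *\<^sub>v (adj_mat M *\<^sub>v r) = (det M \<cdot>\<^sub>m 1\<^sub>m (2 * g)) *\<^sub>v r"
    using assoc_mult_mat_vec[OF M adj(1) r] adj(2) by simp
  also have "\<dots> = det M \<cdot>\<^sub>v r"
    using r by (intro eq_vecI) simp_all
  finally have "M *\<^sub>v x = r"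
    unfolding x_def mult_mat_vec[OF M ar] using \<open>det M \<noteq> 0\<close> by (simp add: smult_smult_assoc)
  then have "A *\<^sub>v map_vec complex_of_real x = v"
    using v A by (intro eq_vecI) (simp_all add: complex_eq_iff ReIm x r_def del: index_mult_mat_vec)
  with x show ?thesis by blast
qed

lemma antisymmetric_sum:
  fixes a :: "nat \<Rightarrow> nat \<Rightarrow> 'a::comm_ring_1"
  assumes "\<And>i. a i i = 0" "\<And>i j. a j i = - a i j"
  shows "(\<Sum>j<m. \<Sum>i<m. a i j * (x i * y j)) = (\<Sum>j<m. \<Sum>i<j. a i j * (x i * y j - x j * y i))"
proof (induction m)
  case (Suc m)
  have "(\<Sum>j<Suc m. \<Sum>i<Suc m. a i j * (x i * y j)) =
      (\<Sum>j<m. \<Sum>i<m. a i j * (x i * y j)) + (\<Sum>j<m. a m j * (x m * y j)) + (\<Sum>i<m. a i m * (x i * y m))"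
    by (simp add: sum.distrib assms(1))
  moreover have "(\<Sum>j<m. a m j * (x m * y j)) = - (\<Sum>i<m. a i m * (x m * y i))"
    unfolding sum_negf[symmetric] by (intro sum.cong refl) (simp add: assms(2)[of m])
  moreover have "(\<Sum>i<m. a i m * (x i * y m - x m * y i)) =
      (\<Sum>i<m. a i m * (x i * y m)) - (\<Sum>i<m. a i m * (x m * y i))"
    by (simp add: right_diff_distrib sum_subtractf)
  ultimately show ?case using Suc.IH by (simp only: sum.lessThan_Suc) simp
qed simp

lemma common_denominator:
  fixes f :: "'i \<Rightarrow> 'a::field_char_0"
  assumes "finite A" "\<And>a. a \<in> A \<Longrightarrow> f a \<in> \<rat>"
  shows "\<exists>m::nat. 0 < m \<and> (\<forall>a\<in>A. of_nat m * f a \<in> \<int>)"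
  using assms
proof (induction A rule: finite_induct)
  case empty
  show ?case by (intro exI[of _ 1]) simp
next
  case (insert a A)
  then obtain m where m: "0 < m" "\<And>b. b \<in> A \<Longrightarrow> of_nat m * f b \<in> \<int>" by auto
  have "f a \<in> \<rat>" using insert.prems by simp
  then obtain p q :: int where pq: "0 < q" "f a = of_int p / of_int q"
    by (elim Rats_cases') auto
  define k where "k = nat q"
  have k: "of_nat k = (of_int q :: 'a)" "0 < k" using pq(1) by (simp_all add: k_def)
  have "of_nat (m * k) * f b \<in> \<int>" if b: "b \<in> A" for b
  proof -
    have "of_nat (m * k) * f b = of_nat k * (of_nat m * f b)" by simp
    then show ?thesis using m(2)[OF b] by (metis Ints_mult Ints_of_nat)
  qed
  moreover have "of_nat (m * k) * f a \<in> \<int>"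
    using pq k by simp
  ultimately show ?case using m(1) k(2) by (intro exI[of _ "m * k"]) auto
qed

text \<open>For hermitian h the imaginary part of h i j is (h i j - h j i) / (2 i), so a
  decomposition of h into products of linear forms yields one of Im h into wedges, with the factor 1
  / (2 i). It serves for \<theta>, for \<omega>, and for showing that Im h is of type (1,1).\<close>

lemma quad_form_Im:
  assumes sum: "\<And>i j. i < m \<Longrightarrow> j < m \<Longrightarrow> h i j = (\<Sum>t\<in>T. c t * (u t i * w t j))"
    and herm: "\<And>i j. i < m \<Longrightarrow> j < m \<Longrightarrow> h j i = cnj (h i j)"
  shows "quad_form m (\<lambda>i j. complex_of_real (Im (h i j))) =
    (\<lambda>S. \<Sum>t\<in>T. c t / (2 * \<i>) * wedge (lin_form m (u t)) (lin_form m (w t)) S)"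
proof -
  have "complex_of_real (Im (h i j)) = (\<Sum>t\<in>T. c t / (2 * \<i>) * (u t i * w t j - u t j * w t i))"
    if "i < j" "j < m" for i j
  proof -
    have "complex_of_real (Im (h i j)) = (h i j - h j i) / (2 * \<i>)"
      using that herm[of i j] by (simp add: complex_eq_iff)
    also have "\<dots> = (\<Sum>t\<in>T. c t * (u t i * w t j) - c t * (u t j * w t i)) / (2 * \<i>)"
      using that by (simp add: sum sum_subtractf)
    also have "\<dots> = (\<Sum>t\<in>T. c t / (2 * \<i>) * (u t i * w t j - u t j * w t i))"
      unfolding sum_divide_distrib by (intro sum.cong refl) (simp add: algebra_simps diff_divide_distrib)
    finally show ?thesis .
  qed
  then have "quad_form m (\<lambda>i j. complex_of_real (Im (h i j))) =
      quad_form m (\<lambda>i j. \<Sum>t\<in>T. c t / (2 * \<i>) * (u t i * w t j - u t j * w t i))"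
    by (rule quad_form_cong)
  also have "\<dots> = (\<lambda>S. \<Sum>t\<in>T. c t / (2 * \<i>) * wedge (lin_form m (u t)) (lin_form m (w t)) S)"
    by (simp only: quad_form_sum quad_form_scale wedge_lin_form)
  finally show ?thesis .
qed

section \<open>The torus of a period matrix\<close>

locale siegel_torus =
  fixes g :: nat and ds :: "nat list" and Z :: "complex mat" and L :: line_bundle
  assumes length_ds: "length ds = g" and divisors: "elementary_divisors ds"
    and pol: "polarization (carrier_vec g) (period_lattice ds Z) L"
    and chern: "chern_class (period_matrix ds Z) L = theta ds"

sublocale siegel_torus \<subseteq> definite_hermitian g "fst L"
proof unfold_locales
  show "hermitian_form (carrier_vec g) (fst L)"
    using pol by (cases L) (simp add: polarization_def Pic_def)
  fix v :: "complex vec" assume "v \<in> carrier_vec g" "v \<noteq> 0\<^sub>v g"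
  then show "0 < Re (fst L v v)" using pol unfolding polarization_def by (metis carrier_vecD)
qed

context siegel_torus
begin

abbreviation P :: "complex mat" where "P \<equiv> period_matrix ds Z"
abbreviation \<Lambda> :: "complex vec set" where "\<Lambda> \<equiv> period_lattice ds Z"

lemma P_dims [simp]: "P \<in> carrier_mat g (2 * g)" "dim_row P = g" "dim_col P = 2 * g"
  by (simp_all add: period_matrix_def length_ds Let_def)

lemma col_P_carrier [simp]: "col P j \<in> carrier_vec g"
  using col_dim[of P j] unfolding P_dims(2) .

lemma ds_pos: "i < g \<Longrightarrow> 0 < ds ! i"
  using divisors length_ds by (simp add: elementary_divisors_def)

lemma theta_eq: "theta ds = quad_form (2 * g) (\<lambda>i j. complex_of_real (E (col P i) (col P j)))"
  unfolding chern[symmetric] by (simp add: chern_class_def quad_form_def E_def)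

lemma E_periods:
  assumes "i < j" "j < 2 * g"
  shows "E (col P i) (col P j) = (if j = g + i then - real (ds ! i) else 0)"
proof -
  have "complex_of_real (E (col P i) (col P j)) = theta ds {i, j}"
    unfolding theta_eq using assms by (simp add: quad_form_eval)
  also have "\<dots> = - (\<Sum>k<g. if k = i \<and> j = g + i then of_nat (ds ! i) else 0)"
    unfolding theta_def length_ds
  proof (intro arg_cong[where f = uminus] sum.cong refl)
    fix k assume "k \<in> {..<g}"
    then have "wedge (dx k) (dx (g + k)) {i, j} = (if {i, j} = {k, g + k} then 1 else 0)"
      by (intro wedge_dx_dx) simp
    moreover have "{i, j} = {k, g + k} \<longleftrightarrow> k = i \<and> j = g + i"
      using assms by (auto simp: doubleton_eq_iff)
    ultimately show "of_nat (ds ! k) * wedge (dx k) (dx (g + k)) {i, j} =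
        (if k = i \<and> j = g + i then of_nat (ds ! i) else 0)" by simp
  qed
  also have "\<dots> = complex_of_real (if j = g + i then - real (ds ! i) else 0)"
    using assms by (cases "j = g + i") simp_all
  finally show ?thesis by (simp only: of_real_eq_iff)
qed

text \<open>The real coordinates in the period basis, computed by pairing with E. The signs are
  opposite to those of \<open>symplectic_coords\<close> because the Chern class is \<theta>, so that
  columns i and g + i pair to - d_i.\<close>

definition xc :: "complex vec \<Rightarrow> nat \<Rightarrow> real" where
  "xc v j = (if j < g then - E v (col P (g + j)) / ds ! j else E v (col P (j - g)) / ds ! (j - g))"

lemma xc_add: "u \<in> carrier_vec g \<Longrightarrow> v \<in> carrier_vec g \<Longrightarrow> xc (u + v) j = xc u j + xc v j"
  and xc_smult: "v \<in> carrier_vec g \<Longrightarrow> xc (complex_of_real r \<cdot>\<^sub>v v) j = r * xc v j"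
  by (simp_all add: xc_def E_add_left E_smult_left add_divide_distrib diff_divide_distrib)

lemma xc_mult:
  assumes x: "x \<in> carrier_vec (2 * g)" and j: "j < 2 * g"
  shows "xc (P *\<^sub>v map_vec complex_of_real x) j = x $ j"
proof (cases "j < g")
  case True
  have p: "E (col P i) (col P (g + j)) = (if i = j then - real (ds ! j) else 0)" if "i < 2 * g" for i
  proof (cases i "g + j" rule: linorder_cases)
    case less
    then show ?thesis using E_periods[of i "g + j"] True by auto
  next
    case equal
    then show ?thesis using True by (simp add: E_self)
  next
    case greater
    then show ?thesis using E_periods[of "g + j" i] E_swap[of "col P (g + j)" "col P i"] that by simp
  qed
  have "E (P *\<^sub>v map_vec complex_of_real x) (col P (g + j)) =
      (\<Sum>i<2 * g. x $ i * E (col P i) (col P (g + j)))"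
    by (rule E_mult_mat_vec) (simp_all add: x)
  also have "\<dots> = (\<Sum>i<2 * g. if i = j then - (x $ j * real (ds ! j)) else 0)"
    by (intro sum.cong refl) (simp add: p)
  finally show ?thesis using True j ds_pos[OF True] by (simp add: xc_def)
next
  case False
  define k where "k = j - g"
  have k: "j = g + k" "k < g" using False j by (simp_all add: k_def)
  have p: "E (col P i) (col P k) = (if i = j then real (ds ! k) else 0)" if "i < 2 * g" for i
  proof (cases i k rule: linorder_cases)
    case less
    then show ?thesis using E_periods[of i k] k by auto
  next
    case equal
    then show ?thesis using k by (simp add: E_self)
  next
    case greater
    then show ?thesis using E_periods[of k i] E_swap[of "col P k" "col P i"] that k by simp
  qed
  have "E (P *\<^sub>v map_vec complex_of_real x) (col P k) = (\<Sum>i<2 * g. x $ i * E (col P i) (col P k))"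
    by (rule E_mult_mat_vec) (simp_all add: x)
  also have "\<dots> = (\<Sum>i<2 * g. if i = j then x $ j * real (ds ! k) else 0)"
    by (intro sum.cong refl) (simp add: p)
  finally show ?thesis using False j ds_pos[OF k(2)] k by (simp add: xc_def)
qed

lemma xc_zero: "xc (0\<^sub>v g) j = 0"
  using xc_add[of "0\<^sub>v g" "0\<^sub>v g" j] by simp

text \<open>By \<open>xc_mult\<close> the coordinates invert x -> P x from the left, so the 2 g
  columns are independent over the reals; by dimension they form a basis and the inverse is
  two-sided.\<close>

lemma mult_xc:
  assumes v: "v \<in> carrier_vec g"
  shows "P *\<^sub>v map_vec complex_of_real (vec (2 * g) (xc v)) = v"
proof -
  have "\<exists>x\<in>carrier_vec (2 * g). P *\<^sub>v map_vec complex_of_real x = v"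
  proof (rule real_combination_of_columns[OF P_dims(1) v])
    fix x :: "real vec" assume x: "x \<in> carrier_vec (2 * g)" "P *\<^sub>v map_vec complex_of_real x = 0\<^sub>v g"
    then have "x $ j = 0" if "j < 2 * g" for j using xc_mult[OF x(1) that] xc_zero by simp
    then show "x = 0\<^sub>v (2 * g)" using x(1) by (intro eq_vecI) auto
  qed
  then obtain x where x: "x \<in> carrier_vec (2 * g)" "P *\<^sub>v map_vec complex_of_real x = v" by blast
  have "vec (2 * g) (xc v) = x" using x(1) xc_mult[OF x(1)] x(2) by (intro eq_vecI) simp_all
  then show ?thesis using x(2) by simp
qed

lemma sum_xc_P: assumes "v \<in> carrier_vec g" "k < g"
  shows "(\<Sum>j<2 * g. complex_of_real (xc v j) * P $$ (k, j)) = v $ k"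
proof -
  have "(P *\<^sub>v map_vec complex_of_real (vec (2 * g) (xc v))) $ k =
      (\<Sum>j<2 * g. complex_of_real (xc v j) * P $$ (k, j))"
    using assms(2) by (simp add: scalar_prod_def atLeast0LessThan mult.commute)
  then show ?thesis using mult_xc[OF assms(1)] by simp
qed

lemma real_linear_expansion:
  assumes v: "v \<in> carrier_vec g"
    and add: "\<And>u w. u \<in> carrier_vec g \<Longrightarrow> w \<in> carrier_vec g \<Longrightarrow> F (u + w) = F u + F w"
    and sc: "\<And>r w. w \<in> carrier_vec g \<Longrightarrow> F (complex_of_real r \<cdot>\<^sub>v w) = r * F w"
  shows "(F v :: real) = (\<Sum>j<2 * g. xc v j * F (col P j))"
proof -
  have "complex_of_real (F (P *\<^sub>v map_vec complex_of_real (vec (2 * g) (xc v)))) =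
      (\<Sum>j<2 * g. map_vec complex_of_real (vec (2 * g) (xc v)) $ j * complex_of_real (F (col P j)))"
  proof (rule mult_mat_vec_mem_and_linear(2)[OF P_dims(1), where W = "carrier_vec g" and K = "\<real>"])
    fix c :: complex and w :: "complex vec" assume "c \<in> \<real>" "w \<in> carrier_vec g"
    then show "complex_of_real (F (c \<cdot>\<^sub>v w)) = c * complex_of_real (F w)"
      by (elim Reals_cases) (simp add: sc)
  qed (simp_all add: add)
  also have "\<dots> = complex_of_real (\<Sum>j<2 * g. xc v j * F (col P j))" by simp
  finally show ?thesis unfolding mult_xc[OF v] by (simp only: of_real_eq_iff)
qed

lemma period_basis: "lattice_basis g (carrier_vec g) \<Lambda> P"
  unfolding lattice_basis_def P_dims
proof (intro conjI refl)
  show "\<Lambda> = (\<lambda>x. P *\<^sub>v map_vec complex_of_int x) ` carrier_vec (2 * g)"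
    by (simp add: period_lattice_def length_ds)
  have "vec (2 * g) (xc (P *\<^sub>v map_vec complex_of_real x)) = x" if "x \<in> carrier_vec (2 * g)" for x
    using that xc_mult[OF that] by (intro eq_vecI) simp_all
  moreover have "P *\<^sub>v map_vec complex_of_real x \<in> carrier_vec g" if "x \<in> carrier_vec (2 * g)" for x
    by (rule mult_mat_vec_carrier[OF P_dims(1)]) (use that in simp)
  ultimately show "bij_betw (\<lambda>x. P *\<^sub>v map_vec complex_of_real x) (carrier_vec (2 * g)) (carrier_vec g)"
    using mult_xc by (intro bij_betw_byWitness[where f' = "\<lambda>v. vec (2 * g) (xc v)"]) auto
qed

end

sublocale siegel_torus \<subseteq> polarized_torus g L "period_lattice ds Z" "period_matrix ds Z"
proof unfold_locales
  show "L \<in> Pic (carrier_vec g) \<Lambda>" using pol by (simp add: polarization_def)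
qed (rule period_basis)

context siegel_torus
begin

lemma xc_lattice: assumes "l \<in> \<Lambda>" "j < 2 * g" shows "xc l j \<in> \<int>"
proof -
  obtain x where x: "x \<in> carrier_vec (2 * g)" "l = P *\<^sub>v map_vec complex_of_int x"
    using assms(1) unfolding \<Lambda>_eq by auto
  have "map_vec complex_of_int x = map_vec complex_of_real (map_vec real_of_int x)" by auto
  then have "xc l j = map_vec real_of_int x $ j" using x assms(2) by (simp add: xc_mult)
  then show ?thesis using x(1) assms(2) by simp
qed

lemma lattice_if_xc_Ints: assumes v: "v \<in> carrier_vec g" and "\<And>j. j < 2 * g \<Longrightarrow> xc v j \<in> \<int>" shows "v \<in> \<Lambda>"
proof -
  let ?x = "vec (2 * g) (\<lambda>j. \<lfloor>xc v j\<rfloor>)"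
  have "map_vec complex_of_int ?x = map_vec complex_of_real (vec (2 * g) (xc v))"
  proof (rule eq_vecI)
    fix j assume "j < dim_vec (map_vec complex_of_real (vec (2 * g) (xc v)))"
    then have j: "j < 2 * g" by simp
    have "real_of_int \<lfloor>xc v j\<rfloor> = xc v j" using assms(2)[OF j] by (auto elim: Ints_cases)
    then have "complex_of_real (real_of_int \<lfloor>xc v j\<rfloor>) = complex_of_real (xc v j)" by (rule arg_cong)
    then show "map_vec complex_of_int ?x $ j = map_vec complex_of_real (vec (2 * g) (xc v)) $ j" using j by simp
  qed simp
  then have "v = P *\<^sub>v map_vec complex_of_int ?x" using mult_xc[OF v] by simp
  then show ?thesis unfolding \<Lambda>_eq P_dims by (rule image_eqI[of _ _ ?x]) simp
qed

lemma xc_col: assumes "i < 2 * g" "j < 2 * g" shows "xc (col P i) j = (if j = i then 1 else 0)"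
proof -
  have "map_vec complex_of_real (unit_vec (2 * g) i) = map_vec complex_of_int (unit_vec (2 * g) i)"
    by (intro eq_vecI) (simp_all add: unit_vec_def)
  then have eq: "P *\<^sub>v map_vec complex_of_real (unit_vec (2 * g) i) = col P i"
    using mult_unit_vec_eq_col[OF P_dims(1) assms(1)] by simp
  have "xc (P *\<^sub>v map_vec complex_of_real (unit_vec (2 * g) i)) j = unit_vec (2 * g) i $ j"
    by (rule xc_mult) (use assms in simp_all)
  then show ?thesis unfolding eq using assms by simp
qed

end

section \<open>The Neron-Severi group\<close>

context siegel_torus
begin

text \<open>A 2-form stores only the unordered pair {i, j}; here its coefficients are spread out to
  an alternating real matrix.\<close>

definition coeff2 :: "form \<Rightarrow> nat \<Rightarrow> nat \<Rightarrow> real" where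
  "coeff2 \<omega> i j = (if i < j then Re (\<omega> {i, j}) else if j < i then - Re (\<omega> {i, j}) else 0)"

definition bil :: "form \<Rightarrow> complex vec \<Rightarrow> complex vec \<Rightarrow> real" where
  "bil \<omega> v w = (\<Sum>j<2 * g. \<Sum>i<2 * g. coeff2 \<omega> i j * (xc v i * xc w j))"

text \<open>The usual passage from an alternating form E to the form E (i v) w + i E v w with
  imaginary part E. Its hermitian symmetry is where condition (a) enters.\<close>

definition herm :: "form \<Rightarrow> complex vec \<Rightarrow> complex vec \<Rightarrow> complex" where
  "herm \<omega> v w = (if v \<in> carrier_vec g \<and> w \<in> carrier_vec g
     then complex_of_real (bil \<omega> (\<i> \<cdot>\<^sub>v v) w) + \<i> * complex_of_real (bil \<omega> v w) else 0)"

lemma complex_RatsD: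
  assumes "x \<in> \<rat>" shows "x = complex_of_real (Re x)" "Re x \<in> \<rat>"
proof -
  obtain p q :: int where "x = of_int p / of_int q" using assms by (elim Rats_cases') auto
  then have x: "x = complex_of_real (of_int p / of_int q)" by simp
  have "Re x = of_int p / of_int q" unfolding x by (rule Re_complex_of_real)
  then show "x = complex_of_real (Re x)" "Re x \<in> \<rat>" using x by simp_all
qed

lemma coeff2_self: "coeff2 \<omega> i i = 0" and coeff2_swap: "coeff2 \<omega> j i = - coeff2 \<omega> i j"
  by (auto simp: coeff2_def insert_commute)

lemma bil_add_left: "u \<in> carrier_vec g \<Longrightarrow> v \<in> carrier_vec g \<Longrightarrow> bil \<omega> (u + v) w = bil \<omega> u w + bil \<omega> v w"
  by (simp add: bil_def xc_add algebra_simps sum.distrib)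

lemma bil_smult_left: "v \<in> carrier_vec g \<Longrightarrow> bil \<omega> (complex_of_real r \<cdot>\<^sub>v v) w = r * bil \<omega> v w"
  by (simp add: bil_def xc_smult sum_distrib_left mult_ac)

lemma bil_swap: "bil \<omega> w v = - bil \<omega> v w"
proof -
  have "bil \<omega> w v = (\<Sum>j<2 * g. \<Sum>i<2 * g. coeff2 \<omega> j i * (xc w j * xc v i))"
    unfolding bil_def by (rule sum.swap)
  also have "\<dots> = (\<Sum>j<2 * g. \<Sum>i<2 * g. - (coeff2 \<omega> i j * (xc v i * xc w j)))"
    by (intro sum.cong refl, subst coeff2_swap) (simp add: mult.commute)
  finally show ?thesis by (simp add: bil_def sum_negf)
qed

lemma bil_alternating_sum:
  "bil \<omega> v w = (\<Sum>j<2 * g. \<Sum>i<j. coeff2 \<omega> i j * (xc v i * xc w j - xc v j * xc w i))"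
  unfolding bil_def by (rule antisymmetric_sum) (rule coeff2_self, rule coeff2_swap)

lemma bil_periods:
  assumes "i < 2 * g" "j < 2 * g" shows "bil \<omega> (col P i) (col P j) = coeff2 \<omega> i j"
proof -
  have "bil \<omega> (col P i) (col P j) =
      (\<Sum>j'<2 * g. \<Sum>i'<2 * g. if i' = i then (if j' = j then coeff2 \<omega> i j else 0) else 0)"
    unfolding bil_def by (intro sum.cong refl) (use assms in \<open>simp add: xc_col\<close>)
  then show ?thesis using assms by simp
qed

lemma i_i_smult: "v \<in> carrier_vec g \<Longrightarrow> \<i> \<cdot>\<^sub>v (\<i> \<cdot>\<^sub>v v) = complex_of_real (-1) \<cdot>\<^sub>v v"
  by (simp add: smult_smult_assoc)

lemma Im_herm: "v \<in> carrier_vec g \<Longrightarrow> w \<in> carrier_vec g \<Longrightarrow> Im (herm \<omega> v w) = bil \<omega> v w"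
  by (simp add: herm_def)

lemma rational_form_coeff:
  assumes "\<omega> \<in> rational_two_forms (2 * g)"
  shows "\<omega> = quad_form (2 * g) (\<lambda>i j. complex_of_real (coeff2 \<omega> i j))"
proof -
  have "complex_of_real (coeff2 \<omega> i j) = \<omega> {i, j}" if "i < j" for i j
  proof -
    have "\<omega> {i, j} \<in> \<rat>" using assms by (simp add: rational_two_forms_def)
    from complex_RatsD(1)[OF this] show ?thesis using that by (simp only: coeff2_def if_True)
  qed
  then have "quad_form (2 * g) (\<lambda>i j. complex_of_real (coeff2 \<omega> i j)) = quad_form (2 * g) (\<lambda>i j. \<omega> {i, j})"
    by (intro quad_form_cong) simp
  then show ?thesis using rational_two_form_eq_quad_form[OF assms] by simp
qed

lemma coeff2_Rats: assumes "\<omega> \<in> rational_two_forms (2 * g)" shows "coeff2 \<omega> i j \<in> \<rat>"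
proof -
  have "Re (\<omega> {i, j}) \<in> \<rat>"
  proof -
    have "\<omega> {i, j} \<in> \<rat>" using assms by (simp add: rational_two_forms_def)
    then show ?thesis by (rule complex_RatsD(2))
  qed
  then show ?thesis by (simp add: coeff2_def)
qed

lemma dz_eq: "dz ds Z k = lin_form (2 * g) (\<lambda>i. P $$ (k, i))"
  by (simp add: dz_def lin_form_def length_ds)

abbreviation volume :: form where "volume \<equiv> wedge_list (map (dz ds Z) [0..<g])"

lemma volume_eq: "volume = wedge_list (map (\<lambda>k. lin_form (2 * g) (\<lambda>i. P $$ (k, i))) [0..<g])"
  by (intro arg_cong[where f = wedge_list] map_cong refl dz_eq)

text \<open>The vectors dual to the dz_k are the standard basis vectors of C^g, written in the real
  coordinates \<open>xc\<close>.\<close>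

lemma volume_nonzero: "volume \<noteq> (\<lambda>S. 0)"
  unfolding volume_eq
proof (rule wedge_list_lin_form_nonzero[where X = "\<lambda>k i. complex_of_real (xc (unit_vec g k) i)"])
  fix k l assume "k \<in> set [0..<g]" "l \<in> set [0..<g]"
  then show "(\<Sum>i<2 * g. complex_of_real (xc (unit_vec g k) i) * P $$ (l, i)) = (if k = l then 1 else 0)"
    by (simp add: sum_xc_P)
qed simp

lemma contract_volume:
  assumes "\<And>k. k < g \<Longrightarrow> (\<Sum>i<2 * g. X i * P $$ (k, i)) = 0"
  shows "contract (2 * g) X volume = (\<lambda>S. 0)"
  unfolding volume_eq by (rule contract_wedge_list_lin_form) (use assms in simp)

text \<open>
  Contracting \<open>\<omega> \<and> dz\<^sub>1 \<and> \<dots> \<and> dz\<^sub>g\<close> with the antiholomorphic vectors \<open>v + \<i> J v\<close> and \<open>w + \<i> J w\<close>, on which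
  all \<open>dz\<^sub>k\<close> vanish, isolates the value of \<open>\<omega>\<close> on them.
\<close>

lemma bil_i_i:
  assumes \<omega>: "\<omega> \<in> NS_rat ds Z" and v: "v \<in> carrier_vec g" and w: "w \<in> carrier_vec g"
  shows "bil \<omega> (\<i> \<cdot>\<^sub>v v) (\<i> \<cdot>\<^sub>v w) = bil \<omega> v w"
proof -
  have rat: "\<omega> \<in> rational_two_forms (2 * g)" and vol: "wedge \<omega> volume = (\<lambda>S. 0)"
    using \<omega> by (simp_all add: NS_rat_def length_ds)
  define X where "X u j = complex_of_real (xc u j) + \<i> * complex_of_real (xc (\<i> \<cdot>\<^sub>v u) j)" for u j
  have Xdz: "(\<Sum>i<2 * g. X u i * P $$ (k, i)) = 0" if u: "u \<in> carrier_vec g" and k: "k < g" for u k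
  proof -
    have "(\<Sum>i<2 * g. X u i * P $$ (k, i)) = (\<Sum>i<2 * g. complex_of_real (xc u i) * P $$ (k, i))
        + \<i> * (\<Sum>i<2 * g. complex_of_real (xc (\<i> \<cdot>\<^sub>v u) i) * P $$ (k, i))"
      by (simp add: X_def sum.distrib distrib_right sum_distrib_left mult.assoc)
    also have "\<dots> = u $ k + \<i> * (\<i> * u $ k)"
      using u k sum_xc_P[OF u k] sum_xc_P[of "\<i> \<cdot>\<^sub>v u" k] by simp
    finally show ?thesis by simp
  qed
  let ?b = "\<lambda>i j. complex_of_real (coeff2 \<omega> i j)"
  have "contract (2 * g) (X w) (contract (2 * g) (X v) (wedge (quad_form (2 * g) ?b) volume)) =
      (\<lambda>S. (\<Sum>j<2 * g. \<Sum>i<j. ?b i j * (X v i * X w j - X v j * X w i)) * volume S)"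
    by (rule contract_wedge_quad_form[OF wedge_list_infinite])
      (use contract_volume Xdz v w in auto)
  moreover have "contract (2 * g) (X w) (contract (2 * g) (X v) (wedge (quad_form (2 * g) ?b) volume)) = (\<lambda>S. 0)"
    using vol rational_form_coeff[OF rat, symmetric] by (simp add: contract_zero)
  ultimately have "(\<lambda>S. (\<Sum>j<2 * g. \<Sum>i<j. ?b i j * (X v i * X w j - X v j * X w i)) * volume S) = (\<lambda>S. 0)"
    by simp
  moreover obtain S where "volume S \<noteq> 0" using volume_nonzero by (auto simp: fun_eq_iff)
  ultimately have "(\<Sum>j<2 * g. \<Sum>i<j. ?b i j * (X v i * X w j - X v j * X w i)) = 0"
    using fun_cong[of "\<lambda>S. (\<Sum>j<2 * g. \<Sum>i<j. ?b i j * (X v i * X w j - X v j * X w i)) * volume S" _ S]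
    by simp
  moreover have "(\<Sum>j<2 * g. \<Sum>i<2 * g. ?b i j * (X v i * X w j)) =
      (\<Sum>j<2 * g. \<Sum>i<j. ?b i j * (X v i * X w j - X v j * X w i))"
  proof (rule antisymmetric_sum)
    show "?b i i = 0" for i by (simp add: coeff2_self)
    show "?b j i = - ?b i j" for i j by (subst coeff2_swap) simp
  qed
  ultimately have "Re (\<Sum>j<2 * g. \<Sum>i<2 * g. ?b i j * (X v i * X w j)) = 0" by (simp only: zero_complex.sel)
  then have "(\<Sum>j<2 * g. \<Sum>i<2 * g. Re (?b i j * (X v i * X w j))) = 0" by (simp only: Re_sum)
  also have "(\<Sum>j<2 * g. \<Sum>i<2 * g. Re (?b i j * (X v i * X w j))) =
      (\<Sum>j<2 * g. \<Sum>i<2 * g. coeff2 \<omega> i j * (xc v i * xc w j) - coeff2 \<omega> i j * (xc (\<i> \<cdot>\<^sub>v v) i * xc (\<i> \<cdot>\<^sub>v w) j))"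
    by (intro sum.cong refl) (simp add: X_def right_diff_distrib)
  also have "\<dots> = bil \<omega> v w - bil \<omega> (\<i> \<cdot>\<^sub>v v) (\<i> \<cdot>\<^sub>v w)"
    by (simp add: bil_def sum_subtractf)
  finally show ?thesis by simp
qed

text \<open>Invariance under i (\<open>bil_i_i\<close>) together with antisymmetry makes E (i v) w
  symmetric in v and w, which is hermitian symmetry. Complex linearity reduces to real scalars and
  the scalar i.\<close>

lemma hermitian_herm:
  assumes \<omega>: "\<omega> \<in> NS_rat ds Z" shows "hermitian_form (carrier_vec g) (herm \<omega>)"
proof -
  have ic: "\<i> \<cdot>\<^sub>v v \<in> carrier_vec g" if "v \<in> carrier_vec g" for v :: "complex vec" using that by simp
  have b_i: "bil \<omega> (\<i> \<cdot>\<^sub>v (\<i> \<cdot>\<^sub>v v)) w = - bil \<omega> v w" if "v \<in> carrier_vec g" for v w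
    unfolding i_i_smult[OF that] bil_smult_left[OF that] by simp
  have sk: "bil \<omega> (\<i> \<cdot>\<^sub>v w) v = bil \<omega> (\<i> \<cdot>\<^sub>v v) w" if "v \<in> carrier_vec g" "w \<in> carrier_vec g" for v w
  proof -
    have "bil \<omega> (\<i> \<cdot>\<^sub>v w) v = - bil \<omega> v (\<i> \<cdot>\<^sub>v w)" by (rule bil_swap)
    also have "bil \<omega> v (\<i> \<cdot>\<^sub>v w) = bil \<omega> (\<i> \<cdot>\<^sub>v v) (\<i> \<cdot>\<^sub>v (\<i> \<cdot>\<^sub>v w))"
      using bil_i_i[OF \<omega> that(1) ic[OF that(2)]] by simp
    also have "\<dots> = - bil \<omega> (\<i> \<cdot>\<^sub>v (\<i> \<cdot>\<^sub>v w)) (\<i> \<cdot>\<^sub>v v)" by (rule bil_swap)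
    also have "\<dots> = bil \<omega> w (\<i> \<cdot>\<^sub>v v)" by (simp only: b_i[OF that(2)] minus_minus)
    also have "\<dots> = - bil \<omega> (\<i> \<cdot>\<^sub>v v) w" by (rule bil_swap)
    finally show ?thesis by simp
  qed
  have add: "herm \<omega> (u + v) w = herm \<omega> u w + herm \<omega> v w"
    if "u \<in> carrier_vec g" "v \<in> carrier_vec g" "w \<in> carrier_vec g" for u v w
    using that by (simp add: herm_def bil_add_left smult_add_distrib_vec[OF that(1,2)] algebra_simps)
  have sc: "herm \<omega> (c \<cdot>\<^sub>v v) w = c * herm \<omega> v w" if vw: "v \<in> carrier_vec g" "w \<in> carrier_vec g" for c v w
  proof -
    have c: "c \<cdot>\<^sub>v v = complex_of_real (Re c) \<cdot>\<^sub>v v + complex_of_real (Im c) \<cdot>\<^sub>v (\<i> \<cdot>\<^sub>v v)"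
    proof (rule eq_vecI)
      fix l assume "l < dim_vec (complex_of_real (Re c) \<cdot>\<^sub>v v + complex_of_real (Im c) \<cdot>\<^sub>v (\<i> \<cdot>\<^sub>v v))"
      then have l: "l < g" using vw by simp
      have "c * v $ l = (complex_of_real (Re c) + \<i> * complex_of_real (Im c)) * v $ l"
        by (simp only: complex_eq[symmetric])
      then show "(c \<cdot>\<^sub>v v) $ l = (complex_of_real (Re c) \<cdot>\<^sub>v v + complex_of_real (Im c) \<cdot>\<^sub>v (\<i> \<cdot>\<^sub>v v)) $ l"
        using l vw by (simp add: algebra_simps)
    qed simp
    have real: "herm \<omega> (complex_of_real r \<cdot>\<^sub>v u) w = complex_of_real r * herm \<omega> u w"
      if u: "u \<in> carrier_vec g" for r u
    proof -
      have "\<i> \<cdot>\<^sub>v (complex_of_real r \<cdot>\<^sub>v u) = complex_of_real r \<cdot>\<^sub>v (\<i> \<cdot>\<^sub>v u)"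
        by (simp add: smult_smult_assoc mult.commute)
      then show ?thesis
        using u vw by (simp add: herm_def bil_smult_left algebra_simps)
    qed
    have imag: "herm \<omega> (\<i> \<cdot>\<^sub>v v) w = \<i> * herm \<omega> v w"
      using vw by (simp add: herm_def b_i algebra_simps)
    have "herm \<omega> (c \<cdot>\<^sub>v v) w = complex_of_real (Re c) * herm \<omega> v w + complex_of_real (Im c) * (\<i> * herm \<omega> v w)"
      unfolding c using vw by (simp only: add real imag smult_carrier_vec ic)
    also have "\<dots> = (complex_of_real (Re c) + \<i> * complex_of_real (Im c)) * herm \<omega> v w"
      by (simp add: algebra_simps)
    finally show ?thesis by (simp only: complex_eq[symmetric])
  qed
  have cj: "herm \<omega> w v = cnj (herm \<omega> v w)" if "v \<in> carrier_vec g" "w \<in> carrier_vec g" for v w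
    using that sk[OF that] bil_swap[of \<omega> w v] by (simp add: herm_def)
  have out: "herm \<omega> v w = 0" if "v \<notin> carrier_vec g \<or> w \<notin> carrier_vec g" for v w
    using that by (auto simp: herm_def)
  show ?thesis unfolding hermitian_form_def using add sc cj out by blast
qed

text \<open>A hermitian form is determined by its imaginary part, and this real-bilinear alternating
  form by its values on pairs of periods. The factor c allows for a line bundle whose class is a
  multiple of \<omega>.\<close>

lemma hermitian_form_eq_herm:
  assumes h: "hermitian_form (carrier_vec g) h"
    and per: "\<And>i j. i < j \<Longrightarrow> j < 2 * g \<Longrightarrow> Im (h (col P i) (col P j)) = c * coeff2 \<omega> i j"
  shows "h v w = complex_of_real c * herm \<omega> v w"
proof -
  have out: "\<And>v w. v \<notin> carrier_vec g \<or> w \<notin> carrier_vec g \<Longrightarrow> h v w = 0"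
    and add: "\<And>u v w. u \<in> carrier_vec g \<Longrightarrow> v \<in> carrier_vec g \<Longrightarrow> w \<in> carrier_vec g \<Longrightarrow> h (u + v) w = h u w + h v w"
    and sc: "\<And>c v w. v \<in> carrier_vec g \<Longrightarrow> w \<in> carrier_vec g \<Longrightarrow> h (c \<cdot>\<^sub>v v) w = c * h v w"
    and cj: "\<And>v w. v \<in> carrier_vec g \<Longrightarrow> w \<in> carrier_vec g \<Longrightarrow> h w v = cnj (h v w)"
    using h unfolding hermitian_form_def by blast+
  have swap: "Im (h w v) = - Im (h v w)" if "v \<in> carrier_vec g" "w \<in> carrier_vec g" for v w
    using cj[OF that] by simp
  have per': "Im (h (col P i) (col P j)) = c * coeff2 \<omega> i j" if ij: "i < 2 * g" "j < 2 * g" for i j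
  proof (cases i j rule: linorder_cases)
    case equal
    then show ?thesis using swap[OF col_P_carrier col_P_carrier, of j j] by (simp add: coeff2_self)
  next
    case greater
    have "Im (h (col P i) (col P j)) = - Im (h (col P j) (col P i))" by (rule swap) simp_all
    also have "\<dots> = - (c * coeff2 \<omega> j i)" using per[OF greater ij(1)] by simp
    finally show ?thesis by (simp add: coeff2_swap[of _ i j])
  qed (use per ij in simp)
  have lin: "Im (h v w) = (\<Sum>j<2 * g. xc v j * Im (h (col P j) w))"
    if "v \<in> carrier_vec g" "w \<in> carrier_vec g" for v w
    by (rule real_linear_expansion[where F = "\<lambda>v. Im (h v w)"]) (use that in \<open>simp_all add: add sc\<close>)
  have Im: "Im (h v w) = c * bil \<omega> v w" if v: "v \<in> carrier_vec g" and w: "w \<in> carrier_vec g" for v w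
  proof -
    have "Im (h v w) = - Im (h w v)" by (rule swap[OF w v])
    also have "\<dots> = - (\<Sum>j<2 * g. xc w j * Im (h (col P j) v))" by (simp only: lin[OF w v])
    also have "\<dots> = (\<Sum>j<2 * g. xc w j * Im (h v (col P j)))"
      unfolding sum_negf[symmetric] by (intro sum.cong refl) (simp add: swap[OF v col_P_carrier])
    also have "\<dots> = (\<Sum>j<2 * g. \<Sum>i<2 * g. c * (coeff2 \<omega> i j * (xc v i * xc w j)))"
      by (intro sum.cong refl) (simp add: lin[OF v col_P_carrier] per' sum_distrib_left mult_ac)
    finally show ?thesis by (simp add: bil_def sum_distrib_left)
  qed
  show ?thesis
  proof (cases "v \<in> carrier_vec g \<and> w \<in> carrier_vec g")
    case True
    then have "Im (h v w) = c * bil \<omega> v w" "Re (h v w) = c * bil \<omega> (\<i> \<cdot>\<^sub>v v) w"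
      using Im[of v w] Im[of "\<i> \<cdot>\<^sub>v v" w] by (simp_all add: sc)
    then show ?thesis using True by (simp add: complex_eq_iff herm_def)
  qed (auto simp: out herm_def)
qed

lemma exists_endo:
  assumes "\<omega> \<in> NS_rat ds Z" "v \<in> carrier_vec g"
  shows "\<exists>u\<in>carrier_vec g. H u = herm \<omega> v"
  using riesz hermitian_form_linear_to_antidual[OF hermitian_herm[OF assms(1)] subspace_carrier] assms(2)
  by (auto simp: linear_to_antidual_def)

text \<open>The endomorphism f attached to \<omega>, given pointwise by Riesz representation of
  \<open>herm \<omega> v\<close>; definiteness of H makes the chosen vector unique.\<close>

definition endo :: "form \<Rightarrow> complex vec \<Rightarrow> complex vec" where
  "endo \<omega> v = (SOME u. u \<in> carrier_vec g \<and> H u = herm \<omega> v)"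

lemma endo:
  assumes "\<omega> \<in> NS_rat ds Z" "v \<in> carrier_vec g"
  shows "endo \<omega> v \<in> carrier_vec g" "H (endo \<omega> v) = herm \<omega> v"
  using someI_ex[of "\<lambda>u. u \<in> carrier_vec g \<and> H u = herm \<omega> v"] exists_endo[OF assms]
  unfolding endo_def by blast+

lemma endo_self_adjoint:
  assumes \<omega>: "\<omega> \<in> NS_rat ds Z" and vw: "v \<in> carrier_vec g" "w \<in> carrier_vec g"
  shows "H (endo \<omega> v) w = H v (endo \<omega> w)"
proof -
  have "H (endo \<omega> v) w = herm \<omega> v w" by (simp add: endo(2)[OF \<omega> vw(1)])
  also have "\<dots> = cnj (herm \<omega> w v)" using hermitian_herm[OF \<omega>] vw unfolding hermitian_form_def by blast
  also have "herm \<omega> w v = H (endo \<omega> w) v" by (simp add: endo(2)[OF \<omega> vw(2)])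
  also have "cnj (H (endo \<omega> w) v) = H v (endo \<omega> w)"
    by (rule H_commute[symmetric, OF endo(1)[OF \<omega> vw(2)] vw(1)])
  finally show ?thesis .
qed

text \<open>After clearing denominators the form is integral on \<Lambda>, and what remains is to
  exhibit a semicharacter for it.\<close>

lemma exists_line_bundle:
  assumes \<omega>: "\<omega> \<in> NS_rat ds Z"
  shows "\<exists>m>0. \<exists>M\<in>Pic (carrier_vec g) \<Lambda>. chern_class P M = (\<lambda>S. of_nat m * \<omega> S) \<and>
    fst M = (\<lambda>v w. of_nat m * herm \<omega> v w)"
proof -
  have rat: "\<omega> \<in> rational_two_forms (2 * g)" using \<omega> by (simp add: NS_rat_def length_ds)
  obtain m :: nat where m: "0 < m" "\<And>p. p \<in> {..<2 * g} \<times> {..<2 * g} \<Longrightarrow> of_nat m * coeff2 \<omega> (fst p) (snd p) \<in> \<int>"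
    using common_denominator[of "{..<2 * g} \<times> {..<2 * g}" "\<lambda>p. coeff2 \<omega> (fst p) (snd p)"] coeff2_Rats[OF rat]
    by auto
  define n where "n i j = of_nat m * coeff2 \<omega> i j" for i j
  have n: "n i j \<in> \<int>" if "i < 2 * g" "j < 2 * g" for i j using m(2)[of "(i, j)"] that by (simp add: n_def)
  \<comment> \<open>A quadratic refinement of Im h modulo 2: in q (l + l') - q l - q l' the
    coefficient n_ij comes with x_i x'_j + x_j x'_i, in Im h with x_i x'_j - x_j x'_i, and the
    difference is an even integer. So exp (i pi q) is a semicharacter.\<close>
  define q where "q l = (\<Sum>j<2 * g. \<Sum>i<j. n i j * (xc l i * xc l j))" for l
  define \<chi> where "\<chi> l = (if l \<in> \<Lambda> then exp (\<i> * complex_of_real pi * complex_of_real (q l)) else 1)" for l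
  define h where "h = (\<lambda>v w. of_nat m * herm \<omega> v w)"
  have herm_h: "hermitian_form (carrier_vec g) h"
  proof -
    have hh: "hermitian_form (carrier_vec g) (herm \<omega>)" by (rule hermitian_herm[OF \<omega>])
    have "h v w = 0" if "v \<notin> carrier_vec g \<or> w \<notin> carrier_vec g" for v w
      using hh that by (simp add: hermitian_form_def h_def)
    moreover have "h (u + v) w = h u w + h v w"
      if "u \<in> carrier_vec g" "v \<in> carrier_vec g" "w \<in> carrier_vec g" for u v w
    proof -
      have "herm \<omega> (u + v) w = herm \<omega> u w + herm \<omega> v w" using hh that unfolding hermitian_form_def by blast
      then show ?thesis by (simp add: h_def distrib_left)
    qed
    moreover have "h (c \<cdot>\<^sub>v v) w = c * h v w" if "v \<in> carrier_vec g" "w \<in> carrier_vec g" for c v w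
    proof -
      have "herm \<omega> (c \<cdot>\<^sub>v v) w = c * herm \<omega> v w" using hh that unfolding hermitian_form_def by blast
      then show ?thesis by (simp add: h_def)
    qed
    moreover have "h w v = cnj (h v w)" if "v \<in> carrier_vec g" "w \<in> carrier_vec g" for v w
    proof -
      have "herm \<omega> w v = cnj (herm \<omega> v w)" using hh that unfolding hermitian_form_def by blast
      then show ?thesis unfolding h_def by (simp only: complex_cnj_mult complex_cnj_of_nat)
    qed
    ultimately show ?thesis unfolding hermitian_form_def by blast
  qed
  have Im_h: "Im (h l l') = (\<Sum>j<2 * g. \<Sum>i<j. n i j * (xc l i * xc l' j - xc l j * xc l' i))"
    if "l \<in> \<Lambda>" "l' \<in> \<Lambda>" for l l'
    using that \<Lambda>_carrier
    by (simp add: h_def Im_herm bil_alternating_sum n_def sum_distrib_left mult.assoc)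
  have Im_int: "Im (h l l') \<in> \<int>" if "l \<in> \<Lambda>" "l' \<in> \<Lambda>" for l l'
    unfolding Im_h[OF that]
    by (intro Ints_sum Ints_mult Ints_diff n xc_lattice) (use that in auto)
  have semi: "\<chi> (l + l') = \<chi> l * \<chi> l' * exp (\<i> * pi * Im (h l l'))" if ll: "l \<in> \<Lambda>" "l' \<in> \<Lambda>" for l l'
  proof -
    define k where "k = (\<Sum>j<2 * g. \<Sum>i<j. n i j * (xc l j * xc l' i))"
    have "k \<in> \<int>" unfolding k_def by (intro Ints_sum Ints_mult n xc_lattice) (use ll in auto)
    then obtain z :: int where z: "k = of_int z" by (elim Ints_cases)
    have "q (l + l') = q l + q l' + Im (h l l') + 2 * k"
      unfolding Im_h[OF ll] q_def k_def sum_distrib_left sum.distrib[symmetric]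
      by (intro sum.cong refl) (simp add: xc_add \<Lambda>_carrier ll algebra_simps)
    then have "\<i> * complex_of_real pi * complex_of_real (q (l + l')) =
        \<i> * complex_of_real pi * complex_of_real (q l) + \<i> * complex_of_real pi * complex_of_real (q l')
        + \<i> * complex_of_real pi * complex_of_real (Im (h l l')) + 2 * complex_of_real pi * \<i> * of_int z"
      by (simp add: z algebra_simps)
    moreover have "exp (2 * complex_of_real pi * \<i> * of_int z) = 1"
    proof -
      have "cis (2 * pi * of_int z) = 1" by (rule cis_multiple_2pi) simp
      then show ?thesis by (simp add: cis_conv_exp mult_ac)
    qed
    ultimately show ?thesis using ll \<Lambda>_add by (simp add: \<chi>_def exp_add)
  qed
  have M: "(h, \<chi>) \<in> Pic (carrier_vec g) \<Lambda>"
    using herm_h Im_int semi by (auto simp: Pic_def \<chi>_def norm_exp_eq_Re)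
  have "Im (h (col P i) (col P j)) = m * coeff2 \<omega> i j" if "i < 2 * g" "j < 2 * g" for i j
    by (simp add: h_def Im_herm bil_periods that)
  then have "quad_form (2 * g) (\<lambda>i j. complex_of_real (Im (h (col P i) (col P j)))) =
      quad_form (2 * g) (\<lambda>i j. of_nat m * complex_of_real (coeff2 \<omega> i j))"
    by (intro quad_form_cong) simp
  moreover have "chern_class P (h, \<chi>) = quad_form (2 * g) (\<lambda>i j. complex_of_real (Im (h (col P i) (col P j))))"
    by (simp add: chern_class_def quad_form_def)
  ultimately have "chern_class P (h, \<chi>) = quad_form (2 * g) (\<lambda>i j. of_nat m * complex_of_real (coeff2 \<omega> i j))"
    by simp
  also have "\<dots> = (\<lambda>S. of_nat m * \<omega> S)"
    unfolding quad_form_scale using rational_form_coeff[OF rat] by simp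
  finally show ?thesis using m(1) M by (intro exI[of _ m]) (auto simp: h_def intro!: bexI[of _ "(h, \<chi>)"])
qed

text \<open>Both M and m may vary, but the Chern class fixes the hermitian form of M as m times
  \<open>herm \<omega>\<close>, and m cancels. This is the well-definedness of the linear
  extension.\<close>

lemma phi_rat_eq:
  assumes \<omega>: "\<omega> \<in> NS_rat ds Z" shows "phi_rat ds Z \<omega> = herm \<omega>"
  unfolding phi_rat_def length_ds
proof (rule the_equality)
  obtain m M where mM: "0 < m" "M \<in> Pic (carrier_vec g) \<Lambda>" "chern_class P M = (\<lambda>S. of_nat m * \<omega> S)"
    "fst M = (\<lambda>v w. of_nat m * herm \<omega> v w)"
    using exists_line_bundle[OF \<omega>] by blast
  then show "\<exists>m>0. \<exists>M\<in>Pic (carrier_vec g) \<Lambda>. chern_class P M = (\<lambda>S. of_nat m * \<omega> S) \<and>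
      herm \<omega> = (\<lambda>v w. phi (carrier_vec g) \<Lambda> M v w / of_nat m)"
    by (intro exI[of _ m] conjI bexI[of _ M]) (simp_all add: phi_L)
  fix F assume "\<exists>m>0. \<exists>M\<in>Pic (carrier_vec g) \<Lambda>. chern_class P M = (\<lambda>S. of_nat m * \<omega> S) \<and>
      F = (\<lambda>v w. phi (carrier_vec g) \<Lambda> M v w / of_nat m)"
  then obtain m M where mM: "0 < m" "M \<in> Pic (carrier_vec g) \<Lambda>" "chern_class P M = (\<lambda>S. of_nat m * \<omega> S)"
    "F = (\<lambda>v w. fst M v w / of_nat m)" by (auto simp: phi_L)
  have h: "hermitian_form (carrier_vec g) (fst M)" using mM(2) by (auto simp: Pic_def)
  have rat: "\<omega> \<in> rational_two_forms (2 * g)" using \<omega> by (simp add: NS_rat_def length_ds)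
  have "Im (fst M (col P i) (col P j)) = real m * coeff2 \<omega> i j" if ij: "i < j" "j < 2 * g" for i j
  proof -
    have "complex_of_real (Im (fst M (col P i) (col P j))) = chern_class P M {i, j}"
      using quad_form_eval[OF ij, of "\<lambda>i j. complex_of_real (Im (fst M (col P i) (col P j)))"]
      by (simp add: chern_class_def quad_form_def)
    also have "\<dots> = of_nat m * \<omega> {i, j}" by (simp add: mM(3))
    finally show ?thesis using ij by (simp add: coeff2_def complex_eq_iff)
  qed
  then have "fst M v w = complex_of_real (real m) * herm \<omega> v w" for v w
    by (rule hermitian_form_eq_herm[OF h])
  then show "F = herm \<omega>" unfolding mM(4) using mM(1) by (simp add: fun_eq_iff)
qed

lemma NS_to_End_eq:
  assumes \<omega>: "\<omega> \<in> NS_rat ds Z"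
  shows "NS_to_End ds Z L \<omega> = restrict (endo \<omega>) (carrier_vec g)"
proof -
  have "phi_inverse (carrier_vec g) \<Lambda> L (herm \<omega> v) = endo \<omega> v" if "v \<in> carrier_vec g" for v
    using phi_inverse_L[OF endo(1)[OF \<omega> that]] endo(2)[OF \<omega> that] by simp
  then show ?thesis
    unfolding NS_to_End_def length_ds phi_rat_eq[OF \<omega>] by (auto simp: restrict_def)
qed

text \<open>The endomorphism gives back \<open>herm \<omega>\<close>, and the imaginary parts of its
  values on pairs of periods are the coefficients of \<omega>.\<close>

lemma inj_NS_to_End: "inj_on (NS_to_End ds Z L) (NS_rat ds Z)"
proof (rule inj_onI)
  fix \<omega> \<omega>' assume w: "\<omega> \<in> NS_rat ds Z" "\<omega>' \<in> NS_rat ds Z" and eq: "NS_to_End ds Z L \<omega> = NS_to_End ds Z L \<omega>'"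
  have "herm \<omega> v = herm \<omega>' v" if v: "v \<in> carrier_vec g" for v
  proof -
    have "endo \<omega> v = endo \<omega>' v"
      using fun_cong[OF eq, of v] v unfolding NS_to_End_eq[OF w(1)] NS_to_End_eq[OF w(2)] by simp
    then show ?thesis using endo(2)[OF w(1) v] endo(2)[OF w(2) v] by simp
  qed
  then have "coeff2 \<omega> i j = coeff2 \<omega>' i j" if "i < 2 * g" "j < 2 * g" for i j
    using Im_herm[of "col P i" "col P j"] bil_periods[OF that] by (metis col_P_carrier)
  then have "quad_form (2 * g) (\<lambda>i j. complex_of_real (coeff2 \<omega> i j)) =
      quad_form (2 * g) (\<lambda>i j. complex_of_real (coeff2 \<omega>' i j))"
    by (intro quad_form_cong) simp
  then show "\<omega> = \<omega>'" using w rational_form_coeff by (simp add: NS_rat_def length_ds)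
qed

end

section \<open>The numerical conditions and the eigenvalues\<close>

lemma prod_diff_mult_fact:
  assumes "r \<le> n" "n \<le> g"
  shows "(\<Prod>i = n + 1..g. of_nat i - of_nat r :: complex) * fact (n - r) = fact (g - r)"
  using assms(2)
proof (induction g rule: dec_induct)
  case (step g)
  have s: "of_nat (Suc g) - of_nat r = (of_nat (Suc (g - r)) :: complex)"
    using step.hyps assms(1) by (simp add: of_nat_diff)
  have f: "Suc g - r = Suc (g - r)" using step.hyps assms(1) by simp
  have "(\<Prod>i = n + 1..Suc g. of_nat i - of_nat r :: complex) =
      (\<Prod>i = n + 1..g. of_nat i - of_nat r) * (of_nat (Suc g) - of_nat r)"
    using step.hyps by (simp add: prod.nat_ivl_Suc')
  then have "(\<Prod>i = n + 1..Suc g. of_nat i - of_nat r :: complex) * fact (n - r) =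
      ((\<Prod>i = n + 1..g. of_nat i - of_nat r) * fact (n - r)) * of_nat (Suc (g - r))"
    by (simp only: s mult_ac)
  then show ?case unfolding step.IH f fact_Suc by (simp only: mult.commute)
qed simp

text \<open>The weight is the binomial coefficient of the mixed power; with it the right-hand side
  of condition (b) becomes the coefficient of t^r in g! (1 + t)^n, uniformly for r below and above
  n.\<close>

lemma choose_mult_condition:
  assumes "n \<le> g" "r \<le> g"
  shows "of_nat (g choose r) * (if r \<le> n then fact n * (\<Prod>i = n + 1..g. of_nat i - of_nat r) else 0) =
    (fact g * of_nat (n choose r) :: complex)"
proof (cases "r \<le> n")
  case True
  have "(\<Prod>i = n + 1..g. of_nat i - of_nat r :: complex) = fact (g - r) / fact (n - r)"
    using prod_diff_mult_fact[OF True assms(1)] by (simp add: field_simps)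
  then show ?thesis using True assms by (simp add: binomial_fact field_simps)
qed simp

lemma sum_choose_powers:
  assumes "n \<le> g" shows "(\<Sum>r\<le>g. of_nat (n choose r) * t ^ r) = (1 + t :: complex) ^ n"
proof -
  have "(1 + t) ^ n = (\<Sum>r\<le>n. of_nat (n choose r) * t ^ r)"
    using binomial_ring[of t 1 n] by (simp add: add.commute)
  also have "\<dots> = (\<Sum>r\<le>g. of_nat (n choose r) * t ^ r)"
    by (rule sum.mono_neutral_left) (use assms in auto)
  finally show ?thesis by simp
qed

lemma prod_zero_one:
  fixes g :: nat and a :: "nat \<Rightarrow> real"
  assumes "\<And>k. k < g \<Longrightarrow> a k = 0 \<or> a k = (1::real)"
  shows "(\<Prod>k<g. 1 + t * complex_of_real (a k)) = (1 + t) ^ card {k. k < g \<and> a k = 1}"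
proof -
  have "(\<Prod>k<g. 1 + t * complex_of_real (a k)) = (\<Prod>k\<in>{..<g}. if a k = 1 then 1 + t else 1)"
    by (intro prod.cong refl) (use assms in force)
  also have "\<dots> = (\<Prod>k\<in>{k \<in> {..<g}. a k = 1}. 1 + t)"
    by (rule prod.inter_filter[symmetric]) simp
  finally show ?thesis by simp
qed

text \<open>
  Comparing coefficients of \<open>t\<close>, the conditions say that the \<open>a k\<close> satisfy
  \<open>\<Prod>k. (1 + t * a k) = (1 + t) ^ n\<close>.
\<close>

lemma conditions_iff_eigenvalues:
  fixes U :: "nat \<Rightarrow> form" and W0 :: form and a :: "nat \<Rightarrow> real"
  assumes n: "n \<le> g" and W0: "W0 \<noteq> (\<lambda>S. 0)"
    and id: "\<And>t S. (\<Sum>r\<le>g. of_nat (g choose r) * t ^ r * U r S) =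
      fact g * (\<Prod>k<g. 1 + t * complex_of_real (a k)) * W0 S"
  shows "(\<forall>r. 1 \<le> r \<and> r \<le> g \<longrightarrow>
      U r = (\<lambda>S. (if r \<le> n then fact n * (\<Prod>i = n + 1..g. of_nat i - of_nat r) else 0) * W0 S)) \<longleftrightarrow>
    (\<forall>k<g. a k = 0 \<or> a k = 1) \<and> card {k. k < g \<and> a k = 1} = n"
    (is "?L \<longleftrightarrow> ?R")
proof
  let ?c = "\<lambda>r. if r \<le> n then fact n * (\<Prod>i = n + 1..g. of_nat i - of_nat r) else (0::complex)"
  have c: "of_nat (g choose r) * ?c r = fact g * of_nat (n choose r)" if "r \<le> g" for r
    by (rule choose_mult_condition[OF n that])
  assume L: ?L
  obtain S where S: "W0 S \<noteq> 0" using W0 by (auto simp: fun_eq_iff)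
  \<comment> \<open>The conditions start at r = 1; the value at r = 0 comes from the identity at t =
    0, where only the term with 0 ^ 0 = 1 remains.\<close>
  have U0: "U 0 S = fact g * W0 S"
  proof -
    have "(\<Sum>r\<le>g. of_nat (g choose r) * 0 ^ r * U r S) = (\<Sum>r\<in>{0}. of_nat (g choose r) * 0 ^ r * U r S)"
      by (rule sum.mono_neutral_right) (auto simp: power_0_left)
    then show ?thesis using id[of 0 S] by simp
  qed
  have prod: "(\<Prod>k<g. 1 + t * complex_of_real (a k)) = (1 + t) ^ n" for t
  proof -
    have "of_nat (g choose r) * t ^ r * U r S = fact g * (of_nat (n choose r) * t ^ r) * W0 S" if "r \<le> g" for r
    proof (cases "r = 0")
      case False
      then have "U r S = ?c r * W0 S" using L that by (simp add: fun_eq_iff)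
      then have "of_nat (g choose r) * t ^ r * U r S = (of_nat (g choose r) * ?c r) * t ^ r * W0 S"
        by (simp only: mult_ac)
      then show ?thesis unfolding c[OF that] by (simp only: mult_ac)
    qed (simp add: U0)
    then have "(\<Sum>r\<le>g. of_nat (g choose r) * t ^ r * U r S) =
        (\<Sum>r\<le>g. fact g * (of_nat (n choose r) * t ^ r) * W0 S)"
      by (intro sum.cong refl) simp
    also have "\<dots> = fact g * (1 + t) ^ n * W0 S"
      unfolding sum_choose_powers[OF n, symmetric] sum_distrib_left sum_distrib_right ..
    finally show ?thesis using id[of t S] S by simp
  qed
  have a: "a k = 0 \<or> a k = 1" if k: "k < g" for k
  proof (rule disjCI)
    assume ne: "a k \<noteq> 1"
    show "a k = 0"
    proof (rule ccontr)
      assume nz: "a k \<noteq> 0"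
      \<comment> \<open>A nonzero a k makes -1 / a k a root of the product, whereas (1 + t) ^ n has
        no root other than -1.\<close>
      define t where "t = complex_of_real (- 1 / a k)"
      have "t * complex_of_real (a k) = complex_of_real (- 1 / a k * a k)"
        unfolding t_def by (rule of_real_mult[symmetric])
      then have "1 + t * complex_of_real (a k) = 0" using nz by simp
      then have "(\<Prod>k<g. 1 + t * complex_of_real (a k)) = 0" using k by (intro prod_zero) auto
      then have "1 + t = 0" unfolding prod by simp
      then have "Re (1 + t) = 0" by simp
      then have "1 + - 1 / a k = 0" by (simp add: t_def)
      then show False using nz ne by (simp add: field_simps)
    qed
  qed
  \<comment> \<open>Evaluation at t = 1 counts the eigenvalues equal to 1, both sides being powers
    of 2.\<close>
  have "(1 + 1 :: complex) ^ card {k. k < g \<and> a k = 1} = (1 + 1) ^ n"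
    using prod[of 1] prod_zero_one[of g a 1] a by simp
  then have "(of_nat (2 ^ card {k. k < g \<and> a k = 1}) :: complex) = of_nat (2 ^ n)" by simp
  then have "(2::nat) ^ card {k. k < g \<and> a k = 1} = 2 ^ n" by (simp only: of_nat_eq_iff)
  then show ?R using a by simp
next
  let ?c = "\<lambda>r. if r \<le> n then fact n * (\<Prod>i = n + 1..g. of_nat i - of_nat r) else (0::complex)"
  assume R: ?R
  have prod: "(\<Prod>k<g. 1 + t * complex_of_real (a k)) = (1 + t) ^ n" for t
    using prod_zero_one[of g a t] R by simp
  show ?L
  proof (intro allI impI ext)
    fix r S assume r: "1 \<le> r \<and> r \<le> g"
    have "(\<Sum>r\<le>g. (of_nat (g choose r) * U r S - fact g * of_nat (n choose r) * W0 S) * t ^ r) = 0" for t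
    proof -
      have "(\<Sum>r\<le>g. (of_nat (g choose r) * U r S - fact g * of_nat (n choose r) * W0 S) * t ^ r) =
          (\<Sum>r\<le>g. of_nat (g choose r) * t ^ r * U r S) - (\<Sum>r\<le>g. fact g * (of_nat (n choose r) * t ^ r) * W0 S)"
        unfolding sum_subtractf[symmetric] by (intro sum.cong refl) (simp add: algebra_simps)
      also have "(\<Sum>r\<le>g. fact g * (of_nat (n choose r) * t ^ r) * W0 S) = fact g * (1 + t) ^ n * W0 S"
        unfolding sum_choose_powers[OF n, symmetric] sum_distrib_left sum_distrib_right ..
      finally show ?thesis unfolding id prod by simp
    qed
    then have "of_nat (g choose r) * U r S - fact g * of_nat (n choose r) * W0 S = 0"
      using polyfun_eq_0[of "\<lambda>r. of_nat (g choose r) * U r S - fact g * of_nat (n choose r) * W0 S" g] r by blast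
    then have "of_nat (g choose r) * U r S = (of_nat (g choose r) * ?c r) * W0 S"
      using choose_mult_condition[OF n, of r] r by simp
    then have "of_nat (g choose r) * U r S = of_nat (g choose r) * (?c r * W0 S)" by (simp only: mult.assoc)
    moreover have "(of_nat (g choose r) :: complex) \<noteq> 0" using r by simp
    ultimately show "U r S = ?c r * W0 S" by (metis mult_left_cancel)
  qed
qed

section \<open>Decomposable two-forms\<close>

lemma wedge_lin_form_square:
  "wedge (wedge (lin_form m c) (lin_form m d)) (wedge (lin_form m c) (lin_form m d)) = (\<lambda>S. 0)"
proof -
  let ?A = "lin_form m c" and ?B = "lin_form m d"
  have "wedge ?B (wedge ?A ?B) = wedge (\<lambda>S. -1 * wedge ?A ?B S) ?B"
    using wedge_lin_form_anticommute[of m d c] by (simp add: wedge_assoc[symmetric])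
  also have "\<dots> = (\<lambda>S. -1 * wedge ?A (wedge ?B ?B) S)" by (simp only: wedge_scale_left wedge_assoc)
  also have "\<dots> = (\<lambda>S. 0)" by (simp add: wedge_lin_form_self wedge_zero_right)
  finally show ?thesis by (simp add: wedge_assoc wedge_zero_right)
qed

lemma dx_eq_lin_form: "i < m \<Longrightarrow> dx i = lin_form m (\<lambda>j. if j = i then 1 else 0)"
  by (simp add: lin_form_def fun_eq_iff if_distrib[of "\<lambda>x. x * _"] cong: if_cong)

lemma distinct_concat_pairs: "n \<le> h \<Longrightarrow> distinct (concat (map (\<lambda>i. [i, h + i]) [0..<n]))"
  by (induction n) auto

lemma wedge_list_pairs:
  "wedge_list (map (\<lambda>i. wedge (dx i) (dx (h + i))) ks) = wedge_list (map dx (concat (map (\<lambda>i. [i, h + i]) ks)))"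
  by (induction ks) (simp_all add: wedge_list_Cons wedge_assoc)

text \<open>Up to sign \<omega>_0 is a product of distinct dx_k, to which the coordinate vectors are
  dual. Its being nonzero is what allows coefficients to be compared in condition (b).\<close>

lemma omega0_nonzero: "omega0 g \<noteq> (\<lambda>S. 0)"
proof -
  let ?ks = "concat (map (\<lambda>i. [i, g + i]) [0..<g])"
  have ks: "set ?ks \<subseteq> {..<2 * g}" by auto
  have m: "map dx ?ks = map (\<lambda>k. lin_form (2 * g) (\<lambda>j. if j = k then 1 else 0)) ?ks"
    by (rule map_cong[OF refl]) (use ks dx_eq_lin_form in auto)
  have "wedge_list (map (\<lambda>k. lin_form (2 * g) (\<lambda>j. if j = k then 1 else 0)) ?ks) \<noteq> (\<lambda>S. 0)"
  proof (rule wedge_list_lin_form_nonzero[where X = "\<lambda>k j. if j = k then 1 else 0"])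
    show "distinct ?ks" by (rule distinct_concat_pairs) simp
    fix k l assume "k \<in> set ?ks" "l \<in> set ?ks"
    then have "k < 2 * g" using ks by blast
    then show "(\<Sum>i<2 * g. (if i = k then 1 else 0) * (if i = l then 1 else 0)) = (if k = l then 1 else (0::complex))"
      by (simp add: if_distrib[of "\<lambda>x. x * _"] cong: if_cong)
  qed
  then have "wedge_list (map (\<lambda>i. wedge (dx i) (dx (g + i))) [0..<g]) \<noteq> (\<lambda>S. 0)"
    unfolding wedge_list_pairs m .
  then show ?thesis by (auto simp: omega0_def fun_eq_iff)
qed

context siegel_torus
begin

definition dxdx :: "nat \<Rightarrow> even_form" where
  "dxdx i = Abs_even_form (wedge (dx i) (dx (g + i)))"

lemma Rep_dxdx: "i < g \<Longrightarrow> Rep_even_form (dxdx i) = wedge (dx i) (dx (g + i))"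
  unfolding dxdx_def by (rule Abs_even_form_inverse) (auto simp: wedge_dx_dx)

lemma dxdx_square: "i < g \<Longrightarrow> dxdx i * dxdx i = 0"
  by (rule Rep_even_form_inject[THEN iffD1])
    (simp add: times_even_form.rep_eq zero_even_form.rep_eq Rep_dxdx dx_eq_lin_form[of _ "2 * g"] wedge_lin_form_square)

text \<open>The factor (-1)^g in \<omega>_0 absorbs the g minus signs of \<theta>; the d_i multiply
  to \<chi>(L), and g! counts the orders of the g factors.\<close>

lemma theta_power:
  assumes "Rep_even_form \<Theta> = theta ds"
  shows "Rep_even_form (\<Theta> ^ g) = (\<lambda>S. fact g * (of_nat (prod_list ds) * omega0 g S))"
proof -
  have "\<Theta> = (\<Sum>i<g. const_form (- of_nat (ds ! i)) * dxdx i)"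
    by (rule Rep_even_form_inject[THEN iffD1])
      (simp add: assms theta_def length_ds Rep_sum Rep_const_form_mult Rep_dxdx sum_negf fun_eq_iff)
  then have p: "\<Theta> ^ g = const_form (fact g * (\<Prod>i<g. - of_nat (ds ! i))) * (\<Prod>i<g. dxdx i)"
    using sum_wedge_power[OF dxdx_square, where g = g and b = "\<lambda>i. - of_nat (ds ! i)"] by simp
  have d: "(\<Prod>i<g. - of_nat (ds ! i)) = (-1) ^ g * (of_nat (prod_list ds) :: complex)"
  proof -
    have "prod_list ds = (\<Prod>i<g. ds ! i)" by (simp add: prod.list_conv_set_nth length_ds atLeast0LessThan)
    moreover have "(\<Prod>i<g. - of_nat (ds ! i)) = (\<Prod>i<g. (-1) * (of_nat (ds ! i) :: complex))" by simp
    ultimately show ?thesis unfolding prod.distrib by simp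
  qed
  have "(\<Prod>i<g. dxdx i) = prod_list (map dxdx [0..<g])"
    using prod.distinct_set_conv_list[of "[0..<g]" dxdx] by (simp add: atLeast0LessThan)
  moreover have "map Rep_even_form (map dxdx [0..<g]) = map (\<lambda>i. wedge (dx i) (dx (g + i))) [0..<g]"
    by (simp add: Rep_dxdx)
  ultimately have w: "Rep_even_form (\<Prod>i<g. dxdx i) = wedge_list (map (\<lambda>i. wedge (dx i) (dx (g + i))) [0..<g])"
    by (simp only: Rep_prod_list)
  show ?thesis
    unfolding p d Rep_const_form_mult w omega0_def by (simp add: mult_ac)
qed

end

section \<open>Eigenbasis of a class and its mixed powers with \<theta>\<close>

locale eigenbasis = siegel_torus +
  fixes \<omega> :: form and v :: "nat \<Rightarrow> complex vec" and a :: "nat \<Rightarrow> real"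
  assumes \<omega>: "\<omega> \<in> NS_rat ds Z"
    and v_mem: "k < g \<Longrightarrow> v k \<in> carrier_vec g"
    and v_on: "i < g \<Longrightarrow> j < g \<Longrightarrow> fst L (v i) (v j) = (if i = j then 1 else 0)"
    and eigen: "k < g \<Longrightarrow> endo \<omega> (v k) = complex_of_real (a k) \<cdot>\<^sub>v v k"

sublocale eigenbasis \<subseteq> orthonormal_basis g "fst L" v
  by unfold_locales (rule v_mem v_on; assumption)+

context eigenbasis
begin

text \<open>Coefficients, in the real coordinates, of the linear form w -> H w (v k), the k-th
  complex coordinate in the eigenbasis.\<close>

definition \<zeta> :: "nat \<Rightarrow> nat \<Rightarrow> complex" where
  "\<zeta> k i = H (col P i) (v k)"

text \<open>This is 1 / (2 i) times the wedge of \<zeta>_k with its conjugate, the imaginary part of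
  the rank one hermitian form given by \<zeta>_k. Writing it as a \<open>quad_form\<close> shows at
  once that it is even.\<close>

definition \<eta> :: "nat \<Rightarrow> even_form" where
  "\<eta> k = Abs_even_form (quad_form (2 * g) (\<lambda>i j. 1 / (2 * \<i>) * (\<zeta> k i * cnj (\<zeta> k j) - \<zeta> k j * cnj (\<zeta> k i))))"

lemma Rep_\<eta>:
  "Rep_even_form (\<eta> k) = (\<lambda>S. 1 / (2 * \<i>) * wedge (lin_form (2 * g) (\<zeta> k)) (lin_form (2 * g) (\<lambda>j. cnj (\<zeta> k j))) S)"
  unfolding \<eta>_def Abs_quad_form by (simp only: quad_form_scale wedge_lin_form)

lemma \<eta>_square: "\<eta> k * \<eta> k = 0"
  by (rule Rep_even_form_inject[THEN iffD1])
    (simp only: times_even_form.rep_eq zero_even_form.rep_eq Rep_\<eta> wedge_scale_left wedge_scale_right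
      wedge_lin_form_square mult_zero_right)

lemma H_endo: "w \<in> carrier_vec g \<Longrightarrow> k < g \<Longrightarrow> H (endo \<omega> w) (v k) = complex_of_real (a k) * H w (v k)"
  using endo_self_adjoint[OF \<omega>, of w "v k"] v_mem[of k] by (simp add: eigen H_smult_right)

lemma Rep_sum_\<eta>: "Rep_even_form (\<Sum>k<g. \<eta> k) = theta ds"
proof -
  have "quad_form (2 * g) (\<lambda>i j. complex_of_real (Im (H (col P i) (col P j)))) =
      (\<lambda>S. \<Sum>k<g. 1 / (2 * \<i>) * wedge (lin_form (2 * g) (\<zeta> k)) (lin_form (2 * g) (\<lambda>j. cnj (\<zeta> k j))) S)"
  proof (rule quad_form_Im)
    show "H (col P i) (col P j) = (\<Sum>k<g. 1 * (\<zeta> k i * cnj (\<zeta> k j)))" for i j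
      using parseval[OF col_P_carrier col_P_carrier] by (simp add: \<zeta>_def)
    show "H (col P j) (col P i) = cnj (H (col P i) (col P j))" for i j by (rule H_commute) simp_all
  qed
  then show ?thesis unfolding theta_eq E_def Rep_sum Rep_\<eta> by simp
qed

lemma Rep_sum_a_\<eta>: "Rep_even_form (\<Sum>k<g. const_form (complex_of_real (a k)) * \<eta> k) = \<omega>"
proof -
  have rat: "\<omega> \<in> rational_two_forms (2 * g)" using \<omega> by (simp add: NS_rat_def length_ds)
  have "quad_form (2 * g) (\<lambda>i j. complex_of_real (Im (herm \<omega> (col P i) (col P j)))) =
      (\<lambda>S. \<Sum>k<g. complex_of_real (a k) / (2 * \<i>) *
        wedge (lin_form (2 * g) (\<zeta> k)) (lin_form (2 * g) (\<lambda>j. cnj (\<zeta> k j))) S)"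
  proof (rule quad_form_Im)
    fix i j
    have "herm \<omega> (col P i) (col P j) = H (endo \<omega> (col P i)) (col P j)"
      by (simp add: endo(2)[OF \<omega>])
    also have "\<dots> = (\<Sum>k<g. H (endo \<omega> (col P i)) (v k) * cnj (H (col P j) (v k)))"
      by (rule parseval) (simp_all add: endo(1)[OF \<omega>])
    also have "\<dots> = (\<Sum>k<g. complex_of_real (a k) * (\<zeta> k i * cnj (\<zeta> k j)))"
      by (intro sum.cong refl) (simp add: H_endo \<zeta>_def)
    finally show "herm \<omega> (col P i) (col P j) = (\<Sum>k<g. complex_of_real (a k) * (\<zeta> k i * cnj (\<zeta> k j)))" .
    show "herm \<omega> (col P j) (col P i) = cnj (herm \<omega> (col P i) (col P j))"
      using hermitian_herm[OF \<omega>] col_P_carrier unfolding hermitian_form_def by blast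
  qed
  moreover have "quad_form (2 * g) (\<lambda>i j. complex_of_real (Im (herm \<omega> (col P i) (col P j)))) = \<omega>"
  proof -
    have "quad_form (2 * g) (\<lambda>i j. complex_of_real (Im (herm \<omega> (col P i) (col P j)))) =
        quad_form (2 * g) (\<lambda>i j. complex_of_real (coeff2 \<omega> i j))"
      by (rule quad_form_cong) (simp add: Im_herm bil_periods)
    then show ?thesis using rational_form_coeff[OF rat] by simp
  qed
  moreover have "Rep_even_form (\<Sum>k<g. const_form (complex_of_real (a k)) * \<eta> k) =
      (\<lambda>S. \<Sum>k<g. complex_of_real (a k) / (2 * \<i>) *
        wedge (lin_form (2 * g) (\<zeta> k)) (lin_form (2 * g) (\<lambda>j. cnj (\<zeta> k j))) S)"
    unfolding Rep_sum Rep_const_form_mult Rep_\<eta> by (intro ext sum.cong refl) simp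
  ultimately show ?thesis by (simp only:)
qed

text \<open>The power (t \<omega> + \<theta>)^g is expanded by the binomial theorem and by the
  product formula for square-zero elements. The product of the \<eta>_k is eliminated by means of
  \<theta>^g, which \<open>theta_power\<close> expresses through \<omega>_0.\<close>

lemma mixed_powers_identity:
  "(\<Sum>r\<le>g. of_nat (g choose r) * t ^ r * wedge (wedge_power \<omega> r) (wedge_power (theta ds) (g - r)) S) =
    fact g * (\<Prod>k<g. 1 + t * complex_of_real (a k)) * (of_nat (prod_list ds) * omega0 g S)"
proof -
  define \<Theta> where "\<Theta> = (\<Sum>k<g. \<eta> k)"
  define \<Omega> where "\<Omega> = (\<Sum>k<g. const_form (complex_of_real (a k)) * \<eta> k)"
  have rep: "Rep_even_form \<Theta> = theta ds" "Rep_even_form \<Omega> = \<omega>"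
    unfolding \<Theta>_def \<Omega>_def by (rule Rep_sum_\<eta>, rule Rep_sum_a_\<eta>)
  have "\<Theta> = (\<Sum>k<g. const_form 1 * \<eta> k)" by (simp add: \<Theta>_def const_form_1)
  then have \<Theta>g: "\<Theta> ^ g = const_form (fact g) * (\<Prod>k<g. \<eta> k)"
    using sum_wedge_power[OF \<eta>_square, where g = g and b = "\<lambda>k. 1"] by simp
  have "const_form t * \<Omega> + \<Theta> = (\<Sum>k<g. const_form (1 + t * complex_of_real (a k)) * \<eta> k)"
    unfolding \<Theta>_def \<Omega>_def sum_distrib_left sum.distrib[symmetric]
    by (intro sum.cong refl) (simp add: const_form_add const_form_mult const_form_1 distrib_right mult.assoc add.commute)
  then have "(const_form t * \<Omega> + \<Theta>) ^ g =
      const_form (fact g * (\<Prod>k<g. 1 + t * complex_of_real (a k))) * (\<Prod>k<g. \<eta> k)"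
    using sum_wedge_power[OF \<eta>_square, where g = g and b = "\<lambda>k. 1 + t * complex_of_real (a k)"] by simp
  also have "\<dots> = const_form (\<Prod>k<g. 1 + t * complex_of_real (a k)) * \<Theta> ^ g"
    unfolding \<Theta>g by (simp add: const_form_mult mult_ac)
  finally have l: "Rep_even_form ((const_form t * \<Omega> + \<Theta>) ^ g) S =
      (\<Prod>k<g. 1 + t * complex_of_real (a k)) * (fact g * (of_nat (prod_list ds) * omega0 g S))"
    by (simp only: Rep_const_form_mult theta_power[OF rep(1)])
  have "of_nat c * (const_form t * \<Omega>) ^ r * \<Theta> ^ s = const_form (of_nat c * t ^ r) * (\<Omega> ^ r * \<Theta> ^ s)" for c r s
    by (simp add: power_mult_distrib const_form_mult const_form_power const_form_of_nat mult_ac)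
  then have "(const_form t * \<Omega> + \<Theta>) ^ g = (\<Sum>r\<le>g. const_form (of_nat (g choose r) * t ^ r) * (\<Omega> ^ r * \<Theta> ^ (g - r)))"
    unfolding binomial_ring by (intro sum.cong refl)
  then have "Rep_even_form ((const_form t * \<Omega> + \<Theta>) ^ g) S =
      (\<Sum>r\<le>g. of_nat (g choose r) * t ^ r * wedge (wedge_power \<omega> r) (wedge_power (theta ds) (g - r)) S)"
    by (simp only: Rep_sum Rep_const_form_mult) (simp only: times_even_form.rep_eq Rep_power rep)
  then show ?thesis using l by (simp only: mult_ac)
qed

lemma conditions_iff:
  assumes n: "n \<le> g"
  shows "(\<forall>r. 1 \<le> r \<and> r \<le> g \<longrightarrow>
      wedge (wedge_power \<omega> r) (wedge_power (theta ds) (g - r)) =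
      (if r \<le> n
       then (\<lambda>S. of_nat (prod_list ds) * fact n *
                 (\<Prod>i = n + 1..g. of_nat i - of_nat r) * omega0 g S)
       else (\<lambda>S. 0))) \<longleftrightarrow>
    (\<forall>k<g. a k = 0 \<or> a k = 1) \<and> card {k. k < g \<and> a k = 1} = n"
proof -
  have "prod_list ds \<noteq> 0"
    using ds_pos length_ds by (auto simp: prod_list_zero_iff in_set_conv_nth)
  then have nz: "(\<lambda>S. of_nat (prod_list ds) * omega0 g S) \<noteq> (\<lambda>S. 0)"
    using omega0_nonzero[of g] by (auto simp: fun_eq_iff)
  have eq: "(if r \<le> n then (\<lambda>S. of_nat (prod_list ds) * fact n *
          (\<Prod>i = n + 1..g. of_nat i - of_nat r) * omega0 g S) else (\<lambda>S. 0)) =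
      (\<lambda>S. (if r \<le> n then fact n * (\<Prod>i = n + 1..g. of_nat i - of_nat r) else 0) *
        (of_nat (prod_list ds) * omega0 g S))" for r
    by (simp add: fun_eq_iff mult_ac)
  show ?thesis
    unfolding eq
    by (rule conditions_iff_eigenvalues[OF n nz mixed_powers_identity])
qed

end

section \<open>Abelian subvarieties and symmetric idempotents\<close>

lemma sum_in_Rats:
  fixes f :: "'i \<Rightarrow> 'a::field_char_0"
  shows "(\<And>i. i \<in> I \<Longrightarrow> f i \<in> \<rat>) \<Longrightarrow> (\<Sum>i\<in>I. f i) \<in> \<rat>"
  by (induction I rule: infinite_finite_induct) simp_all

context siegel_torus
begin

lemma unit_vec_expansion:
  fixes F :: "complex vec \<Rightarrow> complex"
  assumes "u \<in> carrier_vec g"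
    and "\<And>u w. u \<in> carrier_vec g \<Longrightarrow> w \<in> carrier_vec g \<Longrightarrow> F (u + w) = F u + F w"
    and "\<And>c w. w \<in> carrier_vec g \<Longrightarrow> F (c \<cdot>\<^sub>v w) = c * F w"
  shows "F u = (\<Sum>k<g. u $ k * F (unit_vec g k))"
proof -
  have "F (1\<^sub>m g *\<^sub>v u) = (\<Sum>k<g. u $ k * F (col (1\<^sub>m g) k))"
    by (rule mult_mat_vec_mem_and_linear(2)[where W = "carrier_vec g" and K = UNIV]) (use assms in auto)
  then show ?thesis using assms(1) by simp
qed

text \<open>Expanded in the standard basis, h is a combination of products of a dz_k with the
  conjugate of a dz_l. Every wedge in Im h thus has a factor dz_k, which is also a factor of the
  volume form. This is the converse direction to \<open>bil_i_i\<close>.\<close>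

lemma hermitian_form_wedge_volume:
  assumes h: "hermitian_form (carrier_vec g) h"
  shows "wedge (quad_form (2 * g) (\<lambda>i j. complex_of_real (Im (h (col P i) (col P j))))) volume = (\<lambda>S. 0)"
proof -
  have add: "\<And>u v w. u \<in> carrier_vec g \<Longrightarrow> v \<in> carrier_vec g \<Longrightarrow> w \<in> carrier_vec g \<Longrightarrow> h (u + v) w = h u w + h v w"
    and sc: "\<And>c v w. v \<in> carrier_vec g \<Longrightarrow> w \<in> carrier_vec g \<Longrightarrow> h (c \<cdot>\<^sub>v v) w = c * h v w"
    and cj: "\<And>v w. v \<in> carrier_vec g \<Longrightarrow> w \<in> carrier_vec g \<Longrightarrow> h w v = cnj (h v w)"
    using h unfolding hermitian_form_def by blast+
  let ?e = "unit_vec g :: nat \<Rightarrow> complex vec"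
  let ?c = "\<lambda>(k, l). h (?e k) (?e l)" and ?u = "\<lambda>(k, l :: nat) i. P $$ (k, i)"
    and ?w = "\<lambda>(k :: nat, l) j. cnj (P $$ (l, j))"
  have left: "h v w = (\<Sum>k<g. v $ k * h (?e k) w)" if "v \<in> carrier_vec g" "w \<in> carrier_vec g" for v w
    by (rule unit_vec_expansion[where F = "\<lambda>v. h v w"]) (use that add sc in auto)
  have right: "h v w = (\<Sum>l<g. cnj (w $ l) * h v (?e l))" if "v \<in> carrier_vec g" "w \<in> carrier_vec g" for v w
  proof -
    have "h v w = cnj (\<Sum>l<g. w $ l * h (?e l) v)"
      using cj[OF that(2,1)] left[OF that(2,1)] by simp
    also have "\<dots> = (\<Sum>l<g. cnj (w $ l) * h v (?e l))"
      unfolding cnj_sum complex_cnj_mult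
      by (intro sum.cong refl arg_cong2[of _ _ _ _ "(*)"]) (rule cj[symmetric]; simp add: that)
    finally show ?thesis .
  qed
  have q: "quad_form (2 * g) (\<lambda>i j. complex_of_real (Im (h (col P i) (col P j)))) =
      (\<lambda>S. \<Sum>t\<in>{..<g} \<times> {..<g}. ?c t / (2 * \<i>) * wedge (lin_form (2 * g) (?u t)) (lin_form (2 * g) (?w t)) S)"
  proof (rule quad_form_Im)
    fix i j assume ij: "i < 2 * g" "j < 2 * g"
    have "h (col P i) (col P j) = (\<Sum>k<g. \<Sum>l<g. h (?e k) (?e l) * (P $$ (k, i) * cnj (P $$ (l, j))))"
      unfolding left[OF col_P_carrier[of i] col_P_carrier[of j]] right[OF unit_vec_carrier col_P_carrier[of j]] sum_distrib_left
      by (intro sum.cong refl) (use ij in simp)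
    then show "h (col P i) (col P j) = (\<Sum>t\<in>{..<g} \<times> {..<g}. ?c t * (?u t i * ?w t j))"
      by (simp add: sum.cartesian_product split_def)
    show "h (col P j) (col P i) = cnj (h (col P i) (col P j))" by (rule cj) simp_all
  qed
  have z: "wedge (wedge (lin_form (2 * g) (?u t)) (lin_form (2 * g) (?w t))) volume = (\<lambda>S. 0)"
    if mem: "t \<in> {..<g} \<times> {..<g}" for t
  proof -
    obtain k l where t: "t = (k, l)" "k < g" using mem by (cases t) auto
    let ?A = "lin_form (2 * g) (\<lambda>i. P $$ (k, i))" and ?B = "lin_form (2 * g) (\<lambda>j. cnj (P $$ (l, j)))"
    have "wedge ?A volume = (\<lambda>S. 0)"
      unfolding volume_eq
      using wedge_lin_form_wedge_list[of k "[0..<g]" "2 * g" "\<lambda>k i. P $$ (k, i)"] t(2) by simp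
    then have "wedge (\<lambda>S. -1 * wedge ?B ?A S) volume = (\<lambda>S. 0)"
      unfolding wedge_scale_left wedge_assoc by (simp add: wedge_zero_right)
    moreover have "wedge ?A ?B = (\<lambda>S. -1 * wedge ?B ?A S)"
      unfolding wedge_lin_form_anticommute[of _ "\<lambda>i. P $$ (k, i)"] by simp
    ultimately show ?thesis unfolding t by simp
  qed
  show ?thesis
    unfolding q wedge_sum_left wedge_scale_left
    by (intro ext sum.neutral ballI) (simp only: z mult_zero_right)
qed

text \<open>The orthogonal projection p onto W is self-adjoint, so H (p v) w is hermitian and its
  imaginary part satisfies condition (a). It is rational on periods because the symplectic
  coordinates of a lattice vector are integers divided by the elementary divisors of W \<inter>
  \<Lambda>. Having a class with image \<open>epsilon\<close> is what lets \<open>alpha\<close>, an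
  inverse image, be evaluated.\<close>

lemma subvariety_form:
  assumes tan: "is_tangent_space g \<Lambda> X W" and nz: "W \<noteq> {0\<^sub>v g}"
  obtains \<omega> where "\<omega> \<in> NS_rat ds Z" "alpha ds Z L X = \<omega>"
    "\<forall>v\<in>carrier_vec g. endo \<omega> v \<in> W"
    "\<forall>v\<in>carrier_vec g. \<forall>w\<in>W. H (endo \<omega> v) w = H v w"
proof -
  have W: "complex_subspace g W" and lat: "lattice_in g W (W \<inter> \<Lambda>)"
    using tan by (simp_all add: is_tangent_space_def)
  have Wc: "w \<in> carrier_vec g" if "w \<in> W" for w using W that by (auto simp: complex_subspace_iff)
  obtain B es where sc: "symplectic_columns B es" and lb: "lattice_basis g W (W \<inter> \<Lambda>) B"
    by (rule subtorus_symplectic_basis[OF W lat])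
  have B: "B \<in> carrier_mat g (2 * length es)" using sc by (simp add: symplectic_columns_def)
  have dc: "dim_col B = 2 * length es" using B by simp
  have colB: "col B j \<in> \<Lambda>" if "j < 2 * length es" for j
    using lattice_basis_facts(3)[OF lb] that dc by auto
  define p where "p v = B *\<^sub>v map_vec complex_of_real (symplectic_coords B es v)" for v
  have pW: "p v \<in> W" and pH: "\<And>w. w \<in> W \<Longrightarrow> H (p v) w = H v w" if "v \<in> carrier_vec g" for v
    using symplectic_projection[OF W sc lb that] by (simp_all add: p_def)
  have sa: "H (p v) w = H v (p w)" if vw: "v \<in> carrier_vec g" "w \<in> carrier_vec g" for v w
  proof -
    have "H (p v) w = cnj (H w (p v))" by (rule H_commute[OF vw(2) Wc[OF pW[OF vw(1)]]])
    also have "\<dots> = cnj (H (p w) (p v))" by (simp only: pH[OF vw(2) pW[OF vw(1)]])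
    also have "\<dots> = H (p v) (p w)"
      by (rule H_commute[OF Wc[OF pW[OF vw(2)]] Wc[OF pW[OF vw(1)]], symmetric])
    also have "\<dots> = H v (p w)" by (rule pH[OF vw(1) pW[OF vw(2)]])
    finally show ?thesis .
  qed
  define h where "h v w = (if v \<in> carrier_vec g \<and> w \<in> carrier_vec g then H (p v) w else 0)" for v w
  have h: "hermitian_form (carrier_vec g) h"
    unfolding hermitian_form_def
  proof (intro conjI allI impI ballI)
    show "h v w = 0" if "v \<notin> carrier_vec g \<or> w \<notin> carrier_vec g" for v w using that by (auto simp: h_def)
    show "h (u + v) w = h u w + h v w" if "u \<in> carrier_vec g" "v \<in> carrier_vec g" "w \<in> carrier_vec g" for u v w
      using that by (simp add: h_def sa H_add_left Wc pW)
    show "h (c \<cdot>\<^sub>v v) w = c * h v w" if "v \<in> carrier_vec g" "w \<in> carrier_vec g" for c v w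
      using that by (simp add: h_def sa H_smult_left Wc pW)
    show "h w v = cnj (h v w)" if vw: "v \<in> carrier_vec g" "w \<in> carrier_vec g" for v w
    proof -
      have "H (p w) v = cnj (H v (p w))" by (rule H_commute[OF vw(1) Wc[OF pW[OF vw(2)]]])
      then show ?thesis using vw by (simp add: h_def sa[OF vw])
    qed
  qed
  define \<omega> where "\<omega> = quad_form (2 * g) (\<lambda>i j. complex_of_real (Im (h (col P i) (col P j))))"
  have rat: "Im (h (col P i) (col P j)) \<in> \<rat>" if ij: "i < 2 * g" "j < 2 * g" for i j
  proof -
    have per: "col P k \<in> \<Lambda>" if "k < 2 * g" for k
      using lattice_basis_facts(3)[OF period_basis] that by simp
    have "symplectic_coords B es (col P i) $ k \<in> \<rat>" if k: "k < 2 * length es" for k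
    proof -
      have E: "E (col P i) (col B l) \<in> \<rat>" if "l < 2 * length es" for l
        using E_integral[OF per[OF ij(1)] colB[OF that]] Ints_subset_Rats by blast
      show ?thesis
        using k E[of "length es + k"] E[of "k - length es"] by (simp add: symplectic_coords_def)
    qed
    moreover have "E (col B k) (col P j) \<in> \<rat>" if "k < 2 * length es" for k
      using E_integral[OF colB[OF that] per[OF ij(2)]] Ints_subset_Rats by blast
    moreover have "Im (h (col P i) (col P j)) =
        (\<Sum>k<2 * length es. symplectic_coords B es (col P i) $ k * E (col B k) (col P j))"
      using E_mult_mat_vec[OF B symplectic_coords_carrier col_P_carrier]
      by (simp add: h_def p_def E_def)
    ultimately show ?thesis by (auto intro!: sum_in_Rats)
  qed
  have \<omega>rat: "\<omega> \<in> rational_two_forms (2 * g)"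
    unfolding rational_two_forms_def
  proof (intro CollectI conjI allI impI)
    fix S
    have "\<omega> S \<in> \<rat> \<and> (\<omega> S \<noteq> 0 \<longrightarrow> S \<subseteq> {..<2 * g} \<and> card S = 2)"
    proof (cases "\<omega> S = 0")
      case False
      then obtain i j where ij: "i < j" "j < 2 * g" "S = {i, j}"
        unfolding \<omega>_def by (rule quad_form_nonzeroE)
      have "Im (h (col P i) (col P j)) \<in> \<rat>" using rat ij by simp
      then have "complex_of_real (Im (h (col P i) (col P j))) \<in> \<rat>"
        by (elim Rats_cases') simp
      then show ?thesis using ij by (simp add: \<omega>_def quad_form_eval)
    qed simp
    then show "\<omega> S \<in> \<rat>" "\<omega> S \<noteq> 0 \<Longrightarrow> S \<subseteq> {..<2 * g}" "\<omega> S \<noteq> 0 \<Longrightarrow> card S = 2" by blast+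
  qed
  have \<omega>NS: "\<omega> \<in> NS_rat ds Z"
    using \<omega>rat hermitian_form_wedge_volume[OF h] by (simp add: NS_rat_def length_ds \<omega>_def)
  have herm: "h v w = herm \<omega> v w" for v w
  proof -
    have "Im (h (col P i) (col P j)) = 1 * coeff2 \<omega> i j" if ij: "i < j" "j < 2 * g" for i j
    proof -
      have "\<omega> {i, j} = complex_of_real (Im (h (col P i) (col P j)))"
        unfolding \<omega>_def by (rule quad_form_eval[OF ij])
      then show ?thesis using ij by (simp add: coeff2_def)
    qed
    from hermitian_form_eq_herm[OF h this] show ?thesis by simp
  qed
  have endo_p: "endo \<omega> v = p v" if v: "v \<in> carrier_vec g" for v
  proof (rule eq_if_H_eq[OF endo(1)[OF \<omega>NS v] Wc[OF pW[OF v]]])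
    fix w :: "complex vec" assume "w \<in> carrier_vec g"
    then show "H (endo \<omega> v) w = H (p v) w"
      unfolding endo(2)[OF \<omega>NS v] herm[symmetric] using v by (simp add: h_def)
  qed
  have "epsilon g \<Lambda> L X = NS_to_End ds Z L \<omega>"
  proof
    fix v
    show "epsilon g \<Lambda> L X v = NS_to_End ds Z L \<omega> v"
    proof (cases "v \<in> carrier_vec g")
      case True
      then show ?thesis
        using epsilon_eq[OF tan nz True pW[OF True] pH[OF True]]
        by (simp add: NS_to_End_eq[OF \<omega>NS] endo_p)
    qed (simp add: NS_to_End_eq[OF \<omega>NS] epsilon_def)
  qed
  then have "alpha ds Z L X = \<omega>"
    unfolding alpha_def length_ds by (simp add: the_inv_into_f_f[OF inj_NS_to_End \<omega>NS])
  then show thesis using \<omega>NS endo_p pW pH by (intro that) auto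
qed

lemma exists_eigenbasis:
  assumes "\<omega> \<in> NS_rat ds Z"
  obtains v a where "eigenbasis g ds Z L \<omega> v a"
proof -
  obtain v a where "\<And>i. i < g \<Longrightarrow> v i \<in> carrier_vec g"
    "\<And>i. i < g \<Longrightarrow> endo \<omega> (v i) = complex_of_real (a i) \<cdot>\<^sub>v v i"
    "\<And>i j. i < g \<Longrightarrow> j < g \<Longrightarrow> H (v i) (v j) = (if i = j then 1 else 0)"
    by (rule spectral_theorem[of "endo \<omega>"]) (use endo(1) endo_self_adjoint assms in auto)
  then have "eigenbasis g ds Z L \<omega> v a"
    by unfold_locales (use assms in simp_all)
  then show thesis by (rule that)
qed

text \<open>Serves to exclude W = {0} when n is at least 1; there the type would be the empty list
  and the exponent meaningless.\<close>

lemma complex_dim_zero: "complex_dim g {0\<^sub>v g} = 0"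
proof -
  obtain v where "orthonormal_basis g H v" using exists_orthonormal_basis by blast
  then interpret orthonormal_basis g H v .
  have "{0\<^sub>v g} = {w \<in> carrier_vec g. \<forall>k<g. k \<notin> {} \<longrightarrow> H w (v k) = 0}"
    using eq_0_if_orthogonal by (auto simp: H_zero_left v_carrier)
  from complex_dim_eq_card[OF _ this] show ?thesis by simp
qed

end

context eigenbasis
begin

lemma fixed_space_eq:
  assumes a: "\<And>k. k < g \<Longrightarrow> a k = 0 \<or> a k = 1"
  shows "{w \<in> carrier_vec g. endo \<omega> w = w} =
    {w \<in> carrier_vec g. \<forall>k<g. k \<notin> {k. k < g \<and> a k = 1} \<longrightarrow> H w (v k) = 0}"
proof (intro equalityI subsetI)
  fix w assume "w \<in> {w \<in> carrier_vec g. endo \<omega> w = w}"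
  then have w: "w \<in> carrier_vec g" "endo \<omega> w = w" by auto
  have "H w (v k) = 0" if "k < g" "a k \<noteq> 1" for k
    using H_endo[OF w(1) that(1)] a[OF that(1)] that(2) w(2) by simp
  then show "w \<in> {w \<in> carrier_vec g. \<forall>k<g. k \<notin> {k. k < g \<and> a k = 1} \<longrightarrow> H w (v k) = 0}"
    using w(1) by blast
next
  fix w assume "w \<in> {w \<in> carrier_vec g. \<forall>k<g. k \<notin> {k. k < g \<and> a k = 1} \<longrightarrow> H w (v k) = 0}"
  then have w: "w \<in> carrier_vec g" "\<And>k. k < g \<Longrightarrow> a k \<noteq> 1 \<Longrightarrow> H w (v k) = 0" by auto
  have e: "endo \<omega> w \<in> carrier_vec g" by (rule endo(1)[OF \<omega> w(1)])
  have "endo \<omega> w - w = 0\<^sub>v g"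
  proof (rule eq_0_if_orthogonal)
    fix k assume k: "k < g"
    show "H (endo \<omega> w - w) (v k) = 0"
      using H_endo[OF w(1) k] w(2)[OF k] H_diff_left[OF e w(1) v_mem[OF k]] by (cases "a k = 1") auto
  qed (use e w in simp)
  then have "endo \<omega> w = w" by (rule vec_eq_if_diff_eq_0[OF e w(1)])
  then show "w \<in> {w \<in> carrier_vec g. endo \<omega> w = w}" using w(1) by simp
qed

lemma complex_dim_fixed_space:
  assumes "\<And>k. k < g \<Longrightarrow> a k = 0 \<or> a k = 1"
  shows "complex_dim g {w \<in> carrier_vec g. endo \<omega> w = w} = card {k. k < g \<and> a k = 1}"
  by (rule complex_dim_eq_card[OF _ fixed_space_eq[OF assms]]) auto

lemma eigenvalues_idempotent:
  assumes "\<And>w. w \<in> carrier_vec g \<Longrightarrow> endo \<omega> (endo \<omega> w) = endo \<omega> w" and k: "k < g"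
  shows "a k = 0 \<or> a k = 1"
proof -
  have c: "endo \<omega> (v k) \<in> carrier_vec g" by (rule endo(1)[OF \<omega> v_mem[OF k]])
  have "complex_of_real (a k) * (complex_of_real (a k) * H (v k) (v k)) = complex_of_real (a k) * H (v k) (v k)"
    using H_endo[OF c k] H_endo[OF v_mem[OF k] k] assms(1)[OF v_mem[OF k]] by simp
  then have "complex_of_real (a k * a k) = complex_of_real (a k)" using v_on[OF k k] by simp
  then have "a k * a k = a k" by (simp only: of_real_eq_iff)
  then show ?thesis by simp
qed

lemma idempotent_if_eigenvalues:
  assumes a: "\<And>k. k < g \<Longrightarrow> a k = 0 \<or> a k = 1" and w: "w \<in> carrier_vec g"
  shows "endo \<omega> (endo \<omega> w) = endo \<omega> w"
proof -
  have e: "endo \<omega> w \<in> carrier_vec g" by (rule endo(1)[OF \<omega> w])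
  have "endo \<omega> w \<in> {w \<in> carrier_vec g. \<forall>k<g. k \<notin> {k. k < g \<and> a k = 1} \<longrightarrow> H w (v k) = 0}"
    using e H_endo[OF w] a by force
  then have "endo \<omega> w \<in> {w \<in> carrier_vec g. endo \<omega> w = w}" by (simp only: fixed_space_eq[OF a])
  then show ?thesis by simp
qed

end

section \<open>The correspondence between subvarieties and numerical classes\<close>

context siegel_torus
begin

lemma tangent_space_eq_fixed_space:
  assumes W: "complex_subspace g W" and \<omega>: "\<omega> \<in> NS_rat ds Z"
    and p: "\<And>v. v \<in> carrier_vec g \<Longrightarrow> endo \<omega> v \<in> W"
      "\<And>v w. v \<in> carrier_vec g \<Longrightarrow> w \<in> W \<Longrightarrow> H (endo \<omega> v) w = H v w"
  shows "W = {w \<in> carrier_vec g. endo \<omega> w = w}"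
proof (intro equalityI subsetI)
  fix w assume w: "w \<in> W"
  then have wc: "w \<in> carrier_vec g" using W by (auto simp: complex_subspace_iff)
  have "endo \<omega> w = w" by (rule projection_unique[OF W p(1)[OF wc] w]) (rule p(2)[OF wc])
  then show "w \<in> {w \<in> carrier_vec g. endo \<omega> w = w}" using wc by simp
next
  fix w assume "w \<in> {w \<in> carrier_vec g. endo \<omega> w = w}"
  then show "w \<in> W" using p(1)[of w] by auto
qed

text \<open>With f = \<open>endo \<omega>\<close> rational on the periods, one N makes N
  f(\<lambda>) a lattice point of W for every column \<lambda> of P. These points detect a vector u
  = f u of W: by self-adjointness E u (f \<lambda>) = E (f u) \<lambda> = E u \<lambda>, and
  pairings with the columns of P determine u.\<close>

lemma idempotent_lattice:
  assumes \<omega>: "\<omega> \<in> NS_rat ds Z"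
    and idem: "\<And>w. w \<in> carrier_vec g \<Longrightarrow> endo \<omega> (endo \<omega> w) = endo \<omega> w"
  defines "W \<equiv> {w \<in> carrier_vec g. endo \<omega> w = w}"
  shows "complex_subspace g W" "lattice_in g W (W \<inter> \<Lambda>)"
proof -
  have rat: "\<omega> \<in> rational_two_forms (2 * g)" using \<omega> by (simp add: NS_rat_def length_ds)
  note e = endo(1)[OF \<omega>] and sa = endo_self_adjoint[OF \<omega>]
  have add: "endo \<omega> (u + w) = endo \<omega> u + endo \<omega> w" if "u \<in> carrier_vec g" "w \<in> carrier_vec g" for u w
    by (rule self_adjoint_linear(1)[of "endo \<omega>"]) (use e sa that in auto)
  have sc: "endo \<omega> (c \<cdot>\<^sub>v w) = c \<cdot>\<^sub>v endo \<omega> w" if "w \<in> carrier_vec g" for c w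
    by (rule self_adjoint_linear(2)[of "endo \<omega>"]) (use e sa that in auto)
  have zero: "endo \<omega> (0\<^sub>v g) = 0\<^sub>v g"
  proof -
    have "endo \<omega> (0 \<cdot>\<^sub>v 0\<^sub>v g) = 0 \<cdot>\<^sub>v endo \<omega> (0\<^sub>v g)" by (rule sc) simp
    moreover have "(0::complex) \<cdot>\<^sub>v 0\<^sub>v g = 0\<^sub>v g" by auto
    moreover have "0 \<cdot>\<^sub>v endo \<omega> (0\<^sub>v g) = 0\<^sub>v g" using e[of "0\<^sub>v g"] by (intro eq_vecI) auto
    ultimately show ?thesis by simp
  qed
  show W: "complex_subspace g W" unfolding complex_subspace_iff W_def using add sc zero by auto
  have E_sa: "E (endo \<omega> u) w = E u (endo \<omega> w)" if "u \<in> carrier_vec g" "w \<in> carrier_vec g" for u w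
    using sa[OF that] by (simp add: E_def)
  have xr: "xc (endo \<omega> (col P i)) j \<in> \<rat>" if "i < 2 * g" "j < 2 * g" for i j
  proof -
    have E: "E (endo \<omega> (col P i)) (col P k) \<in> \<rat>" if "k < 2 * g" for k
    proof -
      have "E (endo \<omega> (col P i)) (col P k) = Im (herm \<omega> (col P i) (col P k))"
        by (simp add: E_def endo(2)[OF \<omega>])
      also have "\<dots> = coeff2 \<omega> i k" using that \<open>i < 2 * g\<close> by (simp add: Im_herm bil_periods)
      finally show ?thesis using coeff2_Rats[OF rat] by simp
    qed
    show ?thesis using E[of "g + j"] E[of "j - g"] that by (simp add: xc_def)
  qed
  obtain N :: nat where N: "0 < N"
    "\<And>i j. i < 2 * g \<Longrightarrow> j < 2 * g \<Longrightarrow> of_nat N * xc (endo \<omega> (col P i)) j \<in> \<int>"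
    using common_denominator[of "{..<2 * g} \<times> {..<2 * g}" "\<lambda>q. xc (endo \<omega> (col P (fst q))) (snd q)"] xr by auto
  have member: "complex_of_real (real N) \<cdot>\<^sub>v endo \<omega> (col P i) \<in> W \<inter> \<Lambda>" if i: "i < 2 * g" for i
  proof
    have ec: "endo \<omega> (col P i) \<in> carrier_vec g" by (rule e) simp
    show "complex_of_real (real N) \<cdot>\<^sub>v endo \<omega> (col P i) \<in> \<Lambda>"
      by (rule lattice_if_xc_Ints) (use ec N(2) i in \<open>simp_all only: smult_carrier_vec xc_smult\<close>)
    have "endo \<omega> (complex_of_real (real N) \<cdot>\<^sub>v endo \<omega> (col P i)) = complex_of_real (real N) \<cdot>\<^sub>v endo \<omega> (col P i)"
      by (simp only: sc[OF ec] idem[OF col_P_carrier])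
    then show "complex_of_real (real N) \<cdot>\<^sub>v endo \<omega> (col P i) \<in> W" using ec by (simp add: W_def)
  qed
  obtain B es where "lattice_basis g W (W \<inter> \<Lambda>) B"
  proof (rule nondegenerate_subtorus[OF W])
    fix u assume u: "u \<in> W" and orth: "\<And>m. m \<in> W \<inter> \<Lambda> \<Longrightarrow> E u m = 0"
    have uc: "u \<in> carrier_vec g" and fu: "endo \<omega> u = u" using u by (auto simp: W_def)
    have "E u (col P i) = 0" if i: "i < 2 * g" for i
    proof -
      have ec: "endo \<omega> (col P i) \<in> carrier_vec g" by (rule e) simp
      have "real N * E u (endo \<omega> (col P i)) = 0"
        using orth[OF member[OF i]] by (simp only: E_smult_right[OF ec uc])
      then have "E u (endo \<omega> (col P i)) = 0" using N(1) by simp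
      then show ?thesis using E_sa[OF uc col_P_carrier[of i]] fu by simp
    qed
    then have "xc u j = 0" if "j < 2 * g" for j using that by (simp add: xc_def)
    then have "vec (2 * g) (xc u) = 0\<^sub>v (2 * g)" by (intro eq_vecI) simp_all
    then have mz: "map_vec complex_of_real (vec (2 * g) (xc u)) = 0\<^sub>v (2 * g)" by auto
    have "P *\<^sub>v 0\<^sub>v (2 * g) = u" using mult_xc[OF uc] unfolding mz .
    moreover have "P *\<^sub>v 0\<^sub>v (2 * g) = 0\<^sub>v g" by (intro eq_vecI) (simp_all add: scalar_prod_def)
    ultimately show "u = 0\<^sub>v g" by simp
  qed auto
  then show "lattice_in g W (W \<inter> \<Lambda>)" by (auto simp: lattice_in_def)
qed

definition subvarieties :: "nat \<Rightarrow> complex vec set set set" where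
  "subvarieties n = {X. abelian_subvariety g \<Lambda> X \<and> variety_dim g \<Lambda> X = n}"

definition numerical_classes :: "nat \<Rightarrow> form set" where
  "numerical_classes n = {\<omega> \<in> NS_rat ds Z. \<forall>r. 1 \<le> r \<and> r \<le> g \<longrightarrow>
      wedge (wedge_power \<omega> r) (wedge_power (theta ds) (g - r)) =
      (if r \<le> n
       then (\<lambda>S. of_nat (prod_list ds) * fact n *
                 (\<Prod>i = n + 1..g. of_nat i - of_nat r) * omega0 g S)
       else (\<lambda>S. 0))}"

text \<open>The last clause reconstructs X from its class as the image of the fixed space of the
  endomorphism, which yields injectivity. The dimension n enters the numerical conditions as the
  number of eigenvalues 1, the dimension of that fixed space.\<close>

lemma subvarieties_cases:
  assumes X: "X \<in> subvarieties n" and n: "1 \<le> n" "n \<le> g"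
  obtains \<omega> where "alpha ds Z L X = \<omega>" "\<omega> \<in> numerical_classes n"
    "X = torus_point \<Lambda> ` {w \<in> carrier_vec g. endo \<omega> w = w}"
proof -
  obtain W where tan: "is_tangent_space g \<Lambda> X W" using X by (auto simp: subvarieties_def abelian_subvariety_def)
  have dim: "complex_dim g W = n" using X tangent_space_eq[OF tan] by (simp add: subvarieties_def variety_dim_def)
  have nz: "W \<noteq> {0\<^sub>v g}" using dim n complex_dim_zero by auto
  obtain \<omega> where NS: "\<omega> \<in> NS_rat ds Z" and alpha: "alpha ds Z L X = \<omega>"
    and proj: "\<forall>v\<in>carrier_vec g. endo \<omega> v \<in> W" "\<forall>v\<in>carrier_vec g. \<forall>w\<in>W. H (endo \<omega> v) w = H v w"
    by (rule subvariety_form[OF tan nz])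
  have p: "\<And>v. v \<in> carrier_vec g \<Longrightarrow> endo \<omega> v \<in> W"
      "\<And>v w. v \<in> carrier_vec g \<Longrightarrow> w \<in> W \<Longrightarrow> H (endo \<omega> v) w = H v w"
    using proj by blast+
  have W: "complex_subspace g W" using tan by (simp add: is_tangent_space_def)
  have fix_W: "W = {w \<in> carrier_vec g. endo \<omega> w = w}"
    by (rule tangent_space_eq_fixed_space[OF W NS p])
  obtain v a where "eigenbasis g ds Z L \<omega> v a" by (rule exists_eigenbasis[OF NS])
  then interpret eigenbasis g ds Z L \<omega> v a .
  have a: "a k = 0 \<or> a k = 1" if "k < g" for k
    by (rule eigenvalues_idempotent[OF _ that]) (use p(1) fix_W in blast)
  have "card {k. k < g \<and> a k = 1} = n"
    using complex_dim_fixed_space[OF a] dim fix_W by simp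
  then have "\<omega> \<in> numerical_classes n"
    using NS a unfolding numerical_classes_def mem_Collect_eq conditions_iff[OF n(2)] by blast
  moreover have "X = torus_point \<Lambda> ` W" using tan by (simp add: is_tangent_space_def)
  ultimately show thesis using that[OF alpha] fix_W by simp
qed

text \<open>The candidate X is the image of the fixed space W of \<open>endo \<omega>\<close>. That
  its class is \<omega> again follows from recognizing both endomorphisms as the orthogonal
  projection onto W and applying \<open>inj_NS_to_End\<close>.\<close>

lemma numerical_classes_cases:
  assumes cls: "\<omega> \<in> numerical_classes n" and n: "1 \<le> n" "n \<le> g"
  shows "\<exists>X\<in>subvarieties n. alpha ds Z L X = \<omega>"
proof -
  have NS: "\<omega> \<in> NS_rat ds Z" using cls by (simp add: numerical_classes_def)
  obtain v a where "eigenbasis g ds Z L \<omega> v a" by (rule exists_eigenbasis[OF NS])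
  then interpret eigenbasis g ds Z L \<omega> v a .
  have a: "\<And>k. k < g \<Longrightarrow> a k = 0 \<or> a k = 1" and card: "card {k. k < g \<and> a k = 1} = n"
    using cls unfolding numerical_classes_def mem_Collect_eq conditions_iff[OF n(2)] by blast+
  define W where "W = {w \<in> carrier_vec g. endo \<omega> w = w}"
  define X where "X = torus_point \<Lambda> ` W"
  have idem: "endo \<omega> (endo \<omega> w) = endo \<omega> w" if "w \<in> carrier_vec g" for w
    by (rule idempotent_if_eigenvalues[OF a that])
  have tan: "is_tangent_space g \<Lambda> X W"
    using idempotent_lattice[OF NS idem] by (simp add: is_tangent_space_def X_def W_def)
  have dim: "complex_dim g W = n" using complex_dim_fixed_space[OF a] card by (simp add: W_def)
  have XS: "X \<in> subvarieties n"
    using tan dim tangent_space_eq[OF tan] by (auto simp: subvarieties_def abelian_subvariety_def variety_dim_def)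
  have nz: "W \<noteq> {0\<^sub>v g}" using dim n complex_dim_zero by auto
  obtain \<omega>' where \<omega>': "\<omega>' \<in> NS_rat ds Z" "alpha ds Z L X = \<omega>'"
    and p: "\<forall>v\<in>carrier_vec g. endo \<omega>' v \<in> W" "\<forall>v\<in>carrier_vec g. \<forall>w\<in>W. H (endo \<omega>' v) w = H v w"
    by (rule subvariety_form[OF tan nz])
  have W: "complex_subspace g W" using tan by (simp add: is_tangent_space_def)
  have "endo \<omega>' w = endo \<omega> w" if w: "w \<in> carrier_vec g" for w
  proof (rule projection_unique[OF W])
    show "endo \<omega>' w \<in> W" using p(1) w by blast
    show "endo \<omega> w \<in> W" using idem[OF w] endo(1)[OF NS w] by (simp add: W_def)
    fix u assume u: "u \<in> W"
    then have "endo \<omega> u = u" "u \<in> carrier_vec g" by (simp_all add: W_def)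
    then show "H (endo \<omega>' w) u = H (endo \<omega> w) u"
      using bspec[OF bspec[OF p(2) w] u] endo_self_adjoint[OF NS w, of u] by simp
  qed
  then have "NS_to_End ds Z L \<omega>' = NS_to_End ds Z L \<omega>"
    unfolding NS_to_End_eq[OF NS] NS_to_End_eq[OF \<omega>'(1)] by (intro restrict_ext)
  then have "\<omega>' = \<omega>" using inj_onD[OF inj_NS_to_End _ \<omega>'(1) NS] by blast
  then show ?thesis using XS \<omega>'(2) by blast
qed

lemma bij_betw_alpha:
  assumes n: "1 \<le> n" "n \<le> g"
  shows "bij_betw (alpha ds Z L) (subvarieties n) (numerical_classes n)"
  unfolding bij_betw_def
proof
  show "inj_on (alpha ds Z L) (subvarieties n)"
  proof (rule inj_onI)
    fix X Y assume X: "X \<in> subvarieties n" and Y: "Y \<in> subvarieties n" and eq: "alpha ds Z L X = alpha ds Z L Y"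
    obtain \<omega> where "alpha ds Z L X = \<omega>" "X = torus_point \<Lambda> ` {w \<in> carrier_vec g. endo \<omega> w = w}"
      by (rule subvarieties_cases[OF X n])
    moreover obtain \<omega>' where "alpha ds Z L Y = \<omega>'" "Y = torus_point \<Lambda> ` {w \<in> carrier_vec g. endo \<omega>' w = w}"
      by (rule subvarieties_cases[OF Y n])
    ultimately show "X = Y" using eq by simp
  qed
  show "alpha ds Z L ` subvarieties n = numerical_classes n"
  proof (intro equalityI subsetI)
    fix \<omega> assume "\<omega> \<in> alpha ds Z L ` subvarieties n"
    then obtain X where X: "X \<in> subvarieties n" "\<omega> = alpha ds Z L X" by blast
    show "\<omega> \<in> numerical_classes n" by (rule subvarieties_cases[OF X(1) n]) (simp add: X(2))
  next
    fix \<omega> assume "\<omega> \<in> numerical_classes n"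
    then show "\<omega> \<in> alpha ds Z L ` subvarieties n" using numerical_classes_cases[OF _ n] by blast
  qed
qed

end

theorem theorem4p1:
  fixes g n :: nat and ds :: "nat list" and Z :: "complex mat" and L :: line_bundle
  assumes "length ds = g" and "elementary_divisors ds" and "Z \<in> siegel_space g"
    and "polarization (carrier_vec g) (period_lattice ds Z) L"
    and "chern_class (period_matrix ds Z) L = theta ds"
    and "1 \<le> n" and "n \<le> g"
  shows "bij_betw (alpha ds Z L)
    {X. abelian_subvariety g (period_lattice ds Z) X \<and>
        variety_dim g (period_lattice ds Z) X = n}
    {\<omega> \<in> rational_two_forms (2 * g).
       wedge \<omega> (wedge_list (map (dz ds Z) [0..<g])) = (\<lambda>S. 0) \<and>
       (\<forall>r. 1 \<le> r \<and> r \<le> g \<longrightarrow>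
          wedge (wedge_power \<omega> r) (wedge_power (theta ds) (g - r)) =
          (if r \<le> n
           then (\<lambda>S. of_nat (prod_list ds) * fact n *
                     (\<Prod>i = n + 1..g. of_nat i - of_nat r) * omega0 g S)
           else (\<lambda>S. 0)))}"
proof -
  interpret siegel_torus g ds Z L
    by unfold_locales (rule assms)+
  have "numerical_classes n = {\<omega> \<in> rational_two_forms (2 * g).
       wedge \<omega> (wedge_list (map (dz ds Z) [0..<g])) = (\<lambda>S. 0) \<and>
       (\<forall>r. 1 \<le> r \<and> r \<le> g \<longrightarrow>
          wedge (wedge_power \<omega> r) (wedge_power (theta ds) (g - r)) =
          (if r \<le> n
           then (\<lambda>S. of_nat (prod_list ds) * fact n *
                     (\<Prod>i = n + 1..g. of_nat i - of_nat r) * omega0 g S)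
           else (\<lambda>S. 0)))}"
    unfolding numerical_classes_def NS_rat_def length_ds by blast
  then show ?thesis
    using bij_betw_alpha[OF assms(6,7)] unfolding subvarieties_def by (simp only:)
qed

end
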